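(* Let $(X_n)_{n\in\mathbb{N}}$ be a stationary, strongly mixing sequence of real random variables with distribution function $F$, with $\mathbb{E}|X_1|^{\rho}<\infty$ for some $\rho\ge 1$ and mixing coefficients $\alpha(l)=O(l^{-\delta})$ for some $\delta>\frac{2\rho+1}{\rho}$. Let $m\ge 2$ and let $h:\mathbb{R}^m\to\mathbb{R}$ be a Lipschitz-continuous kernel such that the distribution function $H_F$ has a density $h_F$ with $h_F>0$ and $h_F$ bounded, and such that for all $2\le k\le m$ and all $i_1<i_2<\dots<i_m$ the density $h_{F;X_{i_2},\ldots,X_{i_k}}$ is bounded. Let $p\in(0,1)$, $\xi_p=H_F^{-1}(p)$ and $\hat\xi_p=H_n^{-1}(p)$. Then, as $n\to\infty$, $$\hat\xi_p=\xi_p+\frac{H_F(\xi_p)-H_n(\xi_p)}{h_F(\xi_p)}+o_p\Big(\frac{1}{\sqrt n}\Big).$$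
   Context: A kernel is a measurable function $h:\mathbb{R}^m\to\mathbb{R}$ that is symmetric in its arguments. For a stationary process $(X_n)_{n\in\mathbb{N}}$ the strong mixing coefficients are $$\alpha(k)=\sup_{n\in\mathbb{N}}\sup\{|\mathbb{P}(A\cap B)-\mathbb{P}(A)\mathbb{P}(B)|: A\in\mathcal{F}_1^n,\ B\in\mathcal{F}_{n+k}^\infty\},$$ where $\mathcal{F}_a^b$ is the $\sigma$-field generated by $X_a,\ldots,X_b$; the process is strongly mixing if $\alpha(k)\to0$ as $k\to\infty$. The random variables $Y_1,Y_2,\ldots$ are independent copies of $X_1$ (independent of each other and of $(X_n)$). $H_F(y)=\mathbb{P}(h(Y_1,\ldots,Y_m)\le y)$ is the distribution function of the kernel under independence, and $h_F$ is its density. For $2\le k\le m$ and $i_1<\dots<i_m$, $h_{F;X_{i_2},\ldots,X_{i_k}}$ denotes the density of $h(Y_{i_1},X_{i_2},\ldots,X_{i_k},Y_{i_{k+1}},\ldots,Y_{i_m})$. The empirical distribution function of the kernel is $$H_n(x)=\frac{1}{\binom{n}{m}}\sum_{1\le i_1<\ldots<i_m\le n}1_{[h(X_{i_1},\ldots,X_{i_m})\le x]},$$ and generalized inverses are $H_n^{-1}(p)=\inf\{x: H_n(x)\ge p\}$, and likewise $H_F^{-1}(p)=\inf\{x:H_F(x)\ge p\}$.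
   Formalization: The density value h_F(ξ_p) is additionally assumed to be the derivative of H_F at ξ_p; a density fixed only almost everywhere, or H_F with a kink at ξ_p, makes the claim false. *)

theory Defs
  imports "HOL-Probability.Probability" "HOL-Library.Landau_Symbols"
begin

text \<open>
  Sequences of random variables are functions on \<^typ>\<open>nat\<close> indexed from 1; the value at
  index 0 is never used.  Points of $R^m$ are the extensional functions
  in \<open>{1..m} \<rightarrow>\<^sub>E UNIV\<close>, so that \<open>m\<close> is an ordinary natural number.
\<close>

definition generated_sigma ::
  "'a measure \<Rightarrow> (nat \<Rightarrow> 'a \<Rightarrow> real) \<Rightarrow> nat set \<Rightarrow> 'a set set" where
  "generated_sigma M X I =
     sigma_sets (space M) (\<Union>i\<in>I. {X i -` B \<inter> space M | B. B \<in> sets borel})"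

definition mixing_coeff :: "'a measure \<Rightarrow> (nat \<Rightarrow> 'a \<Rightarrow> real) \<Rightarrow> nat \<Rightarrow> real" where
  "mixing_coeff M X k =
     (SUP n\<in>{1..}. SUP (A, B) \<in> generated_sigma M X {1..n} \<times> generated_sigma M X {n + k..}.
        \<bar>measure M (A \<inter> B) - measure M A * measure M B\<bar>)"

definition strongly_mixing :: "'a measure \<Rightarrow> (nat \<Rightarrow> 'a \<Rightarrow> real) \<Rightarrow> bool" where
  "strongly_mixing M X \<longleftrightarrow> mixing_coeff M X \<longlonglongrightarrow> 0"

definition stationary :: "'a measure \<Rightarrow> (nat \<Rightarrow> 'a \<Rightarrow> real) \<Rightarrow> bool" where
  "stationary M X \<longleftrightarrow>
     (\<forall>s. distr M (PiM {1..} (\<lambda>_. borel)) (\<lambda>\<omega>. \<lambda>n\<in>{1..}. X (n + s) \<omega>)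
        = distr M (PiM {1..} (\<lambda>_. borel)) (\<lambda>\<omega>. \<lambda>n\<in>{1..}. X n \<omega>))"

text \<open>\<open>Y\<^sub>1, Y\<^sub>2, \<dots>\<close> are independent copies of \<open>X\<^sub>1\<close>, jointly independent of the whole sequence \<open>X\<close>.\<close>

definition independent_copies ::
  "'a measure \<Rightarrow> (nat \<Rightarrow> 'a \<Rightarrow> real) \<Rightarrow> (nat \<Rightarrow> 'a \<Rightarrow> real) \<Rightarrow> bool" where
  "independent_copies M X Y \<longleftrightarrow>
     prob_space.indep_vars M (\<lambda>_. borel) Y {1..} \<and>
     (\<forall>j\<ge>1. distr M borel (Y j) = distr M borel (X 1)) \<and>
     prob_space.indep_var M
       (PiM {1..} (\<lambda>_. borel)) (\<lambda>\<omega>. \<lambda>n\<in>{1..}. X n \<omega>)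
       (PiM {1..} (\<lambda>_. borel)) (\<lambda>\<omega>. \<lambda>n\<in>{1..}. Y n \<omega>)"

definition is_kernel :: "nat \<Rightarrow> ((nat \<Rightarrow> real) \<Rightarrow> real) \<Rightarrow> bool" where
  "is_kernel m h \<longleftrightarrow>
     h \<in> borel_measurable (PiM {1..m} (\<lambda>_. borel)) \<and>
     (\<forall>\<pi> x. \<pi> permutes {1..m} \<longrightarrow> x \<in> {1..m} \<rightarrow>\<^sub>E UNIV \<longrightarrow> h (x \<circ> \<pi>) = h x)"

text \<open>
  Lipschitz continuity with respect to the Euclidean norm of $R^m$.  The library's metric on
  the function type \<open>nat \<Rightarrow> real\<close> is a metric for the product topology and not the Euclidean
  one, so \<^const>\<open>lipschitz_on\<close> is not applicable here.
\<close>

definition lipschitz_kernel :: "nat \<Rightarrow> ((nat \<Rightarrow> real) \<Rightarrow> real) \<Rightarrow> bool" where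
  "lipschitz_kernel m h \<longleftrightarrow>
     (\<exists>L. \<forall>x \<in> {1..m} \<rightarrow>\<^sub>E UNIV. \<forall>y \<in> {1..m} \<rightarrow>\<^sub>E UNIV.
        \<bar>h x - h y\<bar> \<le> L * L2_set (\<lambda>j. x j - y j) {1..m})"

definition incr_tuples :: "nat \<Rightarrow> nat set \<Rightarrow> (nat \<Rightarrow> nat) set" where
  "incr_tuples m I = {i \<in> {1..m} \<rightarrow>\<^sub>E I. strict_mono_on {1..m} i}"

definition indep_kernel ::
  "nat \<Rightarrow> ((nat \<Rightarrow> real) \<Rightarrow> real) \<Rightarrow> (nat \<Rightarrow> 'a \<Rightarrow> real) \<Rightarrow> 'a \<Rightarrow> real" where
  "indep_kernel m h Y \<omega> = h (\<lambda>j\<in>{1..m}. Y j \<omega>)"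

text \<open>\<open>h(Y\<^bsub>i_1\<^esub>, X\<^bsub>i_2\<^esub>, \<dots>, X\<^bsub>i_k\<^esub>, Y\<^bsub>i_(k+1)\<^esub>, \<dots>, Y\<^bsub>i_m\<^esub>)\<close>\<close>

definition mixed_kernel ::
  "nat \<Rightarrow> ((nat \<Rightarrow> real) \<Rightarrow> real) \<Rightarrow> (nat \<Rightarrow> 'a \<Rightarrow> real) \<Rightarrow> (nat \<Rightarrow> 'a \<Rightarrow> real)
     \<Rightarrow> nat \<Rightarrow> (nat \<Rightarrow> nat) \<Rightarrow> 'a \<Rightarrow> real" where
  "mixed_kernel m h X Y k i \<omega> =
     h (\<lambda>j\<in>{1..m}. if 2 \<le> j \<and> j \<le> k then X (i j) \<omega> else Y (i j) \<omega>)"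

definition has_bounded_density :: "'a measure \<Rightarrow> ('a \<Rightarrow> real) \<Rightarrow> bool" where
  "has_bounded_density M Z \<longleftrightarrow>
     (\<exists>f :: real \<Rightarrow> real. (\<forall>x. 0 \<le> f x) \<and> bounded (range f) \<and> distributed M lborel Z f)"

definition kernel_df ::
  "'a measure \<Rightarrow> nat \<Rightarrow> ((nat \<Rightarrow> real) \<Rightarrow> real) \<Rightarrow> (nat \<Rightarrow> 'a \<Rightarrow> real) \<Rightarrow> real \<Rightarrow> real" where
  "kernel_df M m h Y = cdf (distr M borel (indep_kernel m h Y))"

definition empirical_df ::
  "nat \<Rightarrow> ((nat \<Rightarrow> real) \<Rightarrow> real) \<Rightarrow> (nat \<Rightarrow> 'a \<Rightarrow> real) \<Rightarrow> nat \<Rightarrow> 'a \<Rightarrow> real \<Rightarrow> real" where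
  "empirical_df m h X n \<omega> x =
     1 / real (n choose m) *
     (\<Sum>i \<in> incr_tuples m {1..n}. of_bool (h (\<lambda>j\<in>{1..m}. X (i j) \<omega>) \<le> x))"

definition gen_inverse :: "(real \<Rightarrow> real) \<Rightarrow> real \<Rightarrow> real" where
  "gen_inverse G p = Inf {x. G x \<ge> p}"

text \<open>
  \<open>R\<^sub>n = o\<^sub>p(a\<^sub>n)\<close>.  Measurability of \<open>R\<^sub>n\<close> is part of the definition because
  \<^const>\<open>measure\<close> is 0 on sets that are not measurable.
\<close>

definition small_o_prob ::
  "'a measure \<Rightarrow> (nat \<Rightarrow> 'a \<Rightarrow> real) \<Rightarrow> (nat \<Rightarrow> real) \<Rightarrow> bool" where
  "small_o_prob M R a \<longleftrightarrow>
     (\<forall>n. R n \<in> borel_measurable M) \<and>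
     (\<forall>\<epsilon>>0. (\<lambda>n. measure M {\<omega> \<in> space M. \<bar>R n \<omega>\<bar> > \<epsilon> * a n}) \<longlonglongrightarrow> 0)"

end

theory Submission
  imports Defs "HOL-Real_Asymp.Real_Asymp"
begin

text \<open>
Write \<open>U\<^sub>i\<close> for the kernel evaluated at the observations with indices \<open>i\<^sub>1 < \<dots> < i\<^sub>m\<close>, so that
\<open>H\<^sub>n\<close> averages the indicators of \<open>U\<^sub>i \<le> x\<close>.  The representation follows from two second moment
bounds:
  \<^item> \<open>E (H\<^sub>n x - H x)\<^sup>2 = O(1/n)\<close> (lemma \<open>empirical_df_second_moment\<close>), and
  \<^item> the increment of \<open>H\<^sub>n - H\<close> between \<open>\<xi>\<close> and points \<open>x\<^sub>n \<rightarrow> \<xi>\<close> has second moment \<open>o(1/n)\<close>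
    (lemma \<open>empirical_df_increment\<close>).
Given these, the argument is the one of Ghosh.  Put \<open>V = \<surd>n (Q - \<xi>)\<close> for the sample quantile \<open>Q\<close>
and \<open>W = \<surd>n (H \<xi> - H\<^sub>n \<xi>) / H' \<xi>\<close>.  The event \<open>V \<le> t\<close> is the event
\<open>H\<^sub>n (\<xi> + t/\<surd>n) \<ge> p\<close>, which differs from \<open>W \<le> t\<close> only through an increment of \<open>H\<^sub>n - H\<close> and through
the error of a difference quotient of \<open>H\<close>.  So \<open>V\<close> and \<open>W\<close> lie on the same side of each point of a
finite grid, up to an error below the mesh and with probability tending to 1; since \<open>W\<close> is bounded in
probability, a grid that covers its range forces \<open>V - W\<close> to be small.

Both moment bounds rest on a comparison of the joint law of \<open>U\<^sub>i\<close> and \<open>U\<^sub>j\<close> with the law under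
independence.  Strong mixing controls only products of a past and a future event, so the smallest
index is detached by cutting its range into small cells: on a cell of width \<open>\<epsilon>\<close> the Lipschitz kernel
moves by \<open>O(\<epsilon>)\<close>, each cell costs one mixing coefficient, and the moment condition limits the number
of cells.  For a gap \<open>d\<close> the best width is \<open>d\<^sup>-\<^sup>\<beta>\<close> with \<open>\<beta> = \<delta>\<rho> / (2\<rho> + 1)\<close>, and the total error is of
the same size.  The condition on \<open>\<delta>\<close> says exactly that \<open>\<beta> > 1\<close>, that is, that these errors are
summable over \<open>d\<close>.  All coordinates are detached in turn (lemma \<open>decoupling\<close>).  Each step turns the
event \<open>G \<le> r\<close> into the slightly larger event \<open>G \<le> r + O(\<epsilon>)\<close>; after the last step, under
independence, the accumulated shift is absorbed by the Lipschitz bound on \<open>H\<close> that a bounded density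
provides.  In this way the covariance of the indicators of \<open>U\<^sub>i \<le> s\<close> and \<open>U\<^sub>j \<le> t\<close> is bounded
by a constant times the sum of \<open>(1 + d)\<^sup>-\<^sup>\<beta>\<close> over the gaps \<open>d\<close> between the indices in \<open>i\<close> and \<open>j\<close>.

It remains to count.  The sum of this bound over all pairs of tuples is \<open>O(n\<^sup>2\<^sup>m\<^sup>-\<^sup>1)\<close>, which gives
the first moment bound.  For the second one, the covariance of two increments is also at most a
constant times the mean increment plus the decoupling error of one of the two tuples.  If one of
them has only large gaps this is a small number \<open>\<kappa>\<close>, and capping the summable bound at \<open>\<kappa>\<close> makes
the sum \<open>o(n\<^sup>2\<^sup>m\<^sup>-\<^sup>1)\<close>; pairs in which both tuples contain a small gap are too few to matter.
\<close>

section \<open>Strong mixing and stationarity\<close>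

lemma (in prob_space) abs_dependence_le_1: "\<bar>prob (A \<inter> B) - prob A * prob B\<bar> \<le> 1"
  using mult_le_one[OF prob_le_1 measure_nonneg prob_le_1, of A B] prob_le_1[of "A \<inter> B"]
    measure_nonneg[of M "A \<inter> B"] mult_nonneg_nonneg[OF measure_nonneg measure_nonneg, of M A M B]
  by (simp only: abs_le_iff) linarith

lemma mixing_coeff_upper:
  assumes "prob_space M" and "n \<ge> 1"
    and A: "A \<in> generated_sigma M X {1..n}" and B: "B \<in> generated_sigma M X {n + k..}"
  shows "\<bar>measure M (A \<inter> B) - measure M A * measure M B\<bar> \<le> mixing_coeff M X k"
proof -
  interpret prob_space M by fact
  define dep where "dep = (\<lambda>(A, B). \<bar>measure M (A \<inter> B) - measure M A * measure M B\<bar>)"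
  have dep_le: "dep P \<le> 1" for P
    by (cases P) (simp add: dep_def abs_dependence_le_1)
  let ?S = "\<lambda>n. generated_sigma M X {1..n} \<times> generated_sigma M X {n + k..}"
  have ne: "?S n \<noteq> {}" for n
    using A B by (auto simp: generated_sigma_def intro: sigma_sets.Empty)
  have bdd: "bdd_above (dep ` ?S n)" for n using dep_le by (auto intro!: bdd_aboveI2)
  have "dep (A, B) \<le> (SUP P\<in>?S n. dep P)"
    using A B by (intro cSUP_upper bdd) auto
  also have "\<dots> \<le> (SUP n\<in>{1..}. SUP P\<in>?S n. dep P)"
  proof (rule cSUP_upper)
    show "bdd_above ((\<lambda>n. SUP P\<in>?S n. dep P) ` {1..})"
      using dep_le by (intro bdd_aboveI2[where M = 1] cSUP_least ne)
  qed (use \<open>n \<ge> 1\<close> in auto)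
  finally show ?thesis
    unfolding mixing_coeff_def dep_def by simp
qed

text \<open>
The form in which events meet the mixing coefficient: they are always of the type \<open>G (X\<^sub>j)\<^sub>j\<^sub>\<in>\<^sub>J \<in> S\<close>.
\<close>

lemma generated_sigma_preimage:
  fixes G :: "_ \<Rightarrow> real"
  assumes "J \<subseteq> I" and "G \<in> borel_measurable (PiM J (\<lambda>_. borel))"
    and meas: "\<And>i. i \<in> I \<Longrightarrow> X i \<in> borel_measurable M"
    and S: "S \<in> sets borel"
  shows "{\<omega> \<in> space M. G (\<lambda>j\<in>J. X j \<omega>) \<in> S} \<in> generated_sigma M X I"
proof -
  let ?gen = "\<Union>i\<in>I. {X i -` B \<inter> space M | B. B \<in> sets borel}"
  let ?N = "sigma (space M) ?gen"
  have sub: "?gen \<subseteq> Pow (space M)" by auto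
  have N: "space ?N = space M" "sets ?N = generated_sigma M X I"
    using sub by (simp_all add: space_measure_of_conv generated_sigma_def)
  have X: "X i \<in> borel_measurable ?N" if "i \<in> I" for i
  proof (rule measurableI)
    fix B :: "real set" assume "B \<in> sets borel"
    then have "X i -` B \<inter> space M \<in> ?gen" using that by blast
    then show "X i -` B \<inter> space ?N \<in> sets ?N"
      unfolding N by (simp only: generated_sigma_def) (rule sigma_sets.Basic)
  qed auto
  have "(\<lambda>\<omega>. G (\<lambda>j\<in>J. X j \<omega>)) \<in> borel_measurable ?N"
    by (rule measurable_compose[OF measurable_restrict assms(2)]) (use X \<open>J \<subseteq> I\<close> in auto)
  from measurable_sets[OF this S] show ?thesis
    unfolding N by (simp add: vimage_def Int_def conj_commute)
qed

lemma stationary_distr: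
  assumes st: "stationary M X" and meas: "\<And>n. n \<ge> 1 \<Longrightarrow> X n \<in> borel_measurable M" and "n \<ge> 1"
  shows "distr M borel (X n) = distr M borel (X 1)"
proof -
  let ?P = "PiM {1::nat..} (\<lambda>_. borel :: real measure)"
  have c: "(\<lambda>x. x 1) \<in> measurable ?P borel" by (rule measurable_component_singleton) auto
  have "distr M ?P (\<lambda>\<omega>. \<lambda>k\<in>{1..}. X (k + (n - 1)) \<omega>) = distr M ?P (\<lambda>\<omega>. \<lambda>k\<in>{1..}. X k \<omega>)"
    using st unfolding stationary_def by blast
  then have "distr (distr M ?P (\<lambda>\<omega>. \<lambda>k\<in>{1..}. X (k + (n - 1)) \<omega>)) borel (\<lambda>x. x 1)
      = distr (distr M ?P (\<lambda>\<omega>. \<lambda>k\<in>{1..}. X k \<omega>)) borel (\<lambda>x. x 1)" by simp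
  moreover have "distr (distr M ?P (\<lambda>\<omega>. \<lambda>k\<in>{1..}. X (k + s) \<omega>)) borel (\<lambda>x. x 1)
      = distr M borel (X (1 + s))" for s
    by (subst distr_distr[OF c])
       (auto intro!: measurable_restrict meas simp: comp_def)
  from this[of "n-1"] this[of 0] have "distr (distr M ?P (\<lambda>\<omega>. \<lambda>k\<in>{1..}. X (k + (n - 1)) \<omega>)) borel (\<lambda>x. x 1)
      = distr M borel (X n)" "distr (distr M ?P (\<lambda>\<omega>. \<lambda>k\<in>{1..}. X k \<omega>)) borel (\<lambda>x. x 1)
      = distr M borel (X 1)"
    using \<open>n \<ge> 1\<close> by simp_all
  ultimately show ?thesis by simp
qed

text \<open>
The common law \<open>\<mu>\<close> of the observations is a parameter, so that the product measures built from it are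
the reference laws of the decoupling.
\<close>

locale mixing_process = prob_space M
  for M :: "'a measure" +
  fixes X :: "nat \<Rightarrow> 'a \<Rightarrow> real" and \<mu> :: "real measure" and \<rho> \<delta> :: real
  assumes X_meas [measurable]: "\<And>n. n \<ge> 1 \<Longrightarrow> X n \<in> borel_measurable M"
    and X_law: "\<And>n. n \<ge> 1 \<Longrightarrow> distr M borel (X n) = \<mu>"
    and rho: "\<rho> \<ge> 1"
    and moment: "integrable \<mu> (\<lambda>x. \<bar>x\<bar> powr \<rho>)"
    and delta: "\<delta> > (2 * \<rho> + 1) / \<rho>"
    and mixing_rate: "mixing_coeff M X \<in> O(\<lambda>l. real l powr (- \<delta>))"
begin

text \<open>
The exponent that balances three errors for a pair of indices at distance \<open>d\<close>.  Cells of width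
\<open>d\<^sup>-\<^sup>\<beta>\<close> that cover \<open>\<bar>x\<bar> \<le> d\<^sup>\<beta>\<^sup>/\<^sup>\<rho>\<close> are \<open>O(d\<^sup>\<beta>\<^sup>+\<^sup>\<beta>\<^sup>/\<^sup>\<rho>)\<close> in number and cost \<open>d\<^sup>-\<^sup>\<delta>\<close> each; this total, the mass
outside the covered range and the cell width are all of order \<open>d\<^sup>-\<^sup>\<beta>\<close> exactly when
\<open>2\<beta> + \<beta>/\<rho> = \<delta>\<close>.
\<close>

definition "\<beta> = \<delta> * \<rho> / (2 * \<rho> + 1)"

lemma beta_gt_1: "\<beta> > 1"
  using rho delta by (simp add: \<beta>_def field_simps)

sublocale mu: prob_space \<mu>
  using X_law[of 1] prob_space_distr[OF X_meas[of 1]] by simp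

lemma sets_mu [measurable_cong, simp]: "sets \<mu> = sets borel" and space_mu [simp]: "space \<mu> = UNIV"
  using X_law[of 1] by (metis le_refl sets_distr, metis le_refl space_distr space_borel)

text \<open>
Since the coefficients are at most 1, enlarging the constant extends the rate from large \<open>d\<close> to all \<open>d \<ge> 1\<close>.
\<close>

lemma mixing_bound:
  obtains C where "C > 0" "\<And>d. d \<ge> 1 \<Longrightarrow> mixing_coeff M X d \<le> C * real d powr (- \<delta>)"
proof -
  have le1: "mixing_coeff M X d \<le> 1" for d
  proof -
    have ne: "generated_sigma M X I \<noteq> {}" for I
      by (auto simp: generated_sigma_def intro: sigma_sets.Empty)
    show ?thesis unfolding mixing_coeff_def
      by (intro cSUP_least) (use ne in \<open>auto intro: abs_dependence_le_1\<close>)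
  qed
  from mixing_rate obtain c where c: "c > 0"
    and ev: "eventually (\<lambda>d. norm (mixing_coeff M X d) \<le> c * norm (real d powr (- \<delta>))) at_top"
    by (auto elim: landau_o.bigE)
  then obtain N where N: "\<And>d. d \<ge> N \<Longrightarrow> norm (mixing_coeff M X d) \<le> c * norm (real d powr (- \<delta>))"
    by (auto simp: eventually_at_top_linorder)
  define C where "C = max c (real (max N 1) powr \<delta>)"
  show thesis
  proof (rule that[of C])
    show "C > 0" using c by (simp add: C_def)
    fix d :: nat assume d: "d \<ge> 1"
    show "mixing_coeff M X d \<le> C * real d powr (- \<delta>)"
    proof (cases "d \<ge> N")
      case True
      have "mixing_coeff M X d \<le> c * real d powr (- \<delta>)" using N[OF True] by simp
      also have "\<dots> \<le> C * real d powr (- \<delta>)" by (intro mult_right_mono) (auto simp: C_def)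
      finally show ?thesis .
    next
      case False
      have "\<delta> > 0" using delta rho by (smt (verit) divide_pos_pos)
      have "1 = real d powr \<delta> * real d powr (- \<delta>)" using d by (simp add: powr_minus)
      also have "\<dots> \<le> C * real d powr (- \<delta>)"
        using False \<open>\<delta> > 0\<close> d by (intro mult_right_mono) (auto simp: C_def le_max_iff_disj intro!: disjI2 powr_mono2)
      finally show ?thesis using le1[of d] by simp
    qed
  qed
qed

lemma tail_bound: 
  assumes "K > 0"
  shows "measure \<mu> {x. \<bar>x\<bar> \<ge> K} \<le> (\<integral>x. \<bar>x\<bar> powr \<rho> \<partial>\<mu>) * K powr (- \<rho>)"
proof -
  have iff: "K \<le> \<bar>x\<bar> \<longleftrightarrow> K powr \<rho> \<le> \<bar>x\<bar> powr \<rho>" for x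
    using powr_mono2[of \<rho> K "\<bar>x\<bar>"] powr_less_mono2[of \<rho> "\<bar>x\<bar>" K] rho assms by linarith
  have "measure \<mu> {x. \<bar>x\<bar> \<ge> K} = measure \<mu> {x\<in>space \<mu>. \<bar>x\<bar> powr \<rho> \<ge> K powr \<rho>}"
    by (simp add: iff)
  also have "\<dots> \<le> (\<integral>x. \<bar>x\<bar> powr \<rho> \<partial>\<mu>) / K powr \<rho>"
    using assms by (intro integral_Markov_inequality_measure[OF moment, of "{}"]) auto
  finally show ?thesis by (simp add: powr_minus divide_inverse)
qed

end

section \<open>Decoupling the first coordinate\<close>

text \<open>
The \<open>l\<^sup>1\<close> norm is used because it does not change when a coordinate is frozen, so that sections of
a Lipschitz function keep its constant in the induction over the coordinates.
\<close>

definition l1_lipschitz :: "real \<Rightarrow> nat set \<Rightarrow> ((nat \<Rightarrow> real) \<Rightarrow> real) \<Rightarrow> bool" where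
  "l1_lipschitz L I G \<longleftrightarrow> L \<ge> 0 \<and>
     (\<forall>x \<in> I \<rightarrow>\<^sub>E UNIV. \<forall>y \<in> I \<rightarrow>\<^sub>E UNIV. \<bar>G x - G y\<bar> \<le> L * (\<Sum>i\<in>I. \<bar>x i - y i\<bar>))"

lemma l1_lipschitz_update:
  assumes "l1_lipschitz L (insert k J) G" "finite J" "k \<notin> J" "x \<in> J \<rightarrow>\<^sub>E UNIV"
  shows "\<bar>G (x(k := u)) - G (x(k := v))\<bar> \<le> L * \<bar>u - v\<bar>"
proof -
  have "\<bar>G (x(k := u)) - G (x(k := v))\<bar> \<le> L * (\<Sum>i\<in>insert k J. \<bar>(x(k := u)) i - (x(k := v)) i\<bar>)"
    using assms by (auto simp: l1_lipschitz_def PiE_insert_eq fun_upd_in_PiE)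
  also have "(\<Sum>i\<in>insert k J. \<bar>(x(k := u)) i - (x(k := v)) i\<bar>) = \<bar>u - v\<bar>"
    using assms by (auto intro!: sum.neutral)
  finally show ?thesis .
qed

lemma l1_lipschitz_section:
  assumes "l1_lipschitz L (insert k J) G" "finite J" "k \<notin> J"
  shows "l1_lipschitz L J (\<lambda>x. G (x(k := v)))"
  unfolding l1_lipschitz_def
proof safe
  show "L \<ge> 0" using assms by (simp add: l1_lipschitz_def)
  fix x y :: "nat \<Rightarrow> real" assume xy: "x \<in> J \<rightarrow>\<^sub>E UNIV" "y \<in> J \<rightarrow>\<^sub>E UNIV"
  have "\<bar>G (x(k := v)) - G (y(k := v))\<bar> \<le> L * (\<Sum>i\<in>insert k J. \<bar>(x(k := v)) i - (y(k := v)) i\<bar>)"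
  proof -
    have "x(k := v) \<in> insert k J \<rightarrow>\<^sub>E UNIV" "y(k := v) \<in> insert k J \<rightarrow>\<^sub>E UNIV"
      using xy by (auto simp: PiE_iff extensional_def)
    then show ?thesis using assms(1) unfolding l1_lipschitz_def by blast
  qed
  also have "(\<Sum>i\<in>insert k J. \<bar>(x(k := v)) i - (y(k := v)) i\<bar>) = (\<Sum>i\<in>J. \<bar>x i - y i\<bar>)"
    using assms by (auto intro!: sum.cong)
  finally show "\<bar>G (x(k := v)) - G (y(k := v))\<bar> \<le> L * (\<Sum>i\<in>J. \<bar>x i - y i\<bar>)" .
qed

lemma section_borel:
  fixes G :: "(nat \<Rightarrow> real) \<Rightarrow> real"
  assumes "G \<in> borel_measurable (PiM (insert k J) (\<lambda>_. borel :: real measure))"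
  shows "(\<lambda>x. G (x(k := v))) \<in> borel_measurable (PiM J (\<lambda>_. borel))"
  by (rule measurable_compose[OF _ assms]) (rule measurable_fun_upd[where J = J]; simp)

context mixing_process
begin

lemma prob_as_mu: "n \<ge> 1 \<Longrightarrow> B \<in> sets borel \<Longrightarrow> prob {\<omega>\<in>space M. X n \<omega> \<in> B} = measure \<mu> B"
  by (subst X_law[symmetric, of n], assumption, subst measure_distr)
     (auto simp: vimage_def Int_def conj_commute)

lemma section_measurable:
  fixes G :: "(nat \<Rightarrow> real) \<Rightarrow> real"
  assumes G [measurable]: "G \<in> borel_measurable (PiM (insert k J) (\<lambda>_. borel :: real measure))"
    and J: "J \<subseteq> {1..}"
  shows "(\<lambda>(v, \<omega>). G ((\<lambda>j\<in>J. X j \<omega>)(k := v))) \<in> borel_measurable (borel \<Otimes>\<^sub>M M)"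
proof -
  have "(\<lambda>p. (\<lambda>j\<in>J. X j (snd p))(k := fst p)) \<in> measurable (borel \<Otimes>\<^sub>M M) (PiM (insert k J) (\<lambda>_. borel))"
  proof (rule measurable_fun_upd)
    show "(\<lambda>p. \<lambda>j\<in>J. X j (snd p)) \<in> measurable (borel \<Otimes>\<^sub>M M) (PiM J (\<lambda>_. borel))"
      using J by (intro measurable_restrict measurable_compose[OF measurable_snd X_meas]) auto
  qed auto
  from measurable_compose[OF this G] show ?thesis by (simp add: case_prod_beta')
qed

lemma section_prob_measurable:
  fixes G :: "(nat \<Rightarrow> real) \<Rightarrow> real"
  assumes G: "G \<in> borel_measurable (PiM (insert k J) (\<lambda>_. borel :: real measure))"
    and J: "J \<subseteq> {1..}"
  shows "(\<lambda>v. prob {\<omega>\<in>space M. G ((\<lambda>j\<in>J. X j \<omega>)(k := v)) \<le> r}) \<in> borel_measurable \<mu>"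
proof -
  have "(\<lambda>v. emeasure M (Pair v -` {p\<in>space (borel \<Otimes>\<^sub>M M). (\<lambda>(v, \<omega>). G ((\<lambda>j\<in>J. X j \<omega>)(k := v))) p \<le> r}))
      \<in> borel_measurable borel"
  proof (rule measurable_emeasure_Pair)
    show "{p\<in>space (borel \<Otimes>\<^sub>M M). (\<lambda>(v, \<omega>). G ((\<lambda>j\<in>J. X j \<omega>)(k := v))) p \<le> r}
      \<in> sets (borel \<Otimes>\<^sub>M M)"
      using measurable_sets[OF section_measurable[OF G J] atMost_borel[of r]]
      by (simp add: vimage_def Int_def conj_commute)
  qed
  then have "(\<lambda>v. enn2real (emeasure M (Pair v -` {p\<in>space (borel \<Otimes>\<^sub>M M). (\<lambda>(v, \<omega>). G ((\<lambda>j\<in>J. X j \<omega>)(k := v))) p \<le> r})))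
      \<in> borel_measurable borel" by measurable
  then show ?thesis
    by (simp add: measure_def space_pair_measure vimage_def cong: measurable_cong_sets)
qed

text \<open>
The core estimate.  Strong mixing says nothing about a general event in which \<open>X\<^sub>k\<close> and the later
coordinates are entangled, but if \<open>X\<^sub>k\<close> lies in a cell \<open>[\<epsilon>q, \<epsilon>(q+1))\<close>, then replacing it by the
constant \<open>\<epsilon>q\<close> changes \<open>G\<close> by at most \<open>L\<epsilon>\<close> and turns the event into the intersection of a past and a
future event.  Mixing is applied to each of the \<open>2Q + 1\<close> cells with \<open>-Q \<le> q \<le> Q\<close>, and \<open>\<epsilon>q\<close> is then
replaced by a variable \<open>v\<close> with law \<open>\<mu>\<close> that runs through the cell, at the price of another \<open>L\<epsilon>\<close>.
\<close>

lemma decouple_first_cells: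
  assumes k: "k \<ge> 1" and J: "finite J" "J \<subseteq> {k + d..}" and d: "d \<ge> 1"
    and G: "G \<in> borel_measurable (PiM (insert k J) (\<lambda>_. borel :: real measure))"
    and lip: "l1_lipschitz L (insert k J) G" and \<epsilon>: "\<epsilon> > 0"
  shows "prob {\<omega>\<in>space M. G (\<lambda>j\<in>insert k J. X j \<omega>) \<le> r}
    \<le> (\<integral>v. prob {\<omega>\<in>space M. G ((\<lambda>j\<in>J. X j \<omega>)(k := v)) \<le> r + 2 * L * \<epsilon>} \<partial>\<mu>)
       + (2 * real Q + 1) * mixing_coeff M X d + measure \<mu> {x. \<bar>x\<bar> \<ge> real Q * \<epsilon>}"
proof -
  have k_J: "k \<notin> J" and J1: "J \<subseteq> {1..}" using J d by auto
  have L: "L \<ge> 0" using lip by (simp add: l1_lipschitz_def)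
  let ?c = "\<lambda>q::int. {v::real. \<lfloor>v / \<epsilon>\<rfloor> = q}"
  let ?Q = "{- int Q..int Q}"
  define XJ where "XJ \<omega> = (\<lambda>j\<in>J. X j \<omega>)" for \<omega>
  have XJ: "XJ \<omega> \<in> J \<rightarrow>\<^sub>E UNIV" for \<omega> by (auto simp: XJ_def)
  define P where "P v r = prob {\<omega>\<in>space M. G ((XJ \<omega>)(k := v)) \<le> r}" for v r
  have split: "(\<lambda>j\<in>insert k J. X j \<omega>) = (XJ \<omega>)(k := X k \<omega>)" for \<omega>
    using k_J by (auto simp: XJ_def fun_eq_iff)
  note Gsec = section_borel[OF G]
  define A where "A q = {\<omega>\<in>space M. X k \<omega> \<in> ?c q}" for q
  define B where "B q = {\<omega>\<in>space M. G ((XJ \<omega>)(k := \<epsilon> * q)) \<le> r + L * \<epsilon>}" for q :: int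
  have Bsig: "B q \<in> generated_sigma M X {k + d..}" for q
    using generated_sigma_preimage[OF J(2) Gsec, of X M "{..r + L * \<epsilon>}" "\<epsilon> * q"] k
    by (auto simp: B_def XJ_def)
  have Asig: "A q \<in> generated_sigma M X {1..k}" for q
    using generated_sigma_preimage[of "{k}" "{1..k}" "\<lambda>x. x k" X M "?c q"] k
    by (auto simp: A_def)
  have gs: "generated_sigma M X I \<subseteq> events" if "I \<subseteq> {1..}" for I
    unfolding generated_sigma_def using that by (intro sets.sigma_sets_subset) auto
  have [measurable]: "A q \<in> events" "B q \<in> events" for q
    using gs[of "{1..k}"] gs[of "{k+d..}"] Asig Bsig k by auto
  have cell: "\<bar>v - \<epsilon> * q\<bar> \<le> \<epsilon>" if "v \<in> ?c q" for v q
  proof -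
    have "real_of_int q \<le> v / \<epsilon>" "v / \<epsilon> < real_of_int q + 1" using that by (auto simp: floor_eq_iff)
    then show ?thesis using \<epsilon> by (auto simp: field_simps abs_le_iff)
  qed
  have move: "G ((XJ \<omega>)(k := u)) \<le> s + L * \<epsilon>" if "G ((XJ \<omega>)(k := v)) \<le> s" "\<bar>u - v\<bar> \<le> \<epsilon>" for \<omega> u v s
    using l1_lipschitz_update[OF lip J(1) k_J XJ, of \<omega> u v] mult_left_mono[OF that(2) L] that(1) by linarith
  let ?T = "{\<omega>\<in>space M. X k \<omega> \<in> {x. \<bar>x\<bar> \<ge> real Q * \<epsilon>}}"
  have T [simp]: "?T \<in> events" using k by measurable
  have "{\<omega>\<in>space M. G ((XJ \<omega>)(k := X k \<omega>)) \<le> r} \<subseteq> (\<Union>q\<in>?Q. A q \<inter> B q) \<union> ?T"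
  proof (intro subsetI UnCI)
    fix \<omega> assume "\<omega> \<in> {\<omega>\<in>space M. G ((XJ \<omega>)(k := X k \<omega>)) \<le> r}" and "\<omega> \<notin> ?T"
    then have \<omega>: "\<omega> \<in> space M" "G ((XJ \<omega>)(k := X k \<omega>)) \<le> r"
      and no: "\<not> real Q * \<epsilon> \<le> \<bar>X k \<omega>\<bar>" by auto
    define q where "q = \<lfloor>X k \<omega> / \<epsilon>\<rfloor>"
    have "\<bar>X k \<omega> / \<epsilon>\<bar> < real Q" using no \<epsilon> by (simp add: field_simps)
    then have "- real Q < X k \<omega> / \<epsilon>" and "X k \<omega> / \<epsilon> < real Q" by arith+
    then have "q \<in> ?Q" by (auto simp: q_def le_floor_iff floor_le_iff)
    moreover have "\<omega> \<in> A q \<inter> B q"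
      using \<omega> move[OF \<omega>(2), of "\<epsilon> * q"] cell[of "X k \<omega>" q]
      by (auto simp: A_def B_def q_def abs_minus_commute)
    ultimately show "\<omega> \<in> (\<Union>q\<in>?Q. A q \<inter> B q)" by blast
  qed
  \<comment> \<open>The event is covered by the cells and the tail of \<open>X\<^sub>k\<close>; the factors \<open>A q\<close> and \<open>B q\<close> are past and future events.\<close>
  then have cover: "prob {\<omega>\<in>space M. G (\<lambda>j\<in>insert k J. X j \<omega>) \<le> r} \<le> prob ((\<Union>q\<in>?Q. A q \<inter> B q) \<union> ?T)"
    unfolding split by (rule finite_measure_mono) (intro sets.Un sets.finite_UN sets.Int T; simp)
  have union: "prob ((\<Union>q\<in>?Q. A q \<inter> B q) \<union> ?T) \<le> prob (\<Union>q\<in>?Q. A q \<inter> B q) + prob ?T"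
    by (intro measure_Un_le sets.finite_UN sets.Int T; simp)
  have "prob (\<Union>q\<in>?Q. A q \<inter> B q) \<le> (\<Sum>q\<in>?Q. prob (A q \<inter> B q))"
    by (intro finite_measure_subadditive_finite) auto
  also have "\<dots> \<le> (\<Sum>q\<in>?Q. prob (A q) * prob (B q) + mixing_coeff M X d)"
  proof (rule sum_mono)
    show "prob (A q \<inter> B q) \<le> prob (A q) * prob (B q) + mixing_coeff M X d" for q
      using mixing_coeff_upper[OF prob_space_axioms k Asig[of q] Bsig[of q]] by linarith
  qed
  also have "\<dots> = (\<Sum>q\<in>?Q. prob (A q) * prob (B q)) + (2 * real Q + 1) * mixing_coeff M X d"
    by (simp add: sum.distrib)
  finally have mixed: "prob (\<Union>q\<in>?Q. A q \<inter> B q)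
      \<le> (\<Sum>q\<in>?Q. prob (A q) * prob (B q)) + (2 * real Q + 1) * mixing_coeff M X d" .
  \<comment> \<open>The cells are disjoint, so the sum is the integral of a step function that lies below \<open>P\<close>.\<close>
  have cells: "(\<Sum>q\<in>?Q. prob (A q) * prob (B q)) \<le> (\<integral>v. P v (r + 2 * L * \<epsilon>) \<partial>\<mu>)"
  proof -
    have Pmeas: "(\<lambda>v. P v s) \<in> borel_measurable \<mu>" for s
      using section_prob_measurable[OF G J1] by (simp add: P_def XJ_def)
    have Pint: "integrable \<mu> (\<lambda>v. P v s)" for s
      by (rule mu.integrable_const_bound[where B = 1, OF _ Pmeas]) (simp add: P_def)
    have "(\<Sum>q\<in>?Q. prob (A q) * prob (B q)) = (\<Sum>q\<in>?Q. measure \<mu> (?c q) * prob (B q))"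
      using k by (simp add: A_def prob_as_mu[where B = "?c _", simplified])
    also have "\<dots> = (\<integral>v. (\<Sum>q\<in>?Q. indicator (?c q) v * prob (B q)) \<partial>\<mu>)"
      by (subst Bochner_Integration.integral_sum) (auto intro!: integrable_mult_left simp: mu.emeasure_eq_measure)
    also have "\<dots> \<le> (\<integral>v. P v (r + 2 * L * \<epsilon>) \<partial>\<mu>)"
    proof (intro integral_mono Pint)
      show "integrable \<mu> (\<lambda>v. \<Sum>q\<in>?Q. indicator (?c q) v * prob (B q))"
        by (intro Bochner_Integration.integrable_sum integrable_mult_left integrable_real_indicator)
           (auto simp: mu.emeasure_eq_measure)
      fix v
      define q where "q = \<lfloor>v / \<epsilon>\<rfloor>"
      have "(\<Sum>q\<in>?Q. indicator (?c q) v * prob (B q)) = (\<Sum>q'\<in>?Q. if q' = q then prob (B q) else 0)"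
        by (intro sum.cong) (auto simp: q_def)
      also have "\<dots> \<le> prob (B q)" by (auto simp: sum.delta)
      also have "\<dots> \<le> P v (r + 2 * L * \<epsilon>)"
      proof -
        have "B q \<subseteq> {\<omega>\<in>space M. G ((XJ \<omega>)(k := v)) \<le> r + 2 * L * \<epsilon>}"
          using move[of _ "\<epsilon> * q" "r + L * \<epsilon>" v] cell[of v q]
          by (auto simp: B_def q_def algebra_simps)
        moreover have "{\<omega>\<in>space M. G ((XJ \<omega>)(k := v)) \<le> r + 2 * L * \<epsilon>} \<in> events"
          using generated_sigma_preimage[OF J(2) Gsec, of X M "{..r + 2 * L * \<epsilon>}" v] gs[of "{k+d..}"] k
          by (auto simp: XJ_def)
        ultimately show ?thesis unfolding P_def by (intro finite_measure_mono)
      qed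
      finally show "(\<Sum>q\<in>?Q. indicator (?c q) v * prob (B q)) \<le> P v (r + 2 * L * \<epsilon>)" .
    qed
    finally show ?thesis .
  qed
  have "prob ?T = measure \<mu> {x. \<bar>x\<bar> \<ge> real Q * \<epsilon>}"
    by (rule prob_as_mu[OF k]) simp
  with cover union mixed cells show ?thesis unfolding P_def XJ_def by linarith
qed

text \<open>
The decoupling error of two indices at distance \<open>d\<close>.  The shift by 1 keeps it positive for \<open>d = 0\<close>,
where it equals the trivial bound 1, so that tuples with a common index need no separate weight.
\<close>

definition "dep d = (1 + real d) powr (- \<beta>)"

definition "dep_sum I = (\<Sum>a\<in>I. \<Sum>b\<in>{b\<in>I. a < b}. dep (b - a))"

lemma dep_nonneg [simp]: "0 \<le> dep d"
  by (simp add: dep_def)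

lemma dep_sum_nonneg [simp]: "0 \<le> dep_sum I"
  by (simp add: dep_sum_def sum_nonneg)

lemma powr_le_dep: "d \<ge> 1 \<Longrightarrow> real d powr (- \<beta>) \<le> 2 powr \<beta> * dep d"
proof -
  assume d: "d \<ge> 1"
  have "((1 + real d) / 2) powr \<beta> \<le> real d powr \<beta>"
    using d beta_gt_1 by (intro powr_mono2) auto
  then show ?thesis
    using d by (simp add: dep_def powr_minus powr_divide field_simps)
qed

text \<open>
The choice of cell width and range explained at \<open>\<beta>\<close>.
\<close>

lemma decouple_first:
  obtains C where "C \<ge> 0" "\<And>k d J G L r. \<lbrakk>k \<ge> 1; finite J; J \<subseteq> {k + d..}; d \<ge> 1;
     G \<in> borel_measurable (PiM (insert k J) (\<lambda>_. borel :: real measure));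
     l1_lipschitz L (insert k J) G\<rbrakk> \<Longrightarrow>
     prob {\<omega>\<in>space M. G (\<lambda>j\<in>insert k J. X j \<omega>) \<le> r}
     \<le> (\<integral>v. prob {\<omega>\<in>space M. G ((\<lambda>j\<in>J. X j \<omega>)(k := v)) \<le> r + 2 * L * real d powr (- \<beta>)} \<partial>\<mu>)
       + C * real d powr (- \<beta>)"
proof -
  obtain C1 where C1: "C1 > 0" "\<And>d. d \<ge> 1 \<Longrightarrow> mixing_coeff M X d \<le> C1 * real d powr (- \<delta>)"
    using mixing_bound by blast
  define C2 where "C2 = (\<integral>x. \<bar>x\<bar> powr \<rho> \<partial>\<mu>)"
  have C2: "C2 \<ge> 0" by (simp add: C2_def)
  show thesis
  proof (rule that[of "5 * C1 + C2"])
    show "5 * C1 + C2 \<ge> 0" using C1 C2 by simp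
    fix k d :: nat and J G L r
    assume d: "d \<ge> 1" and asm: "k \<ge> 1" "finite J" "J \<subseteq> {k + d..}"
      "G \<in> borel_measurable (PiM (insert k J) (\<lambda>_. borel :: real measure))"
      "l1_lipschitz L (insert k J) G"
    define \<epsilon> K where "\<epsilon> = real d powr (- \<beta>)" and "K = real d powr (\<beta> / \<rho>)"
    define Q where "Q = nat \<lceil>K / \<epsilon>\<rceil>"
    have eps: "0 < \<epsilon>" "\<epsilon> \<le> 1" using d beta_gt_1 by (auto simp: \<epsilon>_def powr_minus inverse_le_1_iff ge_one_powr_ge_zero)
    have K: "K \<ge> 1" using d beta_gt_1 rho by (auto simp: K_def ge_one_powr_ge_zero)
    have KE: "K / \<epsilon> \<ge> 1" using eps K by (simp add: field_simps)
    have Q: "real Q \<ge> K / \<epsilon>" "real Q \<le> K / \<epsilon> + 1" using KE unfolding Q_def by linarith+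
    have "(2 * real Q + 1) * mixing_coeff M X d \<le> (2 * real Q + 1) * (C1 * real d powr (- \<delta>))"
      by (intro mult_left_mono C1 d) auto
    also have "\<dots> \<le> (5 * (K / \<epsilon>)) * (C1 * real d powr (- \<delta>))"
      using Q KE C1 by (intro mult_right_mono) auto
    also have "\<dots> = 5 * C1 * real d powr (\<beta> / \<rho> + \<beta> - \<delta>)"
      using d by (simp add: K_def \<epsilon>_def powr_add powr_diff powr_minus field_simps)
    also have "\<beta> / \<rho> + \<beta> - \<delta> = - \<beta>"
    proof -
      have "\<beta> * (2 * \<rho> + 1) = \<delta> * \<rho>" using rho by (simp add: \<beta>_def)
      moreover have "\<beta> / \<rho> + 2 * \<beta> = \<beta> * (2 * \<rho> + 1) / \<rho>" using rho by (simp add: field_simps)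
      ultimately have "\<beta> / \<rho> + 2 * \<beta> = \<delta>" using rho by simp
      then show ?thesis by simp
    qed
    finally have 1: "(2 * real Q + 1) * mixing_coeff M X d \<le> 5 * C1 * \<epsilon>" by (simp add: \<epsilon>_def)
    have "measure \<mu> {x. \<bar>x\<bar> \<ge> real Q * \<epsilon>} \<le> measure \<mu> {x. \<bar>x\<bar> \<ge> K}"
      using Q(1) eps by (intro mu.finite_measure_mono) (auto simp: field_simps)
    also have "\<dots> \<le> C2 * K powr (- \<rho>)"
      unfolding C2_def using K by (intro tail_bound) auto
    also have "K powr (- \<rho>) = \<epsilon>" using rho by (simp add: K_def \<epsilon>_def powr_powr)
    finally have 2: "measure \<mu> {x. \<bar>x\<bar> \<ge> real Q * \<epsilon>} \<le> C2 * \<epsilon>" .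
    show "prob {\<omega>\<in>space M. G (\<lambda>j\<in>insert k J. X j \<omega>) \<le> r}
     \<le> (\<integral>v. prob {\<omega>\<in>space M. G ((\<lambda>j\<in>J. X j \<omega>)(k := v)) \<le> r + 2 * L * real d powr (- \<beta>)} \<partial>\<mu>)
       + (5 * C1 + C2) * real d powr (- \<beta>)"
      using decouple_first_cells[OF asm(1-3) d asm(4,5) eps(1), of r Q] 1 2
      unfolding \<epsilon>_def[symmetric] by (simp add: distrib_right)
  qed
qed

section \<open>Decoupling all coordinates\<close>

text \<open>
Fubini for the product law, in the form in which the induction over the coordinates uses it.
\<close>

lemma PiM_insert_prob:
  fixes G :: "(nat \<Rightarrow> real) \<Rightarrow> real"
  assumes J: "finite J" "k \<notin> J"
    and G [measurable]: "G \<in> borel_measurable (PiM (insert k J) (\<lambda>_. borel :: real measure))"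
  shows "measure (PiM (insert k J) (\<lambda>_. \<mu>)) {x\<in>insert k J \<rightarrow>\<^sub>E UNIV. G x \<le> r}
     = (\<integral>v. measure (PiM J (\<lambda>_. \<mu>)) {x\<in>J \<rightarrow>\<^sub>E UNIV. G (x(k := v)) \<le> r} \<partial>\<mu>)"
    and "integrable \<mu> (\<lambda>v. measure (PiM J (\<lambda>_. \<mu>)) {x\<in>J \<rightarrow>\<^sub>E UNIV. G (x(k := v)) \<le> r})"
proof -
  interpret product_sigma_finite "\<lambda>_. \<mu>" ..
  interpret PJ: prob_space "PiM J (\<lambda>_. \<mu>)" by (intro prob_space_PiM mu.prob_space_axioms)
  interpret PK: prob_space "PiM (insert k J) (\<lambda>_. \<mu>)" by (intro prob_space_PiM mu.prob_space_axioms)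
  have sets_eq: "sets (PiM I (\<lambda>_. \<mu>)) = sets (PiM I (\<lambda>_. borel))" for I :: "nat set"
    by (intro sets_PiM_cong) auto
  have G' [measurable]: "G \<in> borel_measurable (PiM (insert k J) (\<lambda>_. \<mu>))"
    using G by (simp cong: measurable_cong_sets add: sets_eq)
  let ?S = "{x\<in>insert k J \<rightarrow>\<^sub>E UNIV. G x \<le> r}"
  have S: "?S = {x\<in>space (PiM (insert k J) (\<lambda>_. \<mu>)). G x \<le> r}" by (simp add: space_PiM)
  have [measurable]: "?S \<in> sets (PiM (insert k J) (\<lambda>_. \<mu>))" unfolding S by measurable
  have upd: "(\<lambda>(v, x). x(k := v)) \<in> measurable (\<mu> \<Otimes>\<^sub>M PiM J (\<lambda>_. \<mu>)) (PiM (insert k J) (\<lambda>_. \<mu>))"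
    unfolding case_prod_beta' by (rule measurable_fun_upd[where J = J]) auto
  have pm: "{p\<in>space (\<mu> \<Otimes>\<^sub>M PiM J (\<lambda>_. \<mu>)). G ((snd p)(k := fst p)) \<le> r} \<in> sets (\<mu> \<Otimes>\<^sub>M PiM J (\<lambda>_. \<mu>))"
    using measurable_sets[OF measurable_compose[OF upd G'] atMost_borel[of r]]
    by (simp add: case_prod_beta' vimage_def Int_def conj_commute)
  have em: "(\<lambda>v. emeasure (PiM J (\<lambda>_. \<mu>)) {x\<in>J \<rightarrow>\<^sub>E UNIV. G (x(k := v)) \<le> r}) \<in> borel_measurable \<mu>"
    using PJ.measurable_emeasure_Pair[OF pm]
    by (simp add: space_pair_measure space_PiM vimage_def)
  then have meas: "(\<lambda>v. measure (PiM J (\<lambda>_. \<mu>)) {x\<in>J \<rightarrow>\<^sub>E UNIV. G (x(k := v)) \<le> r}) \<in> borel_measurable \<mu>"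
    unfolding measure_def by measurable
  then show int: "integrable \<mu> (\<lambda>v. measure (PiM J (\<lambda>_. \<mu>)) {x\<in>J \<rightarrow>\<^sub>E UNIV. G (x(k := v)) \<le> r})"
    by (rule mu.integrable_const_bound[rotated, where B = 1]) (auto)
  have sec: "{x\<in>J \<rightarrow>\<^sub>E UNIV. G (x(k := v)) \<le> r} \<in> sets (PiM J (\<lambda>_. \<mu>))" for v
    using sets_Pair1[OF pm, of v] by (simp add: space_pair_measure space_PiM vimage_def)
  have "emeasure (PiM (insert k J) (\<lambda>_. \<mu>)) ?S = (\<integral>\<^sup>+x. indicator ?S x \<partial>PiM (insert k J) (\<lambda>_. \<mu>))"
    by simp
  also have "\<dots> = (\<integral>\<^sup>+v. \<integral>\<^sup>+x. indicator ?S (x(k := v)) \<partial>PiM J (\<lambda>_. \<mu>) \<partial>\<mu>)"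
    by (rule product_nn_integral_insert_rev[OF J]) measurable
  also have "\<dots> = (\<integral>\<^sup>+v. emeasure (PiM J (\<lambda>_. \<mu>)) {x\<in>J \<rightarrow>\<^sub>E UNIV. G (x(k := v)) \<le> r} \<partial>\<mu>)"
  proof (rule nn_integral_cong)
    fix v
    have "(\<integral>\<^sup>+x. indicator ?S (x(k := v)) \<partial>PiM J (\<lambda>_. \<mu>))
        = (\<integral>\<^sup>+x. indicator {x\<in>J \<rightarrow>\<^sub>E UNIV. G (x(k := v)) \<le> r} x \<partial>PiM J (\<lambda>_. \<mu>))"
      by (intro nn_integral_cong) (auto simp: space_PiM indicator_def PiE_iff extensional_def)
    then show "(\<integral>\<^sup>+x. indicator ?S (x(k := v)) \<partial>PiM J (\<lambda>_. \<mu>))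
        = emeasure (PiM J (\<lambda>_. \<mu>)) {x\<in>J \<rightarrow>\<^sub>E UNIV. G (x(k := v)) \<le> r}"
      using sec[of v] by simp
  qed
  also have "\<dots> = ennreal (\<integral>v. measure (PiM J (\<lambda>_. \<mu>)) {x\<in>J \<rightarrow>\<^sub>E UNIV. G (x(k := v)) \<le> r} \<partial>\<mu>)"
    unfolding PJ.emeasure_eq_measure using int by (intro nn_integral_eq_integral) auto
  finally show "measure (PiM (insert k J) (\<lambda>_. \<mu>)) ?S
     = (\<integral>v. measure (PiM J (\<lambda>_. \<mu>)) {x\<in>J \<rightarrow>\<^sub>E UNIV. G (x(k := v)) \<le> r} \<partial>\<mu>)"
    by (simp add: measure_def enn2real_ennreal)
qed

lemma dep_sum_insert:
  assumes "finite J" "\<forall>b\<in>J. k < b"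
  shows "dep_sum (insert k J) = (\<Sum>b\<in>J. dep (b - k)) + dep_sum J"
proof -
  have "{b\<in>insert k J. k < b} = J" using assms by auto
  moreover have "{b\<in>insert k J. a < b} = {b\<in>J. a < b}" if "a \<in> J" for a using assms that by auto
  moreover have "k \<notin> J" using assms by auto
  ultimately show ?thesis using assms by (simp add: dep_sum_def)
qed

text \<open>
Induction that detaches the smallest index of \<open>I\<close>.  Lemma \<open>decouple_first\<close> replaces its observation
by a variable \<open>v\<close> with law \<open>\<mu>\<close>, and for each fixed \<open>v\<close> the induction hypothesis applies to the section
of \<open>G\<close> at \<open>v\<close>.  The bound is one-sided and lets the level \<open>r\<close> grow, so that the steps can be chained.
\<close>

lemma decoupling:
  obtains C where "C \<ge> 0" "\<And>I G L r. \<lbrakk>finite I; I \<subseteq> {1..};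
     G \<in> borel_measurable (PiM I (\<lambda>_. borel :: real measure)); l1_lipschitz L I G\<rbrakk> \<Longrightarrow>
     prob {\<omega>\<in>space M. G (\<lambda>j\<in>I. X j \<omega>) \<le> r}
     \<le> measure (PiM I (\<lambda>_. \<mu>)) {x\<in>I \<rightarrow>\<^sub>E UNIV. G x \<le> r + C * L * dep_sum I} + C * dep_sum I"
proof -
  obtain C0 where C0: "C0 \<ge> 0" and step: "\<And>k d J G L r. \<lbrakk>k \<ge> 1; finite J; J \<subseteq> {k + d..}; d \<ge> 1;
     G \<in> borel_measurable (PiM (insert k J) (\<lambda>_. borel :: real measure));
     l1_lipschitz L (insert k J) G\<rbrakk> \<Longrightarrow>
     prob {\<omega>\<in>space M. G (\<lambda>j\<in>insert k J. X j \<omega>) \<le> r}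
     \<le> (\<integral>v. prob {\<omega>\<in>space M. G ((\<lambda>j\<in>J. X j \<omega>)(k := v)) \<le> r + 2 * L * real d powr (- \<beta>)} \<partial>\<mu>)
       + C0 * real d powr (- \<beta>)"
    using decouple_first by blast
  define C where "C = (C0 + 2) * 2 powr \<beta>"
  show thesis
  proof (rule that[of C])
    show "C \<ge> 0" using C0 by (simp add: C_def)
    fix I :: "nat set" and G :: "(nat \<Rightarrow> real) \<Rightarrow> real" and L r
    assume "finite I" "I \<subseteq> {1..}"
     "G \<in> borel_measurable (PiM I (\<lambda>_. borel :: real measure))" "l1_lipschitz L I G"
    then show "prob {\<omega>\<in>space M. G (\<lambda>j\<in>I. X j \<omega>) \<le> r}
     \<le> measure (PiM I (\<lambda>_. \<mu>)) {x\<in>I \<rightarrow>\<^sub>E UNIV. G x \<le> r + C * L * dep_sum I} + C * dep_sum I"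
    proof (induction I arbitrary: G r rule: finite_linorder_min_induct)
      case empty
      interpret P: prob_space "PiM {} (\<lambda>_::nat. \<mu>)" by (intro prob_space_PiM mu.prob_space_axioms)
      have "P.prob {\<lambda>_. undefined} = 1" using P.prob_space by (simp add: space_PiM)
      then show ?case by (auto simp: dep_sum_def Collect_conv_if prob_space)
    next
      case (insert k J)
      have kJ: "k \<notin> J" "k \<ge> 1" "J \<subseteq> {1..}" using insert by auto
      have L: "L \<ge> 0" using insert.prems by (simp add: l1_lipschitz_def)
      note Gsec = section_borel[OF insert.prems(2)]
      have lip: "l1_lipschitz L J (\<lambda>x. G (x(k := v)))" for v
        by (rule l1_lipschitz_section[OF insert.prems(3) insert.hyps(1) kJ(1)])
      define \<eta> where "\<eta> = (\<Sum>b\<in>J. dep (b - k))"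
      have eta: "\<eta> \<ge> 0" by (simp add: \<eta>_def sum_nonneg)
      \<comment> \<open>The gap to the nearest later index gives the error; the sum over all later indices is larger and easier to add up.\<close>
      have first: "prob {\<omega>\<in>space M. G (\<lambda>j\<in>insert k J. X j \<omega>) \<le> r}
        \<le> (\<integral>v. prob {\<omega>\<in>space M. G ((\<lambda>j\<in>J. X j \<omega>)(k := v)) \<le> r + C * L * \<eta>} \<partial>\<mu>) + C * \<eta>"
      proof (cases "J = {}")
        case True
        have "prob {\<omega>\<in>space M. G ((\<lambda>_. undefined)(k := v)) \<le> r} = indicator {v. G ((\<lambda>_. undefined)(k := v)) \<le> r} v" for v
          by (simp add: prob_space indicator_def)
        moreover have "{v. G ((\<lambda>_. undefined)(k := v)) \<le> r} \<in> sets borel"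
        proof -
          have "(\<lambda>v. (\<lambda>_. undefined)(k := v)) \<in> measurable borel (PiM (insert k J) (\<lambda>_. borel :: real measure))"
            unfolding True by (rule measurable_fun_upd[where J = "{}"]) (auto simp: measurable_def space_PiM)
          from measurable_sets[OF measurable_compose[OF this insert.prems(2)] atMost_borel[of r]]
          show ?thesis by (simp add: vimage_def fun_upd_def)
        qed
        moreover have "(\<lambda>j\<in>{k}. X j \<omega>) = (\<lambda>_. undefined)(k := X k \<omega>)" for \<omega> by auto
        ultimately show ?thesis
          using prob_as_mu[OF kJ(2), of "{v. G ((\<lambda>_. undefined)(k := v)) \<le> r}"] True
          by (simp add: \<eta>_def restrict_def)
      next
        case False
        define d where "d = Min J - k"
        have Min: "Min J \<in> J" using False insert.hyps by simp
        then have d: "d \<ge> 1" "J \<subseteq> {k + d..}" using insert.hyps by (auto simp: d_def Suc_le_eq)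
        have "dep d \<le> \<eta>" unfolding \<eta>_def d_def using insert.hyps(1) Min by (intro member_le_sum) auto
        with powr_le_dep[OF d(1)] have e: "real d powr (- \<beta>) \<le> 2 powr \<beta> * \<eta>"
          by (smt (verit) mult_left_mono powr_ge_zero)
        have "prob {\<omega>\<in>space M. G (\<lambda>j\<in>insert k J. X j \<omega>) \<le> r}
          \<le> (\<integral>v. prob {\<omega>\<in>space M. G ((\<lambda>j\<in>J. X j \<omega>)(k := v)) \<le> r + 2 * L * real d powr (- \<beta>)} \<partial>\<mu>)
            + C0 * real d powr (- \<beta>)"
          by (rule step[OF kJ(2) insert.hyps(1) d(2,1) insert.prems(2,3)])
        also have "\<dots> \<le> (\<integral>v. prob {\<omega>\<in>space M. G ((\<lambda>j\<in>J. X j \<omega>)(k := v)) \<le> r + C * L * \<eta>} \<partial>\<mu>) + C * \<eta>"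
        proof (rule add_mono)
          have int: "integrable \<mu> (\<lambda>v. prob {\<omega>\<in>space M. G ((\<lambda>j\<in>J. X j \<omega>)(k := v)) \<le> s})" for s
            by (rule mu.integrable_const_bound[where B = 1, OF _ section_prob_measurable[OF insert.prems(2) kJ(3)]]) simp
          have "2 * real d powr (- \<beta>) \<le> 2 * (2 powr \<beta> * \<eta>)" using e by simp
          also have "\<dots> \<le> C * \<eta>" using C0 eta by (auto simp: C_def algebra_simps)
          finally have "L * (2 * real d powr (- \<beta>)) \<le> L * (C * \<eta>)" by (rule mult_left_mono[OF _ L])
          then have le: "r + 2 * L * real d powr (- \<beta>) \<le> r + C * L * \<eta>" by (simp add: mult_ac)
          show "(\<integral>v. prob {\<omega>\<in>space M. G ((\<lambda>j\<in>J. X j \<omega>)(k := v)) \<le> r + 2 * L * real d powr (- \<beta>)} \<partial>\<mu>)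
             \<le> (\<integral>v. prob {\<omega>\<in>space M. G ((\<lambda>j\<in>J. X j \<omega>)(k := v)) \<le> r + C * L * \<eta>} \<partial>\<mu>)"
          proof (intro integral_mono int finite_measure_mono)
            fix v show "{\<omega>\<in>space M. G ((\<lambda>j\<in>J. X j \<omega>)(k := v)) \<le> r + C * L * \<eta>} \<in> events"
              by (intro borel_measurable_le borel_measurable_const measurable_compose[OF measurable_restrict Gsec] X_meas)
                 (use kJ(3) in auto)
          qed (use le in auto)
          have "C0 * real d powr (- \<beta>) \<le> C0 * (2 powr \<beta> * \<eta>)" by (rule mult_left_mono[OF e C0])
          also have "\<dots> \<le> C * \<eta>" using eta by (auto simp: C_def algebra_simps)
          finally show "C0 * real d powr (- \<beta>) \<le> C * \<eta>" .
        qed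
        finally show ?thesis .
      qed
      have eq: "r + C * L * \<eta> + C * L * dep_sum J = r + C * L * dep_sum (insert k J)"
        using insert.hyps by (simp add: dep_sum_insert \<eta>_def algebra_simps)
      have "(\<integral>v. prob {\<omega>\<in>space M. G ((\<lambda>j\<in>J. X j \<omega>)(k := v)) \<le> r + C * L * \<eta>} \<partial>\<mu>)
        \<le> (\<integral>v. (measure (PiM J (\<lambda>_. \<mu>)) {x\<in>J \<rightarrow>\<^sub>E UNIV. G (x(k := v)) \<le> r + C * L * \<eta> + C * L * dep_sum J} + C * dep_sum J) \<partial>\<mu>)"
      proof (rule integral_mono)
        show "integrable \<mu> (\<lambda>v. prob {\<omega>\<in>space M. G ((\<lambda>j\<in>J. X j \<omega>)(k := v)) \<le> r + C * L * \<eta>})"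
          by (rule mu.integrable_const_bound[where B = 1, OF _ section_prob_measurable[OF insert.prems(2) kJ(3)]]) simp
        show "integrable \<mu> (\<lambda>v. measure (PiM J (\<lambda>_. \<mu>)) {x\<in>J \<rightarrow>\<^sub>E UNIV. G (x(k := v)) \<le> r + C * L * \<eta> + C * L * dep_sum J} + C * dep_sum J)"
          by (intro Bochner_Integration.integrable_add mu.integrable_const
              PiM_insert_prob(2)[OF insert.hyps(1) kJ(1) insert.prems(2)])
      qed (rule insert.IH[OF kJ(3) Gsec lip])
      also have "\<dots> = measure (PiM (insert k J) (\<lambda>_. \<mu>)) {x\<in>insert k J \<rightarrow>\<^sub>E UNIV. G x \<le> r + C * L * dep_sum (insert k J)} + C * dep_sum J"
        unfolding eq PiM_insert_prob(1)[OF insert.hyps(1) kJ(1) insert.prems(2)]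
        by (subst Bochner_Integration.integral_add[OF PiM_insert_prob(2)[OF insert.hyps(1) kJ(1) insert.prems(2)]])
           (simp_all add: mu.prob_space[simplified])
      finally have rest: "(\<integral>v. prob {\<omega>\<in>space M. G ((\<lambda>j\<in>J. X j \<omega>)(k := v)) \<le> r + C * L * \<eta>} \<partial>\<mu>)
        \<le> measure (PiM (insert k J) (\<lambda>_. \<mu>)) {x\<in>insert k J \<rightarrow>\<^sub>E UNIV. G x \<le> r + C * L * dep_sum (insert k J)} + C * dep_sum J" .
      have "C * dep_sum (insert k J) = C * \<eta> + C * dep_sum J"
        using insert.hyps by (simp add: dep_sum_insert \<eta>_def distrib_left)
      with first rest show ?case by linarith
    qed
  qed
qed

text \<open>
The two-sided form.  The lower bound is the upper bound for \<open>- G\<close>; when passing to complements,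
\<open>G < s\<close> must be compared with \<open>G \<le> s\<close>, for which an arbitrarily small extra shift \<open>\<zeta>\<close> is spent.
\<close>

lemma lipschitz_df_decoupling:
  obtains C where "C \<ge> 0" "\<And>I G L K D. \<lbrakk>finite I; I \<subseteq> {1..};
     G \<in> borel_measurable (PiM I (\<lambda>_. borel :: real measure)); l1_lipschitz L I G; K \<ge> 0;
     \<And>s. \<bar>measure (PiM I (\<lambda>_. \<mu>)) {x\<in>I \<rightarrow>\<^sub>E UNIV. G x \<le> s} - D\<bar> \<le> K * \<bar>s\<bar>\<rbrakk> \<Longrightarrow>
     \<bar>prob {\<omega>\<in>space M. G (\<lambda>j\<in>I. X j \<omega>) \<le> 0} - D\<bar> \<le> C * (K * L + 1) * dep_sum I"
proof -
  obtain C where C: "C \<ge> 0" and dec: "\<And>I G L r. \<lbrakk>finite I; I \<subseteq> {1..};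
     G \<in> borel_measurable (PiM I (\<lambda>_. borel :: real measure)); l1_lipschitz L I G\<rbrakk> \<Longrightarrow>
     prob {\<omega>\<in>space M. G (\<lambda>j\<in>I. X j \<omega>) \<le> r}
     \<le> measure (PiM I (\<lambda>_. \<mu>)) {x\<in>I \<rightarrow>\<^sub>E UNIV. G x \<le> r + C * L * dep_sum I} + C * dep_sum I"
    using decoupling by blast
  show thesis
  proof (rule that[OF C])
    fix I :: "nat set" and G L K D
    assume I: "finite I" "I \<subseteq> {1..}"
      and G [measurable]: "G \<in> borel_measurable (PiM I (\<lambda>_. borel :: real measure))"
      and lip: "l1_lipschitz L I G" and K: "K \<ge> 0"
      and D: "\<And>s. \<bar>measure (PiM I (\<lambda>_. \<mu>)) {x\<in>I \<rightarrow>\<^sub>E UNIV. G x \<le> s} - D\<bar> \<le> K * \<bar>s\<bar>"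
    interpret P: prob_space "PiM I (\<lambda>_. \<mu>)" by (intro prob_space_PiM mu.prob_space_axioms)
    have G': "G \<in> borel_measurable (PiM I (\<lambda>_. \<mu>))"
      using G by (simp cong: measurable_cong_sets sets_PiM_cong)
    have L: "L \<ge> 0" using lip by (simp add: l1_lipschitz_def)
    let ?e = "C * L * dep_sum I"
    have e: "?e \<ge> 0" using C L by simp
    have GX: "(\<lambda>\<omega>. G (\<lambda>j\<in>I. X j \<omega>)) \<in> borel_measurable M"
      by (rule measurable_compose[OF measurable_restrict G]) (use I in auto)
    have "prob {\<omega>\<in>space M. G (\<lambda>j\<in>I. X j \<omega>) \<le> 0} \<le> (D + K * ?e) + C * dep_sum I"
      using dec[OF I G lip, of 0] D[of "?e"] e by simp
    moreover have "prob {\<omega>\<in>space M. G (\<lambda>j\<in>I. X j \<omega>) \<le> 0} \<ge> (D - K * ?e) - C * dep_sum I"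
    proof (rule field_le_epsilon)
      fix z :: real assume z: "z > 0"
      define \<zeta> where "\<zeta> = z / (K + 1)"
      have \<zeta>: "\<zeta> > 0" "K * \<zeta> \<le> z" using z K by (auto simp: \<zeta>_def field_simps)
      have lip': "l1_lipschitz L I (\<lambda>x. - G x)"
        using lip by (auto simp: l1_lipschitz_def abs_minus_commute)
      have flip: "prob {\<omega>\<in>space M. \<not> G (\<lambda>j\<in>I. X j \<omega>) \<le> 0} \<le> prob {\<omega>\<in>space M. - G (\<lambda>j\<in>I. X j \<omega>) \<le> 0}"
        using GX by (intro finite_measure_mono) (auto intro!: borel_measurable_le)
      have decoupled: "prob {\<omega>\<in>space M. - G (\<lambda>j\<in>I. X j \<omega>) \<le> 0} \<le> P.prob {x\<in>I \<rightarrow>\<^sub>E UNIV. - G x \<le> 0 + ?e} + C * dep_sum I"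
        by (rule dec[OF I _ lip']) simp
      have "P.prob {x\<in>I \<rightarrow>\<^sub>E UNIV. - G x \<le> 0 + ?e} \<le> P.prob {x\<in>space (PiM I (\<lambda>_. \<mu>)). \<not> G x \<le> - ?e - \<zeta>}"
      proof (rule P.finite_measure_mono)
        show "{x\<in>space (PiM I (\<lambda>_. \<mu>)). \<not> G x \<le> - ?e - \<zeta>} \<in> P.events"
          using G' by measurable
      qed (use \<zeta> in \<open>auto simp: space_PiM\<close>)
      also have "\<dots> = 1 - P.prob {x\<in>space (PiM I (\<lambda>_. \<mu>)). G x \<le> - ?e - \<zeta>}"
        using G' by (intro P.prob_neg) auto
      finally have complement: "P.prob {x\<in>I \<rightarrow>\<^sub>E UNIV. - G x \<le> 0 + ?e}
          \<le> 1 - P.prob {x\<in>space (PiM I (\<lambda>_. \<mu>)). G x \<le> - ?e - \<zeta>}" .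
      have "P.prob {x\<in>space (PiM I (\<lambda>_. \<mu>)). G x \<le> - ?e - \<zeta>} \<ge> D - K * (?e + \<zeta>)"
      proof -
        have "\<bar>- ?e - \<zeta>\<bar> = ?e + \<zeta>" using e \<zeta> by simp
        with D[of "- ?e - \<zeta>"] have "P.prob {x\<in>I \<rightarrow>\<^sub>E UNIV. G x \<le> - ?e - \<zeta>} \<ge> D - K * (?e + \<zeta>)"
          by (simp only: abs_le_iff) linarith
        then show ?thesis by (simp add: space_PiM)
      qed
      with flip decoupled complement have "prob {\<omega>\<in>space M. \<not> G (\<lambda>j\<in>I. X j \<omega>) \<le> 0} \<le> 1 - (D - K * (?e + \<zeta>)) + C * dep_sum I"
        by linarith
      moreover have "prob {\<omega>\<in>space M. \<not> G (\<lambda>j\<in>I. X j \<omega>) \<le> 0} = 1 - prob {\<omega>\<in>space M. G (\<lambda>j\<in>I. X j \<omega>) \<le> 0}"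
        using GX by (intro prob_neg) auto
      ultimately show "(D - K * ?e) - C * dep_sum I \<le> prob {\<omega>\<in>space M. G (\<lambda>j\<in>I. X j \<omega>) \<le> 0} + z"
        using \<zeta> by (simp add: distrib_left)
    qed
    ultimately show "\<bar>prob {\<omega>\<in>space M. G (\<lambda>j\<in>I. X j \<omega>) \<le> 0} - D\<bar> \<le> C * (K * L + 1) * dep_sum I"
      by (simp add: abs_le_iff algebra_simps)
  qed
qed

end

section \<open>Kernels at index tuples\<close>

text \<open>
\<open>H\<close> is the distribution function of the kernel under independence; the constant \<open>B\<close> stands for a bound
of its density.
\<close>

locale kernel_process = mixing_process +
  fixes m :: nat and h :: "(nat \<Rightarrow> real) \<Rightarrow> real" and L B :: real and H :: "real \<Rightarrow> real"
  assumes m2: "m \<ge> 2"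
    and h_meas: "h \<in> borel_measurable (PiM {1..m} (\<lambda>_. borel))"
    and h_lip: "l1_lipschitz L {1..m} h"
    and H_eq: "\<And>t. H t = measure (PiM {1..m} (\<lambda>_. \<mu>)) {x\<in>{1..m} \<rightarrow>\<^sub>E UNIV. h x \<le> t}"
    and B_nonneg: "B \<ge> 0"
    and H_lip: "\<And>s t. \<bar>H s - H t\<bar> \<le> B * \<bar>s - t\<bar>"
begin

definition "at_tuple i x = h (\<lambda>k\<in>{1..m}. x (i k))"

lemma at_tuple_measurable:
  assumes "i ` {1..m} \<subseteq> I" "\<And>k. sets (N k) = sets borel"
  shows "at_tuple i \<in> borel_measurable (PiM I N)"
  unfolding at_tuple_def
proof (rule measurable_compose[OF measurable_restrict h_meas])
  fix k assume "k \<in> {1..m}"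
  then have "(\<lambda>x. x (i k)) \<in> measurable (PiM I N) (N (i k))"
    using assms by (intro measurable_component_singleton) auto
  then show "(\<lambda>x. x (i k)) \<in> borel_measurable (PiM I N)"
    using assms(2) by (simp cong: measurable_cong_sets)
qed

lemma at_tuple_lipschitz:
  assumes "inj_on i {1..m}" "i ` {1..m} \<subseteq> I" "finite I"
  shows "l1_lipschitz L I (at_tuple i)"
  unfolding l1_lipschitz_def
proof safe
  show L: "L \<ge> 0" using h_lip by (simp add: l1_lipschitz_def)
  fix x y :: "nat \<Rightarrow> real"
  have "\<bar>at_tuple i x - at_tuple i y\<bar> \<le> L * (\<Sum>k\<in>{1..m}. \<bar>(\<lambda>k\<in>{1..m}. x (i k)) k - (\<lambda>k\<in>{1..m}. y (i k)) k\<bar>)"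
    using h_lip unfolding l1_lipschitz_def at_tuple_def by (auto simp del: restrict_apply)
  also have "(\<Sum>k\<in>{1..m}. \<bar>(\<lambda>k\<in>{1..m}. x (i k)) k - (\<lambda>k\<in>{1..m}. y (i k)) k\<bar>) = (\<Sum>a\<in>i ` {1..m}. \<bar>x a - y a\<bar>)"
    unfolding sum.reindex[OF assms(1)] by simp
  also have "\<dots> \<le> (\<Sum>a\<in>I. \<bar>x a - y a\<bar>)" using assms by (intro sum_mono2) auto
  finally show "\<bar>at_tuple i x - at_tuple i y\<bar> \<le> L * (\<Sum>a\<in>I. \<bar>x a - y a\<bar>)"
    using L by (simp add: mult_left_mono)
qed

lemma at_tuple_restrict:
  assumes "i ` {1..m} \<subseteq> I"
  shows "at_tuple i (\<lambda>j\<in>I. x j) = at_tuple i x"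
  unfolding at_tuple_def using assms by (intro arg_cong[where f = h]) (auto simp: fun_eq_iff image_subset_iff)

lemma at_tuple_df:
  assumes "inj_on i {1..m}" "i ` {1..m} \<subseteq> I"
  shows "measure (PiM I (\<lambda>_. \<mu>)) {x\<in>I \<rightarrow>\<^sub>E UNIV. at_tuple i x \<le> t} = H t"
proof -
  let ?r = "\<lambda>x. \<lambda>k\<in>{1..m}. x (i k)"
  have d: "distr (PiM I (\<lambda>_. \<mu>)) (PiM {1..m} (\<lambda>_. \<mu>)) ?r = PiM {1..m} (\<lambda>_. \<mu>)"
    using assms by (intro distr_PiM_reindex mu.prob_space_axioms) auto
  have h': "h \<in> borel_measurable (PiM {1..m} (\<lambda>_. \<mu>))"
    using h_meas by (simp cong: measurable_cong_sets sets_PiM_cong)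
  have r: "?r \<in> measurable (PiM I (\<lambda>_. \<mu>)) (PiM {1..m} (\<lambda>_. \<mu>))"
    using assms by (intro measurable_restrict measurable_component_singleton) auto
  have "H t = measure (distr (PiM I (\<lambda>_. \<mu>)) (PiM {1..m} (\<lambda>_. \<mu>)) ?r) {x\<in>space (PiM {1..m} (\<lambda>_. \<mu>)). h x \<le> t}"
    unfolding d by (simp add: H_eq space_PiM)
  also have "\<dots> = measure (PiM I (\<lambda>_. \<mu>)) (?r -` {x\<in>space (PiM {1..m} (\<lambda>_. \<mu>)). h x \<le> t} \<inter> space (PiM I (\<lambda>_. \<mu>)))"
    using h' by (intro measure_distr[OF r]) simp
  also have "?r -` {x\<in>space (PiM {1..m} (\<lambda>_. \<mu>)). h x \<le> t} \<inter> space (PiM I (\<lambda>_. \<mu>)) = {x\<in>I \<rightarrow>\<^sub>E UNIV. at_tuple i x \<le> t}"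
    by (auto simp: space_PiM at_tuple_def)
  finally show ?thesis by simp
qed

lemma at_disjoint_tuples_df:
  assumes i: "inj_on i {1..m}" and j: "inj_on j {1..m}"
    and disj: "i ` {1..m} \<inter> j ` {1..m} = {}"
  shows "measure (PiM (i ` {1..m} \<union> j ` {1..m}) (\<lambda>_. \<mu>))
     {x\<in>(i ` {1..m} \<union> j ` {1..m}) \<rightarrow>\<^sub>E UNIV. at_tuple i x \<le> s \<and> at_tuple j x \<le> t} = H s * H t"
proof -
  interpret product_sigma_finite "\<lambda>_. \<mu>" ..
  let ?I = "i ` {1..m}" and ?J = "j ` {1..m}"
  let ?PI = "PiM ?I (\<lambda>_. \<mu>)" and ?PJ = "PiM ?J (\<lambda>_. \<mu>)" and ?PIJ = "PiM (?I \<union> ?J) (\<lambda>_. \<mu>)"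
  interpret PI: prob_space ?PI by (intro prob_space_PiM mu.prob_space_axioms)
  interpret PJ: prob_space ?PJ by (intro prob_space_PiM mu.prob_space_axioms)
  have [measurable]: "at_tuple i \<in> borel_measurable ?PI" "at_tuple j \<in> borel_measurable ?PJ"
    "at_tuple i \<in> borel_measurable ?PIJ" "at_tuple j \<in> borel_measurable ?PIJ"
    by (auto intro!: at_tuple_measurable)
  let ?SI = "{x\<in>space ?PI. at_tuple i x \<le> s}" and ?SJ = "{x\<in>space ?PJ. at_tuple j x \<le> t}"
  let ?S = "{x\<in>space ?PIJ. at_tuple i x \<le> s \<and> at_tuple j x \<le> t}"
  have "emeasure ?PIJ ?S = emeasure (distr (?PI \<Otimes>\<^sub>M ?PJ) ?PIJ (merge ?I ?J)) ?S"
    by (subst distr_merge[OF disj]) auto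
  also have "\<dots> = emeasure (?PI \<Otimes>\<^sub>M ?PJ) (merge ?I ?J -` ?S \<inter> space (?PI \<Otimes>\<^sub>M ?PJ))"
    by (intro emeasure_distr measurable_merge) measurable
  also have "merge ?I ?J -` ?S \<inter> space (?PI \<Otimes>\<^sub>M ?PJ) = ?SI \<times> ?SJ"
  proof -
    have "at_tuple i (merge ?I ?J (x, y)) = at_tuple i x" for x y
      unfolding at_tuple_def by (intro arg_cong[where f = h]) (auto simp: fun_eq_iff merge_def simp del: One_nat_def)
    moreover have "at_tuple j (merge ?I ?J (x, y)) = at_tuple j y" for x y
    proof -
      have "j k \<notin> ?I" if "k \<in> {1..m}" for k using disj that by blast
      then show ?thesis
        unfolding at_tuple_def by (intro arg_cong[where f = h]) (auto simp: fun_eq_iff merge_def simp del: One_nat_def)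
    qed
    ultimately show ?thesis by (auto simp: space_pair_measure space_PiM)
  qed
  also have "emeasure (?PI \<Otimes>\<^sub>M ?PJ) (?SI \<times> ?SJ) = emeasure ?PI ?SI * emeasure ?PJ ?SJ"
    by (intro PJ.emeasure_pair_measure_Times) measurable
  finally have "measure ?PIJ ?S = measure ?PI ?SI * measure ?PJ ?SJ"
    by (simp add: measure_def enn2real_mult)
  then show ?thesis
    using at_tuple_df[OF i subset_refl] at_tuple_df[OF j subset_refl] by (simp add: space_PiM)
qed

lemma H_bounds: "0 \<le> H t" "H t \<le> 1"
proof -
  interpret P: prob_space "PiM {1..m} (\<lambda>_. \<mu>)" by (intro prob_space_PiM mu.prob_space_axioms)
  show "0 \<le> H t" "H t \<le> 1" unfolding H_eq by (rule measure_nonneg P.prob_le_1)+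
qed

text \<open>
Decoupling applied to the kernel at one tuple, and to the maximum of the kernels at two disjoint
tuples.  The maximum is again Lipschitz, and its sublevel sets are the joint events
\<open>U\<^sub>i \<le> s, U\<^sub>j \<le> t\<close>, whose probability under independence is \<open>H s * H t\<close>.
\<close>

lemma decoupled_dfs:
  obtains C where "C \<ge> 1"
    "\<And>i t. \<lbrakk>inj_on i {1..m}; i ` {1..m} \<subseteq> {1..}\<rbrakk> \<Longrightarrow>
       \<bar>prob {\<omega>\<in>space M. at_tuple i (\<lambda>k. X k \<omega>) \<le> t} - H t\<bar> \<le> C * dep_sum (i ` {1..m})"
    "\<And>i j s t. \<lbrakk>inj_on i {1..m}; i ` {1..m} \<subseteq> {1..}; inj_on j {1..m}; j ` {1..m} \<subseteq> {1..};
        i ` {1..m} \<inter> j ` {1..m} = {}\<rbrakk> \<Longrightarrow>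
       \<bar>prob {\<omega>\<in>space M. at_tuple i (\<lambda>k. X k \<omega>) \<le> s \<and> at_tuple j (\<lambda>k. X k \<omega>) \<le> t} - H s * H t\<bar>
         \<le> C * dep_sum (i ` {1..m} \<union> j ` {1..m})"
proof -
  obtain C where C: "C \<ge> 0" and dec: "\<And>I G L K D. \<lbrakk>finite I; I \<subseteq> {1..};
     G \<in> borel_measurable (PiM I (\<lambda>_. borel :: real measure)); l1_lipschitz L I G; K \<ge> 0;
     \<And>s. \<bar>measure (PiM I (\<lambda>_. \<mu>)) {x\<in>I \<rightarrow>\<^sub>E UNIV. G x \<le> s} - D\<bar> \<le> K * \<bar>s\<bar>\<rbrakk> \<Longrightarrow>
     \<bar>prob {\<omega>\<in>space M. G (\<lambda>j\<in>I. X j \<omega>) \<le> 0} - D\<bar> \<le> C * (K * L + 1) * dep_sum I"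
    using lipschitz_df_decoupling by blast
  have L: "L \<ge> 0" using h_lip by (simp add: l1_lipschitz_def)
  define C' where "C' = C * (2 * B * L + 1) + 1"
  have C': "C * (B * L + 1) \<le> C'" "C * (2 * B * L + 1) \<le> C'" "1 \<le> C'"
    using C B_nonneg L by (auto simp: C'_def algebra_simps)
  show thesis
  proof (rule that[OF C'(3)])
    fix i :: "nat \<Rightarrow> nat" and t assume i: "inj_on i {1..m}" "i ` {1..m} \<subseteq> {1..}"
    let ?I = "i ` {1..m}"
    have lip: "l1_lipschitz L ?I (\<lambda>x. at_tuple i x - t)"
      using at_tuple_lipschitz[OF i(1) subset_refl] by (simp add: l1_lipschitz_def)
    have "\<bar>measure (PiM ?I (\<lambda>_. \<mu>)) {x\<in>?I \<rightarrow>\<^sub>E UNIV. at_tuple i x - t \<le> s} - H t\<bar> \<le> B * \<bar>s\<bar>" for s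
      using at_tuple_df[OF i(1) subset_refl, of "s + t"] H_lip[of "s + t" t] by (simp add: diff_le_eq)
    note D = this
    have "(\<lambda>x. at_tuple i x - t) \<in> borel_measurable (PiM ?I (\<lambda>_. borel))"
      by (intro borel_measurable_diff borel_measurable_const at_tuple_measurable) auto
    from dec[OF _ i(2) this lip B_nonneg D]
    have "\<bar>prob {\<omega>\<in>space M. at_tuple i (\<lambda>j\<in>?I. X j \<omega>) - t \<le> 0} - H t\<bar> \<le> C * (B * L + 1) * dep_sum ?I"
      by simp
    also have "\<dots> \<le> C' * dep_sum ?I" by (intro mult_right_mono C') simp
    finally show "\<bar>prob {\<omega>\<in>space M. at_tuple i (\<lambda>k. X k \<omega>) \<le> t} - H t\<bar> \<le> C' * dep_sum ?I"
      by (simp add: at_tuple_restrict)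
  next
    fix i j :: "nat \<Rightarrow> nat" and s t
    assume i: "inj_on i {1..m}" "i ` {1..m} \<subseteq> {1..}" and j: "inj_on j {1..m}" "j ` {1..m} \<subseteq> {1..}"
      and disj: "i ` {1..m} \<inter> j ` {1..m} = {}"
    let ?I = "i ` {1..m} \<union> j ` {1..m}"
    let ?G = "\<lambda>x. max (at_tuple i x - s) (at_tuple j x - t)"
    have lip: "l1_lipschitz L ?I ?G"
    proof -
      have "l1_lipschitz L ?I (at_tuple i)" "l1_lipschitz L ?I (at_tuple j)"
        using i j by (auto intro!: at_tuple_lipschitz)
      note lips = this
      have contr: "\<bar>max (a - s) (b - t) - max (c - s) (d - t)\<bar> \<le> e"
        if "\<bar>a - c\<bar> \<le> e" "\<bar>b - d\<bar> \<le> e" for a b c d e :: real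
        using that by (auto simp: max_def abs_le_iff)
      show ?thesis
        using lips unfolding l1_lipschitz_def by (intro conjI ballI contr) auto
    qed
    have D: "\<bar>measure (PiM ?I (\<lambda>_. \<mu>)) {x\<in>?I \<rightarrow>\<^sub>E UNIV. ?G x \<le> u} - H s * H t\<bar> \<le> (2 * B) * \<bar>u\<bar>" for u
    proof -
      have "{x\<in>?I \<rightarrow>\<^sub>E UNIV. ?G x \<le> u} = {x\<in>?I \<rightarrow>\<^sub>E UNIV. at_tuple i x \<le> u + s \<and> at_tuple j x \<le> u + t}"
        by (auto simp: diff_le_eq)
      then have "measure (PiM ?I (\<lambda>_. \<mu>)) {x\<in>?I \<rightarrow>\<^sub>E UNIV. ?G x \<le> u} = H (u + s) * H (u + t)"
        using at_disjoint_tuples_df[OF i(1) j(1) disj] by simp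
      moreover have "\<bar>H (u + s) * H (u + t) - H s * H t\<bar>
          \<le> \<bar>(H (u + s) - H s) * H (u + t)\<bar> + \<bar>H s * (H (u + t) - H t)\<bar>"
        using abs_triangle_ineq[of "(H (u + s) - H s) * H (u + t)" "H s * (H (u + t) - H t)"]
        by (simp add: left_diff_distrib right_diff_distrib)
      moreover have "\<bar>(H (u + s) - H s) * H (u + t)\<bar> \<le> (B * \<bar>u\<bar>) * 1"
        unfolding abs_mult using H_lip[of "u + s" s] H_bounds by (intro mult_mono) auto
      moreover have "\<bar>H s * (H (u + t) - H t)\<bar> \<le> 1 * (B * \<bar>u\<bar>)"
        unfolding abs_mult using H_lip[of "u + t" t] H_bounds by (intro mult_mono) auto
      ultimately show ?thesis by simp
    qed
    have "?G \<in> borel_measurable (PiM ?I (\<lambda>_. borel))"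
      by (intro borel_measurable_max borel_measurable_diff borel_measurable_const at_tuple_measurable) auto
    from dec[OF _ _ this lip _ D] i(2) j(2) B_nonneg
    have "\<bar>prob {\<omega>\<in>space M. ?G (\<lambda>j\<in>?I. X j \<omega>) \<le> 0} - H s * H t\<bar> \<le> C * (2 * B * L + 1) * dep_sum ?I"
      by simp
    also have "\<dots> \<le> C' * dep_sum ?I" by (intro mult_right_mono C') simp
    finally show "\<bar>prob {\<omega>\<in>space M. at_tuple i (\<lambda>k. X k \<omega>) \<le> s \<and> at_tuple j (\<lambda>k. X k \<omega>) \<le> t} - H s * H t\<bar>
         \<le> C' * dep_sum ?I"
      by (simp add: at_tuple_restrict)
  qed
qed

end

section \<open>Counting pairs of index tuples\<close>

text \<open>
The distance of two indices, written with truncated subtraction.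
\<close>

definition gap :: "nat \<Rightarrow> nat \<Rightarrow> nat" where
  "gap a b = (a - b) + (b - a)"

definition within_weight :: "nat \<Rightarrow> (nat \<Rightarrow> real) \<Rightarrow> (nat \<Rightarrow> nat) \<Rightarrow> real" where
  "within_weight m e i = (\<Sum>u\<in>{1..m}. \<Sum>v\<in>{1..m} - {u}. e (gap (i u) (i v)))"

definition cross_weight :: "nat \<Rightarrow> (nat \<Rightarrow> real) \<Rightarrow> (nat \<Rightarrow> nat) \<Rightarrow> (nat \<Rightarrow> nat) \<Rightarrow> real" where
  "cross_weight m e i j = (\<Sum>u\<in>{1..m}. \<Sum>v\<in>{1..m}. e (gap (i u) (j v)))"

text \<open>
The sum of \<open>e\<close> over all gaps between two slots of the pair of tuples \<open>(i, j)\<close>.  The function \<open>e\<close> is a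
parameter because three choices are needed: the decoupling error, its truncation at a small level,
and the indicator of small gaps.
\<close>

definition weight :: "nat \<Rightarrow> (nat \<Rightarrow> real) \<Rightarrow> (nat \<Rightarrow> nat) \<Rightarrow> (nat \<Rightarrow> nat) \<Rightarrow> real" where
  "weight m e i j = within_weight m e i + within_weight m e j + cross_weight m e i j"

lemma gap_commute: "gap a b = gap b a"
  by (simp add: gap_def)

lemma within_weight_nonneg: "(\<And>d. 0 \<le> e d) \<Longrightarrow> 0 \<le> within_weight m e i"
  and cross_weight_nonneg: "(\<And>d. 0 \<le> e d) \<Longrightarrow> 0 \<le> cross_weight m e i j"
  by (auto simp: within_weight_def cross_weight_def intro!: sum_nonneg)

lemma weight_nonneg: "(\<And>d. 0 \<le> e d) \<Longrightarrow> 0 \<le> weight m e i j"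
  by (simp add: weight_def within_weight_nonneg cross_weight_nonneg)

lemma incr_tuples_inj: "i \<in> incr_tuples m I \<Longrightarrow> inj_on i {1..m}"
  by (auto simp: incr_tuples_def strict_mono_on_imp_inj_on)

lemma incr_tuples_image: "i \<in> incr_tuples m I \<Longrightarrow> i ` {1..m} \<subseteq> I"
  by (auto simp: incr_tuples_def)

lemma incr_tuples_subset: "incr_tuples m I \<subseteq> {1..m} \<rightarrow>\<^sub>E I"
  by (auto simp: incr_tuples_def)

lemma finite_incr_tuples [simp]: "finite I \<Longrightarrow> finite (incr_tuples m I)"
  by (rule finite_subset[OF incr_tuples_subset]) (simp add: finite_PiE)

lemma incr_tuples_mono: "I \<subseteq> J \<Longrightarrow> incr_tuples m I \<subseteq> incr_tuples m J"
  by (auto simp: incr_tuples_def PiE_def)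

text \<open>
Increasing tuples correspond to their ranges, the \<open>m\<close>-element subsets.
\<close>

lemma card_incr_tuples: "card (incr_tuples m {1..n}) = n choose m"
proof -
  have "bij_betw (\<lambda>i. i ` {1..m}) (incr_tuples m {1..n}) {A. A \<subseteq> {1..n} \<and> card A = m}"
    unfolding bij_betw_def
  proof (intro conjI equalityI subsetI)
    show "inj_on (\<lambda>i. i ` {1..m}) (incr_tuples m {1..n})"
    proof (rule inj_onI)
      fix i j assume i: "i \<in> incr_tuples m {1..n}" and j: "j \<in> incr_tuples m {1..n}"
        and eq: "i ` {1..m} = j ` {1..m}"
      have "i k = j k" if "k \<in> {1..m}" for k
        using that
      proof (induction k rule: less_induct)
        case (less k)
        have mi: "i a < i b \<longleftrightarrow> a < b" and mj: "j a < j b \<longleftrightarrow> a < b" if "a \<in> {1..m}" "b \<in> {1..m}" for a b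
          using i j that by (auto simp: incr_tuples_def strict_mono_on_less)
        obtain a where a: "a \<in> {1..m}" "i k = j a" using less.prems eq by blast
        obtain b where b: "b \<in> {1..m}" "j k = i b" using less.prems eq by blast
        have "\<not> a < k" using less.IH[of a] a mi[of a k] less.prems by auto
        moreover have "\<not> b < k" using less.IH[of b] b mj[of b k] less.prems by auto
        ultimately have "j k \<le> j a" "i k \<le> i b"
          using mj[of a k] mi[of b k] a b less.prems by (auto simp: not_less[symmetric])
        then show ?case using a b by simp
      qed
      moreover have "i \<in> extensional {1..m}" "j \<in> extensional {1..m}"
        using i j by (auto simp: incr_tuples_def PiE_def)
      ultimately show "i = j" by (intro extensionalityI) auto
    qed
  next
    fix A assume "A \<in> (\<lambda>i. i ` {1..m}) ` incr_tuples m {1..n}"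
    then show "A \<in> {A. A \<subseteq> {1..n} \<and> card A = m}"
      using card_image[OF incr_tuples_inj] incr_tuples_image by fastforce
  next
    fix A assume "A \<in> {A. A \<subseteq> {1..n} \<and> card A = m}"
    then have A: "A \<subseteq> {1..n}" "card A = m" "finite A" by (auto intro: finite_subset)
    obtain f where f: "bij_betw f {..<m} A" "strict_mono_on {..<m} f"
      using ex_bij_betw_strict_mono_card[OF A(3)] A(2) by auto
    define i where "i = (\<lambda>k\<in>{1..m}. f (k - 1))"
    have "i ` {1..m} = f ` ((\<lambda>k. k - 1) ` {1..m})" by (auto simp: i_def image_iff)
    also have "(\<lambda>k. k - 1) ` {1..m} = {..<m}"
      by (auto simp: image_iff intro!: bexI[of _ "Suc _"])
    finally have img: "i ` {1..m} = A" using f(1) by (simp add: bij_betw_def)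
    have "strict_mono_on {1..m} i"
    proof (rule strict_mono_onI)
      fix r s assume "r \<in> {1..m}" "s \<in> {1..m}" "r < s"
      then show "i r < i s"
        using strict_mono_onD[OF f(2), of "r - 1" "s - 1"] by (auto simp: i_def)
    qed
    moreover have "i \<in> {1..m} \<rightarrow>\<^sub>E {1..n}" using img A(1) by (auto simp: i_def)
    ultimately show "A \<in> (\<lambda>i. i ` {1..m}) ` incr_tuples m {1..n}"
      using img by (auto simp: incr_tuples_def intro!: image_eqI[of _ _ i])
  qed
  then have "card (incr_tuples m {1..n}) = card {A. A \<subseteq> {1..n} \<and> card A = m}"
    by (rule bij_betw_same_card)
  then show ?thesis by (simp add: n_subsets)
qed

lemma card_tuples_fixed:
  assumes "finite S" "finite N" "U \<subseteq> S" "\<And>k. k \<in> U \<Longrightarrow> c k \<in> N"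
  shows "card {i\<in>S \<rightarrow>\<^sub>E N. \<forall>k\<in>U. i k = c k} = card N ^ (card S - card U)"
proof -
  have "{i\<in>S \<rightarrow>\<^sub>E N. \<forall>k\<in>U. i k = c k} = PiE S (\<lambda>k. if k \<in> U then {c k} else N)"
    using assms(3,4) by (auto simp: PiE_iff extensional_def split: if_splits)
  also have "card \<dots> = (\<Prod>k\<in>S. if k \<in> U then 1 else card N)"
    by (simp add: card_PiE[OF assms(1)] if_distrib[of card] cong: if_cong)
  also have "\<dots> = (\<Prod>k\<in>S - U. card N)"
    using assms by (subst prod.subset_diff[OF assms(3,1)]) (auto intro!: prod.neutral)
  finally show ?thesis using assms by (simp add: card_Diff_subset finite_subset)
qed

lemma sum_tuples_slot:
  fixes f :: "nat \<Rightarrow> real"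
  assumes "u \<in> {1..m}"
  shows "(\<Sum>i\<in>{1..m} \<rightarrow>\<^sub>E {1..n}. f (i u)) = real n ^ (m - 1) * (\<Sum>a\<in>{1..n}. f a)"
proof -
  let ?P = "{1..m} \<rightarrow>\<^sub>E {1..n}"
  have fin: "finite ?P" by (simp add: finite_PiE)
  have "(\<Sum>i\<in>?P. f (i u)) = (\<Sum>i\<in>?P. \<Sum>a\<in>{1..n}. if i u = a then f a else 0)"
    using assms by (intro sum.cong) (auto simp: PiE_iff)
  also have "\<dots> = (\<Sum>a\<in>{1..n}. \<Sum>i\<in>?P. if i u = a then f a else 0)" by (rule sum.swap)
  also have "\<dots> = (\<Sum>a\<in>{1..n}. real (card {i\<in>?P. \<forall>k\<in>{u}. i k = a}) * f a)"
    using fin by (intro sum.cong refl) (simp add: sum.If_cases Int_def conj_commute)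
  also have "\<dots> = (\<Sum>a\<in>{1..n}. real n ^ (m - 1) * f a)"
  proof (intro sum.cong refl)
    fix a assume "a \<in> {1..n}"
    then have "card {i\<in>?P. \<forall>k\<in>{u}. i k = a} = n ^ (m - 1)"
      using card_tuples_fixed[of "{1..m}" "{1..n}" "{u}" "\<lambda>_. a"] assms by simp
    then show "real (card {i\<in>?P. \<forall>k\<in>{u}. i k = a}) * f a = real n ^ (m - 1) * f a" by simp
  qed
  finally show ?thesis by (simp add: sum_distrib_left)
qed

lemma sum_tuples_two_slots:
  fixes f :: "nat \<Rightarrow> nat \<Rightarrow> real"
  assumes "u \<in> {1..m}" "v \<in> {1..m}" "u \<noteq> v"
  shows "(\<Sum>i\<in>{1..m} \<rightarrow>\<^sub>E {1..n}. f (i u) (i v)) = real n ^ (m - 2) * (\<Sum>a\<in>{1..n}. \<Sum>b\<in>{1..n}. f a b)"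
proof -
  let ?P = "{1..m} \<rightarrow>\<^sub>E {1..n}"
  have fin: "finite ?P" by (simp add: finite_PiE)
  have "(\<Sum>i\<in>?P. f (i u) (i v)) = (\<Sum>i\<in>?P. \<Sum>(a, b)\<in>{1..n} \<times> {1..n}. if i u = a \<and> i v = b then f a b else 0)"
  proof (rule sum.cong)
    fix i assume i: "i \<in> ?P"
    have "(\<Sum>(a, b)\<in>{1..n} \<times> {1..n}. if i u = a \<and> i v = b then f a b else 0)
        = (\<Sum>p\<in>{1..n} \<times> {1..n}. if p = (i u, i v) then f (i u) (i v) else 0)"
      by (intro sum.cong) (auto split: if_splits)
    also have "\<dots> = f (i u) (i v)" using i assms by (simp add: sum.delta PiE_iff)
    finally show "f (i u) (i v) = (\<Sum>(a, b)\<in>{1..n} \<times> {1..n}. if i u = a \<and> i v = b then f a b else 0)" by simp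
  qed simp
  also have "\<dots> = (\<Sum>(a, b)\<in>{1..n} \<times> {1..n}. \<Sum>i\<in>?P. if i u = a \<and> i v = b then f a b else 0)"
    by (subst sum.swap) (simp add: case_prod_beta')
  also have "\<dots> = (\<Sum>(a, b)\<in>{1..n} \<times> {1..n}. real n ^ (m - 2) * f a b)"
  proof (intro sum.cong refl, safe)
    fix a b assume ab: "a \<in> {1..n}" "b \<in> {1..n}"
    have "{i\<in>?P. i u = a \<and> i v = b} = {i\<in>?P. \<forall>k\<in>{u, v}. i k = (if k = u then a else b)}"
      using assms by auto
    then have "card {i\<in>?P. i u = a \<and> i v = b} = n ^ (m - 2)"
      using card_tuples_fixed[of "{1..m}" "{1..n}" "{u, v}" "\<lambda>k. if k = u then a else b"] assms ab by (simp add: numeral_2_eq_2)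
    moreover have "(\<Sum>i\<in>?P. if i u = a \<and> i v = b then f a b else 0) = real (card {i\<in>?P. i u = a \<and> i v = b}) * f a b"
      using fin by (simp add: sum.If_cases Int_def conj_commute)
    ultimately show "(\<Sum>i\<in>?P. if i u = a \<and> i v = b then f a b else 0) = real n ^ (m - 2) * f a b"
      by simp
  qed
  finally show ?thesis by (simp add: sum_distrib_left sum.cartesian_product case_prod_beta')
qed

text \<open>
A given distance from \<open>a\<close> is attained by at most two indices, one on each side.
\<close>

lemma sum_gap_le:
  fixes e :: "nat \<Rightarrow> real"
  assumes e: "\<And>d. 0 \<le> e d" "summable e"
  shows "(\<Sum>a\<in>{1..n}. \<Sum>b\<in>{1..n}. e (gap a b)) \<le> real n * (2 * suminf e)"
proof -
  have "(\<Sum>b\<in>{1..n}. e (gap a b)) \<le> 2 * suminf e" for a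
  proof -
    have "(\<Sum>b\<in>{1..n}. e (gap a b)) = (\<Sum>b\<in>{b\<in>{1..n}. b \<le> a}. e (gap a b)) + (\<Sum>b\<in>{b\<in>{1..n}. \<not> b \<le> a}. e (gap a b))"
      by (subst sum.union_disjoint[symmetric]) (auto intro!: sum.cong)
    also have "(\<Sum>b\<in>{b\<in>{1..n}. b \<le> a}. e (gap a b)) = sum e ((\<lambda>b. a - b) ` {b\<in>{1..n}. b \<le> a})"
      by (subst sum.reindex) (auto simp: inj_on_def gap_def)
    also have "\<dots> \<le> suminf e" using e by (intro sum_le_suminf) auto
    also have "(\<Sum>b\<in>{b\<in>{1..n}. \<not> b \<le> a}. e (gap a b)) = sum e ((\<lambda>b. b - a) ` {b\<in>{1..n}. \<not> b \<le> a})"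
      by (subst sum.reindex) (auto simp: inj_on_def gap_def)
    also have "\<dots> \<le> suminf e" using e by (intro sum_le_suminf) auto
    finally show ?thesis by simp
  qed
  then have "(\<Sum>a\<in>{1..n}. \<Sum>b\<in>{1..n}. e (gap a b)) \<le> (\<Sum>a\<in>{1..n}. 2 * suminf e)"
    by (intro sum_mono)
  then show ?thesis by simp
qed

text \<open>
Fixing the two slots of a gap leaves \<open>m - 2\<close> free indices, and summability pays for one of the two fixed ones.
\<close>

lemma sum_within_weight_le:
  fixes e :: "nat \<Rightarrow> real"
  assumes e: "\<And>d. 0 \<le> e d" "summable e" and m: "m \<ge> 2"
  shows "(\<Sum>i\<in>incr_tuples m {1..n}. within_weight m e i) \<le> 2 * real m ^ 2 * real n ^ (m - 1) * suminf e"
proof -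
  let ?P = "{1..m} \<rightarrow>\<^sub>E {1..n}"
  have S: "suminf e \<ge> 0" using e by (intro suminf_nonneg)
  have "(\<Sum>i\<in>incr_tuples m {1..n}. within_weight m e i) \<le> (\<Sum>i\<in>?P. within_weight m e i)"
    using e by (intro sum_mono2 incr_tuples_subset) (auto simp: finite_PiE within_weight_nonneg)
  also have "\<dots> = (\<Sum>u\<in>{1..m}. \<Sum>v\<in>{1..m} - {u}. \<Sum>i\<in>?P. e (gap (i u) (i v)))"
    unfolding within_weight_def by (subst sum.swap, intro sum.cong refl sum.swap)
  also have "\<dots> \<le> (\<Sum>u\<in>{1..m}. \<Sum>v\<in>{1..m} - {u}. real n ^ (m - 2) * (real n * (2 * suminf e)))"
  proof (intro sum_mono)
    fix u v assume "u \<in> {1..m}" "v \<in> {1..m} - {u}"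
    then have "(\<Sum>i\<in>?P. e (gap (i u) (i v))) = real n ^ (m - 2) * (\<Sum>a\<in>{1..n}. \<Sum>b\<in>{1..n}. e (gap a b))"
      by (intro sum_tuples_two_slots) auto
    also have "\<dots> \<le> real n ^ (m - 2) * (real n * (2 * suminf e))"
      by (intro mult_left_mono sum_gap_le e) auto
    finally show "(\<Sum>i\<in>?P. e (gap (i u) (i v))) \<le> real n ^ (m - 2) * (real n * (2 * suminf e))" .
  qed
  also have "\<dots> \<le> (\<Sum>u\<in>{1..m}. \<Sum>v\<in>{1..m}. real n ^ (m - 2) * (real n * (2 * suminf e)))"
    using S by (intro sum_mono sum_mono2) auto
  also have "\<dots> = 2 * real m ^ 2 * (real n * real n ^ (m - 2)) * suminf e"
    by (simp add: power2_eq_square)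
  also have "real n * real n ^ (m - 2) = real n ^ (m - 1)"
    using m by (subst power_Suc[symmetric]) (simp add: Suc_diff_le[symmetric] numeral_2_eq_2)
  finally show ?thesis .
qed

lemma sum_cross_weight_le:
  fixes e :: "nat \<Rightarrow> real"
  assumes e: "\<And>d. 0 \<le> e d" "summable e" and m: "m \<ge> 1"
  shows "(\<Sum>i\<in>incr_tuples m {1..n}. \<Sum>j\<in>incr_tuples m {1..n}. cross_weight m e i j)
    \<le> 2 * real m ^ 2 * real n ^ (2 * m - 1) * suminf e"
proof -
  let ?P = "{1..m} \<rightarrow>\<^sub>E {1..n}"
  have S: "suminf e \<ge> 0" using e by (intro suminf_nonneg)
  have "(\<Sum>i\<in>incr_tuples m {1..n}. \<Sum>j\<in>incr_tuples m {1..n}. cross_weight m e i j)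
     \<le> (\<Sum>i\<in>?P. \<Sum>j\<in>incr_tuples m {1..n}. cross_weight m e i j)"
    using e by (intro sum_mono2 incr_tuples_subset) (auto simp: finite_PiE intro!: sum_nonneg cross_weight_nonneg)
  also have "\<dots> \<le> (\<Sum>i\<in>?P. \<Sum>j\<in>?P. cross_weight m e i j)"
    using e by (intro sum_mono sum_mono2 incr_tuples_subset) (auto simp: finite_PiE cross_weight_nonneg)
  also have "\<dots> = (\<Sum>(i, j)\<in>?P \<times> ?P. \<Sum>(u, v)\<in>{1..m} \<times> {1..m}. e (gap (i u) (j v)))"
    by (simp only: cross_weight_def sum.cartesian_product[symmetric])
  also have "\<dots> = (\<Sum>(u, v)\<in>{1..m} \<times> {1..m}. \<Sum>(i, j)\<in>?P \<times> ?P. e (gap (i u) (j v)))"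
    unfolding case_prod_beta' by (rule sum.swap)
  also have "\<dots> = (\<Sum>u\<in>{1..m}. \<Sum>v\<in>{1..m}. \<Sum>i\<in>?P. \<Sum>j\<in>?P. e (gap (i u) (j v)))"
    by (simp only: sum.cartesian_product[symmetric])
  also have "\<dots> \<le> (\<Sum>u\<in>{1..m}. \<Sum>v\<in>{1..m}. real n ^ (m - 1) * (real n ^ (m - 1) * (real n * (2 * suminf e))))"
  proof (intro sum_mono)
    fix u v assume uv: "u \<in> {1..m}" "v \<in> {1..m}"
    have "(\<Sum>i\<in>?P. \<Sum>j\<in>?P. e (gap (i u) (j v))) = (\<Sum>i\<in>?P. real n ^ (m - 1) * (\<Sum>b\<in>{1..n}. e (gap (i u) b)))"
      by (intro sum.cong refl sum_tuples_slot uv)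
    also have "\<dots> = real n ^ (m - 1) * (\<Sum>i\<in>?P. \<Sum>b\<in>{1..n}. e (gap (i u) b))"
      by (simp add: sum_distrib_left)
    also have "(\<Sum>i\<in>?P. \<Sum>b\<in>{1..n}. e (gap (i u) b)) = real n ^ (m - 1) * (\<Sum>a\<in>{1..n}. \<Sum>b\<in>{1..n}. e (gap a b))"
      by (rule sum_tuples_slot[OF uv(1)])
    also have "real n ^ (m - 1) * \<dots> \<le> real n ^ (m - 1) * (real n ^ (m - 1) * (real n * (2 * suminf e)))"
      by (intro mult_left_mono sum_gap_le e) auto
    finally show "(\<Sum>i\<in>?P. \<Sum>j\<in>?P. e (gap (i u) (j v)))
        \<le> real n ^ (m - 1) * (real n ^ (m - 1) * (real n * (2 * suminf e)))" .
  qed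
  also have "\<dots> = 2 * real m ^ 2 * (real n ^ (m - 1) * real n ^ (m - 1) * real n) * suminf e"
    by (simp add: power2_eq_square)
  also have "real n ^ (m - 1) * real n ^ (m - 1) * real n = real n ^ (2 * m - 1)"
  proof -
    have "2 * m - 1 = Suc ((m - 1) + (m - 1))" using m by simp
    then show ?thesis by (simp only: power_add power_Suc mult_ac)
  qed
  finally show ?thesis .
qed

lemma card_incr_tuples_le: "real (card (incr_tuples m {1..n})) \<le> real n ^ m"
proof -
  have "card (incr_tuples m {1..n}) \<le> card ({1..m} \<rightarrow>\<^sub>E {1..n})"
    by (intro card_mono incr_tuples_subset) (simp add: finite_PiE)
  then have "card (incr_tuples m {1..n}) \<le> n ^ m" by (simp add: card_PiE)
  then show ?thesis by (metis of_nat_le_iff of_nat_power)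
qed

text \<open>
Against the \<open>n\<^sup>2\<^sup>m\<close> pairs of tuples one power of \<open>n\<close> is gained, because each term of the weight ties two of the indices together by a summable factor.
\<close>

lemma sum_weight_le:
  fixes e :: "nat \<Rightarrow> real"
  assumes e: "\<And>d. 0 \<le> e d" "summable e" and m: "m \<ge> 2"
  shows "(\<Sum>i\<in>incr_tuples m {1..n}. \<Sum>j\<in>incr_tuples m {1..n}. weight m e i j)
    \<le> 6 * real m ^ 2 * real n ^ (2 * m - 1) * suminf e"
proof -
  let ?T = "incr_tuples m {1..n}"
  let ?W = "\<Sum>i\<in>?T. within_weight m e i"
  have "?W \<ge> 0" using e by (intro sum_nonneg within_weight_nonneg)
  have "real (card ?T) * ?W \<le> real n ^ m * (2 * real m ^ 2 * real n ^ (m - 1) * suminf e)"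
    using \<open>?W \<ge> 0\<close> by (intro mult_mono card_incr_tuples_le sum_within_weight_le e m) auto
  also have "\<dots> = 2 * real m ^ 2 * (real n ^ m * real n ^ (m - 1)) * suminf e" by simp
  also have "real n ^ m * real n ^ (m - 1) = real n ^ (2 * m - 1)"
    using m by (subst power_add[symmetric]) (simp add: mult_2)
  finally have W: "real (card ?T) * ?W \<le> 2 * real m ^ 2 * real n ^ (2 * m - 1) * suminf e" .
  have "(\<Sum>i\<in>?T. \<Sum>j\<in>?T. weight m e i j)
      = real (card ?T) * ?W + real (card ?T) * ?W + (\<Sum>i\<in>?T. \<Sum>j\<in>?T. cross_weight m e i j)"
    by (simp add: weight_def sum.distrib sum_distrib_left[symmetric])
  also have "\<dots> \<le> 6 * real m ^ 2 * real n ^ (2 * m - 1) * suminf e"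
    using W sum_cross_weight_le[OF e, of m n] m by simp
  finally show ?thesis .
qed

lemma min_sum_le:
  fixes f :: "'b \<Rightarrow> real"
  assumes "finite A" "\<And>x. x \<in> A \<Longrightarrow> 0 \<le> f x" "0 \<le> c"
  shows "min (sum f A) c \<le> (\<Sum>x\<in>A. min (f x) c)"
  using assms
proof (induction A rule: finite_induct)
  case (insert x A)
  have "min (f x + sum f A) c \<le> min (f x) c + min (sum f A) c"
    using insert.prems(1)[of x] insert.prems(2) sum_nonneg[of A f, OF insert.prems(1)] by (simp add: min_def)
  then show ?case using insert by simp
qed simp

lemma min_weight_le:
  assumes e: "\<And>d. 0 \<le> e d" and c: "0 \<le> c"
  shows "min (weight m e i j) c \<le> weight m (\<lambda>d. min (e d) c) i j"
proof -
  have dbl: "min (\<Sum>u\<in>A. \<Sum>v\<in>B u. f u v) c \<le> (\<Sum>u\<in>A. \<Sum>v\<in>B u. min (f u v) c)"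
    if "finite A" "\<And>u. finite (B u)" "\<And>u v. 0 \<le> f u v" for A :: "nat set" and B :: "nat \<Rightarrow> nat set" and f
  proof -
    have "min (\<Sum>u\<in>A. \<Sum>v\<in>B u. f u v) c \<le> (\<Sum>u\<in>A. min (\<Sum>v\<in>B u. f u v) c)"
      using that c by (intro min_sum_le sum_nonneg) auto
    also have "\<dots> \<le> (\<Sum>u\<in>A. \<Sum>v\<in>B u. min (f u v) c)"
      using that c by (intro sum_mono min_sum_le) auto
    finally show ?thesis .
  qed
  have "min (within_weight m e i') c \<le> within_weight m (\<lambda>d. min (e d) c) i'" for i'
    unfolding within_weight_def by (rule dbl) (auto simp: e)
  moreover have "min (cross_weight m e i j) c \<le> cross_weight m (\<lambda>d. min (e d) c) i j"
    unfolding cross_weight_def by (rule dbl) (auto simp: e)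
  moreover have "min (weight m e i j) c \<le> min (within_weight m e i) c + min (within_weight m e j) c + min (cross_weight m e i j) c"
    unfolding weight_def using within_weight_nonneg[of e m i, OF e] within_weight_nonneg[of e m j, OF e]
      cross_weight_nonneg[of e m i j, OF e] c by (auto simp: min_def)
  ultimately show ?thesis unfolding weight_def by (smt (verit))
qed

context mixing_process
begin

lemma dep_sum_le_within:
  assumes "inj_on i {1..m}"
  shows "dep_sum (i ` {1..m}) \<le> within_weight m dep i"
proof -
  let ?I = "i ` {1..m}"
  have "dep_sum ?I \<le> (\<Sum>a\<in>?I. \<Sum>b\<in>?I - {a}. dep (gap a b))"
    unfolding dep_sum_def
  proof (intro sum_mono)
    fix a assume "a \<in> ?I"
    have "(\<Sum>b\<in>{b\<in>?I. a < b}. dep (b - a)) = (\<Sum>b\<in>{b\<in>?I. a < b}. dep (gap a b))"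
      by (intro sum.cong) (auto simp: gap_def)
    also have "\<dots> \<le> (\<Sum>b\<in>?I - {a}. dep (gap a b))" by (intro sum_mono2) auto
    finally show "(\<Sum>b\<in>{b\<in>?I. a < b}. dep (b - a)) \<le> (\<Sum>b\<in>?I - {a}. dep (gap a b))" .
  qed
  also have "\<dots> = (\<Sum>u\<in>{1..m}. \<Sum>b\<in>?I - {i u}. dep (gap (i u) b))"
    by (simp only: sum.reindex[OF assms] comp_def)
  also have "\<dots> = within_weight m dep i"
    unfolding within_weight_def
  proof (rule sum.cong[OF refl])
    fix u assume u: "u \<in> {1..m}"
    have "?I - {i u} = i ` ({1..m} - {u})"
      using inj_on_image_set_diff[OF assms, of "{1..m}" "{u}"] u by auto
    moreover have "inj_on i ({1..m} - {u})" using assms by (rule inj_on_subset) auto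
    ultimately show "(\<Sum>b\<in>?I - {i u}. dep (gap (i u) b)) = (\<Sum>v\<in>{1..m} - {u}. dep (gap (i u) (i v)))"
      by (simp only: sum.reindex comp_def)
  qed
  finally show ?thesis .
qed

text \<open>
Each pair of elements is counted once on the left, but the two halves \<open>a < b\<close> and \<open>b < a\<close> of the mixed pairs are bounded separately, whence the factor 2.
\<close>

lemma dep_sum_Un_le:
  assumes fin: "finite A" "finite B" and disj: "A \<inter> B = {}"
  shows "dep_sum (A \<union> B) \<le> dep_sum A + dep_sum B + 2 * (\<Sum>a\<in>A. \<Sum>b\<in>B. dep (gap a b))"
proof -
  have split: "(\<Sum>b\<in>{b\<in>A \<union> B. a < b}. dep (b - a)) = (\<Sum>b\<in>{b\<in>A. a < b}. dep (b - a)) + (\<Sum>b\<in>{b\<in>B. a < b}. dep (b - a))" for a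
    using fin disj by (subst sum.union_disjoint[symmetric]) (auto intro!: sum.cong)
  have bound: "(\<Sum>b\<in>{b\<in>D. a < b}. dep (b - a)) \<le> (\<Sum>b\<in>D. dep (gap a b))" if "finite D" for D a
  proof -
    have "(\<Sum>b\<in>{b\<in>D. a < b}. dep (b - a)) = (\<Sum>b\<in>{b\<in>D. a < b}. dep (gap a b))"
      by (intro sum.cong) (auto simp: gap_def)
    also have "\<dots> \<le> (\<Sum>b\<in>D. dep (gap a b))" using that by (intro sum_mono2) auto
    finally show ?thesis .
  qed
  have "dep_sum (A \<union> B) = (\<Sum>a\<in>A. \<Sum>b\<in>{b\<in>A \<union> B. a < b}. dep (b - a)) + (\<Sum>a\<in>B. \<Sum>b\<in>{b\<in>A \<union> B. a < b}. dep (b - a))"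
    unfolding dep_sum_def using fin disj by (rule sum.union_disjoint)
  also have "\<dots> = dep_sum A + (\<Sum>a\<in>A. \<Sum>b\<in>{b\<in>B. a < b}. dep (b - a))
      + ((\<Sum>a\<in>B. \<Sum>b\<in>{b\<in>A. a < b}. dep (b - a)) + dep_sum B)"
    by (simp only: split sum.distrib dep_sum_def)
  also have "(\<Sum>a\<in>A. \<Sum>b\<in>{b\<in>B. a < b}. dep (b - a)) \<le> (\<Sum>a\<in>A. \<Sum>b\<in>B. dep (gap a b))"
    by (intro sum_mono bound fin)
  also have "(\<Sum>a\<in>B. \<Sum>b\<in>{b\<in>A. a < b}. dep (b - a)) \<le> (\<Sum>a\<in>B. \<Sum>b\<in>A. dep (gap a b))"
    by (intro sum_mono bound fin)
  also have "(\<Sum>a\<in>B. \<Sum>b\<in>A. dep (gap a b)) = (\<Sum>a\<in>A. \<Sum>b\<in>B. dep (gap a b))"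
    by (subst sum.swap, subst gap_commute) (rule refl)
  finally show ?thesis by simp
qed

lemma dep_sum_le_weight:
  assumes i: "inj_on i {1..m}" and j: "inj_on j {1..m}" and disj: "i ` {1..m} \<inter> j ` {1..m} = {}"
  shows "dep_sum (i ` {1..m} \<union> j ` {1..m}) \<le> 2 * weight m dep i j"
proof -
  have "(\<Sum>a\<in>i ` {1..m}. \<Sum>b\<in>j ` {1..m}. dep (gap a b)) = cross_weight m dep i j"
    unfolding cross_weight_def by (simp only: sum.reindex[OF i] sum.reindex[OF j] comp_def)
  then show ?thesis
    using dep_sum_Un_le[OF _ _ disj] dep_sum_le_within[OF i] dep_sum_le_within[OF j]
      within_weight_nonneg[of dep m i] within_weight_nonneg[of dep m j]
    by (simp add: weight_def)
qed

lemma summable_dep: "summable dep"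
proof -
  have "summable (\<lambda>d. real (Suc d) powr (- \<beta>))"
    using beta_gt_1 summable_real_powr_iff[of "-\<beta>"] by (subst summable_Suc_iff) simp
  then show ?thesis by (simp add: dep_def[abs_def] add.commute)
qed

lemma dep_antimono: "c \<le> d \<Longrightarrow> dep d \<le> dep c"
  unfolding dep_def using beta_gt_1 by (intro powr_mono2') auto

end

section \<open>Second moments of the empirical distribution function\<close>

lemma suminf_min_tendsto_0:
  fixes e :: "nat \<Rightarrow> real"
  assumes e: "\<And>d. 0 \<le> e d" "summable e" and c: "\<And>n. 0 \<le> c n" "c \<longlonglongrightarrow> 0"
  shows "(\<lambda>n::nat. \<Sum>d. min (e d) (c n)) \<longlonglongrightarrow> 0"
proof -
  have "(\<lambda>n. \<Sum>d. min (e d) (c n)) \<longlonglongrightarrow> (\<Sum>d. 0)"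
  proof (rule tannerys_theorem[THEN conjunct2, THEN conjunct2])
    show "(\<lambda>n. min (e d) (c n)) \<longlonglongrightarrow> 0" for d
      using tendsto_min[OF tendsto_const[of "e d"] c(2)] e(1)[of d] by simp
    show "\<forall>\<^sub>F (d, n) in at_top \<times>\<^sub>F sequentially. norm (min (e d) (c n)) \<le> e d"
      using e(1) c(1) by (intro always_eventually) auto
  qed (use e in auto)
  then show ?thesis by simp
qed

lemma (in prob_space) expectation_of_bool:
  assumes "{\<omega>\<in>space M. P \<omega>} \<in> events"
  shows "expectation (\<lambda>\<omega>. of_bool (P \<omega>) :: real) = prob {\<omega>\<in>space M. P \<omega>}"
proof -
  have "expectation (\<lambda>\<omega>. of_bool (P \<omega>) :: real) = expectation (indicator {\<omega>\<in>space M. P \<omega>})"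
    by (intro Bochner_Integration.integral_cong) (auto simp: indicator_def)
  then show ?thesis using assms by simp
qed

lemma (in prob_space) second_moment_sum_le:
  fixes Z :: "'b \<Rightarrow> 'a \<Rightarrow> real"
  assumes "finite T" and meas: "\<And>i. i \<in> T \<Longrightarrow> Z i \<in> borel_measurable M"
    and bound: "\<And>i \<omega>. i \<in> T \<Longrightarrow> \<bar>Z i \<omega>\<bar> \<le> c"
  shows "expectation (\<lambda>\<omega>. (\<Sum>i\<in>T. Z i \<omega>)\<^sup>2) \<le> (\<Sum>i\<in>T. \<Sum>j\<in>T. \<bar>expectation (\<lambda>\<omega>. Z i \<omega> * Z j \<omega>)\<bar>)"
proof -
  have int: "integrable M (\<lambda>\<omega>. Z i \<omega> * Z j \<omega>)" if "i \<in> T" "j \<in> T" for i j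
  proof (rule integrable_const_bound[where B = "c * c"])
    show "AE \<omega> in M. norm (Z i \<omega> * Z j \<omega>) \<le> c * c"
      using that bound by (auto simp: abs_mult intro!: AE_I2 mult_mono' order_trans[OF abs_ge_zero bound])
  qed (use that meas in auto)
  have "expectation (\<lambda>\<omega>. (\<Sum>i\<in>T. Z i \<omega>)\<^sup>2) = (\<Sum>i\<in>T. \<Sum>j\<in>T. expectation (\<lambda>\<omega>. Z i \<omega> * Z j \<omega>))"
    by (simp add: power2_eq_square sum_product int)
  also have "\<dots> \<le> (\<Sum>i\<in>T. \<Sum>j\<in>T. \<bar>expectation (\<lambda>\<omega>. Z i \<omega> * Z j \<omega>)\<bar>)"
    by (intro sum_mono abs_ge_self)
  finally show ?thesis .
qed

context kernel_process
begin

definition "kernel_at i \<omega> = at_tuple i (\<lambda>k. X k \<omega>)"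

definition "centred i t \<omega> = of_bool (kernel_at i \<omega> \<le> t) - H t"

lemma kernel_at_measurable:
  assumes "i ` {1..m} \<subseteq> {1..}"
  shows "kernel_at i \<in> borel_measurable M"
  unfolding kernel_at_def at_tuple_def
  by (rule measurable_compose[OF measurable_restrict h_meas])
     (use assms in \<open>auto simp: image_subset_iff intro!: X_meas\<close>)

lemma centred_measurable:
  assumes "i ` {1..m} \<subseteq> {1..}"
  shows "centred i t \<in> borel_measurable M"
  unfolding centred_def using kernel_at_measurable[OF assms] by measurable

lemma centred_bound: "\<bar>centred i t \<omega>\<bar> \<le> 1"
  using H_bounds[of t] by (auto simp: centred_def)

text \<open>
For disjoint tuples the covariance is expanded into deviations of probabilities from their values
under independence.  If the tuples share an index, then the weight contains the term \<open>dep 0 = 1\<close> and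
the trivial bound is enough.
\<close>

lemma covariance_bounds:
  obtains C where "C \<ge> 1"
    "\<And>i t. i \<in> incr_tuples m {1..} \<Longrightarrow>
       \<bar>prob {\<omega>\<in>space M. kernel_at i \<omega> \<le> t} - H t\<bar> \<le> C * within_weight m dep i"
    "\<And>i j s t. \<lbrakk>i \<in> incr_tuples m {1..}; j \<in> incr_tuples m {1..}\<rbrakk> \<Longrightarrow>
       \<bar>expectation (\<lambda>\<omega>. centred i s \<omega> * centred j t \<omega>)\<bar> \<le> C * weight m dep i j"
proof -
  obtain C where C: "C \<ge> 1" and one:
    "\<And>i t. \<lbrakk>inj_on i {1..m}; i ` {1..m} \<subseteq> {1..}\<rbrakk> \<Longrightarrow>
       \<bar>prob {\<omega>\<in>space M. at_tuple i (\<lambda>k. X k \<omega>) \<le> t} - H t\<bar> \<le> C * dep_sum (i ` {1..m})"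
    and two:
    "\<And>i j s t. \<lbrakk>inj_on i {1..m}; i ` {1..m} \<subseteq> {1..}; inj_on j {1..m}; j ` {1..m} \<subseteq> {1..};
        i ` {1..m} \<inter> j ` {1..m} = {}\<rbrakk> \<Longrightarrow>
       \<bar>prob {\<omega>\<in>space M. at_tuple i (\<lambda>k. X k \<omega>) \<le> s \<and> at_tuple j (\<lambda>k. X k \<omega>) \<le> t} - H s * H t\<bar>
         \<le> C * dep_sum (i ` {1..m} \<union> j ` {1..m})"
    using decoupled_dfs by blast
  have W: "0 \<le> within_weight m dep i" "0 \<le> cross_weight m dep i j" for i j
    by (simp_all add: within_weight_nonneg cross_weight_nonneg)
  have P1: "\<bar>prob {\<omega>\<in>space M. kernel_at i \<omega> \<le> t} - H t\<bar> \<le> C * within_weight m dep i"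
    if i: "i \<in> incr_tuples m {1..}" for i t
  proof -
    have "\<bar>prob {\<omega>\<in>space M. kernel_at i \<omega> \<le> t} - H t\<bar> \<le> C * dep_sum (i ` {1..m})"
      unfolding kernel_at_def by (rule one[OF incr_tuples_inj[OF i] incr_tuples_image[OF i]])
    also have "\<dots> \<le> C * within_weight m dep i"
      using C by (intro mult_left_mono dep_sum_le_within incr_tuples_inj[OF i]) auto
    finally show ?thesis .
  qed
  have P2: "\<bar>expectation (\<lambda>\<omega>. centred i s \<omega> * centred j t \<omega>)\<bar> \<le> 4 * C * weight m dep i j"
    if i: "i \<in> incr_tuples m {1..}" and j: "j \<in> incr_tuples m {1..}" for i j s t
  proof (cases "i ` {1..m} \<inter> j ` {1..m} = {}")
    case False
    then obtain u v where uv: "u \<in> {1..m}" "v \<in> {1..m}" "i u = j v" by blast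
    have "1 = dep (gap (i u) (j v))" using uv by (simp add: gap_def dep_def)
    also have "\<dots> \<le> (\<Sum>v\<in>{1..m}. dep (gap (i u) (j v)))" using uv by (intro member_le_sum) auto
    also have "\<dots> \<le> cross_weight m dep i j"
      unfolding cross_weight_def using uv by (intro member_le_sum[where f = "\<lambda>u. \<Sum>v\<in>{1..m}. dep (gap (i u) (j v))"]) (auto intro: sum_nonneg)
    also have "\<dots> \<le> weight m dep i j" using W by (simp add: weight_def)
    finally have w: "1 \<le> weight m dep i j" .
    have "\<bar>expectation (\<lambda>\<omega>. centred i s \<omega> * centred j t \<omega>)\<bar> \<le> expectation (\<lambda>\<omega>. 1)"
    proof (rule order_trans[OF integral_abs_bound], rule integral_mono')
      fix \<omega> show "\<bar>centred i s \<omega> * centred j t \<omega>\<bar> \<le> 1"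
        unfolding abs_mult by (intro mult_le_one centred_bound) auto
    qed auto
    also have "\<dots> \<le> 4 * C * weight m dep i j"
      using mult_mono[of 1 "4 * C" 1 "weight m dep i j"] C w by (simp add: prob_space)
    finally show ?thesis .
  next
    case True
    note mi = kernel_at_measurable[OF incr_tuples_image[OF i]] and mj = kernel_at_measurable[OF incr_tuples_image[OF j]]
    define pi pj pij where "pi = prob {\<omega>\<in>space M. kernel_at i \<omega> \<le> s}"
      and "pj = prob {\<omega>\<in>space M. kernel_at j \<omega> \<le> t}"
      and "pij = prob {\<omega>\<in>space M. kernel_at i \<omega> \<le> s \<and> kernel_at j \<omega> \<le> t}"
    let ?w = "C * weight m dep i j"
    have "\<bar>pij - H s * H t\<bar> \<le> C * dep_sum (i ` {1..m} \<union> j ` {1..m})"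
      unfolding pij_def kernel_at_def
      by (rule two[OF incr_tuples_inj[OF i] incr_tuples_image[OF i] incr_tuples_inj[OF j] incr_tuples_image[OF j] True])
    also have "\<dots> \<le> C * (2 * weight m dep i j)"
      using C by (intro mult_left_mono dep_sum_le_weight True incr_tuples_inj[OF i] incr_tuples_inj[OF j]) auto
    finally have b: "\<bar>pij - H s * H t\<bar> \<le> 2 * ?w" by simp
    have bi: "\<bar>pi - H s\<bar> \<le> ?w"
      unfolding pi_def using C W by (intro order_trans[OF P1[OF i]] mult_left_mono) (auto simp: weight_def)
    have bj: "\<bar>pj - H t\<bar> \<le> ?w"
      unfolding pj_def using C W by (intro order_trans[OF P1[OF j]] mult_left_mono) (auto simp: weight_def)
    have "expectation (\<lambda>\<omega>. centred i s \<omega> * centred j t \<omega>)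
      = expectation (\<lambda>\<omega>. of_bool (kernel_at i \<omega> \<le> s \<and> kernel_at j \<omega> \<le> t)
          - H t * of_bool (kernel_at i \<omega> \<le> s) - H s * of_bool (kernel_at j \<omega> \<le> t) + H s * H t)"
      by (intro Bochner_Integration.integral_cong refl) (simp add: centred_def algebra_simps of_bool_conj)
    also have "\<dots> = pij - H t * pi - H s * pj + H s * H t"
    proof -
      have int: "integrable M (\<lambda>\<omega>. of_bool (kernel_at i \<omega> \<le> s \<and> kernel_at j \<omega> \<le> t) :: real)"
        "integrable M (\<lambda>\<omega>. of_bool (kernel_at i \<omega> \<le> s) :: real)"
        "integrable M (\<lambda>\<omega>. of_bool (kernel_at j \<omega> \<le> t) :: real)"
        using mi mj by (auto intro!: integrable_const_bound[where B = 1])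
      then show ?thesis
        using mi mj by (simp add: expectation_of_bool pi_def pj_def pij_def prob_space)
    qed
    also have "\<dots> = (pij - H s * H t) - H t * (pi - H s) - H s * (pj - H t)" by (simp add: algebra_simps)
    finally have eq: "expectation (\<lambda>\<omega>. centred i s \<omega> * centred j t \<omega>)
      = (pij - H s * H t) - H t * (pi - H s) - H s * (pj - H t)" .
    have "\<bar>H t * (pi - H s)\<bar> \<le> 1 * ?w" unfolding abs_mult using bi H_bounds by (intro mult_mono) auto
    moreover have "\<bar>H s * (pj - H t)\<bar> \<le> 1 * ?w" unfolding abs_mult using bj H_bounds by (intro mult_mono) auto
    ultimately have "\<bar>expectation (\<lambda>\<omega>. centred i s \<omega> * centred j t \<omega>)\<bar> \<le> 2 * ?w + ?w + ?w"
      using b unfolding eq by arith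
    then show ?thesis by simp
  qed
  show thesis
  proof (rule that[of "4 * C"])
    fix i t assume i: "i \<in> incr_tuples m {1..}"
    have "C * within_weight m dep i \<le> (4 * C) * within_weight m dep i"
      using C W(1)[of i] by (intro mult_right_mono) auto
    with P1[OF i, of t] show "\<bar>prob {\<omega>\<in>space M. kernel_at i \<omega> \<le> t} - H t\<bar> \<le> 4 * C * within_weight m dep i"
      by linarith
  qed (use C P2 in auto)
qed

abbreviation "tuples n \<equiv> incr_tuples m {1..n}"

lemma tuples_subset: "tuples n \<subseteq> incr_tuples m {1..}"
  by (rule incr_tuples_mono) auto

lemma empirical_df_centred:
  assumes "n \<ge> m"
  shows "empirical_df m h X n \<omega> t - H t = (\<Sum>i\<in>tuples n. centred i t \<omega>) / real (n choose m)"
proof -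
  have pos: "real (n choose m) > 0" using assms by simp
  have "(\<Sum>i\<in>tuples n. centred i t \<omega>)
      = (\<Sum>i\<in>tuples n. of_bool (kernel_at i \<omega> \<le> t)) - real (n choose m) * H t"
    by (simp add: centred_def sum_subtractf card_incr_tuples[simplified])
  then show ?thesis
    using pos by (simp add: empirical_df_def kernel_at_def at_tuple_def field_simps)
qed

lemma choose_lower:
  assumes "n \<ge> m"
  shows "real n ^ (2 * m) \<le> real m ^ (2 * m) * (real (n choose m))\<^sup>2"
proof -
  have "(real n / real m) ^ m \<le> real (n choose m)"
    by (rule binomial_ge_n_over_k_pow_k[OF assms])
  then have "real n ^ m \<le> real m ^ m * real (n choose m)"
    using m2 by (simp add: power_divide field_simps)
  then have "(real n ^ m)\<^sup>2 \<le> (real m ^ m * real (n choose m))\<^sup>2"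
    by (intro power_mono) auto
  then show ?thesis by (simp add: power_mult_distrib power_mult[symmetric] mult.commute)
qed

lemma scaled_second_moment_le:
  assumes n: "n \<ge> m" and c: "\<And>i \<omega>. i \<in> tuples n \<Longrightarrow> \<bar>Z i \<omega>\<bar> \<le> c"
    and meas: "\<And>i. i \<in> tuples n \<Longrightarrow> Z i \<in> borel_measurable M"
    and b: "\<And>i j. i \<in> tuples n \<Longrightarrow> j \<in> tuples n \<Longrightarrow> \<bar>expectation (\<lambda>\<omega>. Z i \<omega> * Z j \<omega>)\<bar> \<le> b i j"
    and S: "(\<Sum>i\<in>tuples n. \<Sum>j\<in>tuples n. b i j) \<le> S"
  shows "expectation (\<lambda>\<omega>. ((\<Sum>i\<in>tuples n. Z i \<omega>) / real (n choose m))\<^sup>2) \<le> real m ^ (2 * m) * S / real n ^ (2 * m)"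
proof -
  have pos: "real (n choose m) > 0" "real n > 0" using n m2 by auto
  have "expectation (\<lambda>\<omega>. (\<Sum>i\<in>tuples n. Z i \<omega>)\<^sup>2) \<le> (\<Sum>i\<in>tuples n. \<Sum>j\<in>tuples n. \<bar>expectation (\<lambda>\<omega>. Z i \<omega> * Z j \<omega>)\<bar>)"
    using second_moment_sum_le[of "tuples n" Z c] meas c by simp
  also have "\<dots> \<le> (\<Sum>i\<in>tuples n. \<Sum>j\<in>tuples n. b i j)" by (intro sum_mono b)
  finally have le: "expectation (\<lambda>\<omega>. (\<Sum>i\<in>tuples n. Z i \<omega>)\<^sup>2) \<le> S" using S by simp
  have S0: "S \<ge> 0" by (rule order_trans[OF Bochner_Integration.integral_nonneg le]) simp
  have "expectation (\<lambda>\<omega>. ((\<Sum>i\<in>tuples n. Z i \<omega>) / real (n choose m))\<^sup>2)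
      = expectation (\<lambda>\<omega>. (\<Sum>i\<in>tuples n. Z i \<omega>)\<^sup>2) / (real (n choose m))\<^sup>2"
    by (simp add: power_divide)
  also have "\<dots> \<le> S / (real (n choose m))\<^sup>2" using le by (intro divide_right_mono) auto
  also have "\<dots> \<le> real m ^ (2 * m) * S / real n ^ (2 * m)"
    using mult_right_mono[OF choose_lower[OF n] S0] pos by (simp add: field_simps)
  finally show ?thesis .
qed

text \<open>
The number of pairs of tuples is of order \<open>n\<^sup>2\<^sup>m\<close> and the covariances sum up to \<open>O(n\<^sup>2\<^sup>m\<^sup>-\<^sup>1)\<close>.
\<close>

lemma empirical_df_second_moment:
  obtains C where "C \<ge> 0" "\<And>n t. n \<ge> m \<Longrightarrow>
    expectation (\<lambda>\<omega>. (empirical_df m h X n \<omega> t - H t)\<^sup>2) \<le> C / real n"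
proof -
  obtain C where C: "C \<ge> 1" and "\<And>i t. i \<in> incr_tuples m {1..} \<Longrightarrow>
       \<bar>prob {\<omega>\<in>space M. kernel_at i \<omega> \<le> t} - H t\<bar> \<le> C * within_weight m dep i"
    and cov: "\<And>i j s t. \<lbrakk>i \<in> incr_tuples m {1..}; j \<in> incr_tuples m {1..}\<rbrakk> \<Longrightarrow>
       \<bar>expectation (\<lambda>\<omega>. centred i s \<omega> * centred j t \<omega>)\<bar> \<le> C * weight m dep i j"
    using covariance_bounds by blast
  have Sd: "suminf dep \<ge> 0" by (intro suminf_nonneg summable_dep) simp
  define A where "A = C * (6 * real m ^ 2 * suminf dep)"
  have A: "A \<ge> 0" using C Sd by (simp add: A_def)
  show thesis
  proof (rule that[of "real m ^ (2 * m) * A"])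
    show "0 \<le> real m ^ (2 * m) * A" using A by simp
    fix n :: nat and t :: real assume n: "n \<ge> m"
    then have pos: "real n > 0" using m2 by simp
    have sum: "(\<Sum>i\<in>tuples n. \<Sum>j\<in>tuples n. C * weight m dep i j) \<le> A * real n ^ (2 * m - 1)"
    proof -
      have "(\<Sum>i\<in>tuples n. \<Sum>j\<in>tuples n. C * weight m dep i j) = C * (\<Sum>i\<in>tuples n. \<Sum>j\<in>tuples n. weight m dep i j)"
        by (simp add: sum_distrib_left)
      also have "\<dots> \<le> C * (6 * real m ^ 2 * real n ^ (2 * m - 1) * suminf dep)"
        using C m2 by (intro mult_left_mono sum_weight_le summable_dep) auto
      finally show ?thesis by (simp add: A_def mult_ac)
    qed
    have "expectation (\<lambda>\<omega>. (empirical_df m h X n \<omega> t - H t)\<^sup>2)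
        \<le> real m ^ (2 * m) * (A * real n ^ (2 * m - 1)) / real n ^ (2 * m)"
      unfolding empirical_df_centred[OF n]
    proof (rule scaled_second_moment_le[OF n, where c = 1 and b = "\<lambda>i j. C * weight m dep i j"])
      show "centred i t \<in> borel_measurable M" if "i \<in> tuples n" for i
        using that tuples_subset by (intro centred_measurable incr_tuples_image) blast
      show "\<bar>expectation (\<lambda>\<omega>. centred i t \<omega> * centred j t \<omega>)\<bar> \<le> C * weight m dep i j"
        if "i \<in> tuples n" "j \<in> tuples n" for i j
        using that tuples_subset by (intro cov) blast+
    qed (use centred_bound sum in auto)
    also have "real n ^ (2 * m) = real n ^ (2 * m - 1) * real n"
      using m2 by (subst power_Suc2[symmetric]) simp
    finally show "expectation (\<lambda>\<omega>. (empirical_df m h X n \<omega> t - H t)\<^sup>2) \<le> real m ^ (2 * m) * A / real n"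
      using pos by simp
  qed
qed


text \<open>
Two bounds for the covariance of increments.  The first decays with the gaps but does not see that
\<open>s\<close> and \<open>t\<close> are close.  The second sees this: the other increment is bounded by 1, and the mean of
\<open>\<bar>centred i t - centred i s\<bar>\<close> is the probability of \<open>s < U\<^sub>i \<le> t\<close> up to the deterministic increment.
Which of the two tuples is used for the second bound is free by symmetry.
\<close>

lemma tuple_increment_bounds:
  obtains C where "C \<ge> 1"
    "\<And>i j s t. \<lbrakk>i \<in> incr_tuples m {1..}; j \<in> incr_tuples m {1..}\<rbrakk> \<Longrightarrow>
       \<bar>expectation (\<lambda>\<omega>. (centred i t \<omega> - centred i s \<omega>) * (centred j t \<omega> - centred j s \<omega>))\<bar>
         \<le> C * weight m dep i j"
    "\<And>i j s t. \<lbrakk>i \<in> incr_tuples m {1..}; j \<in> incr_tuples m {1..}\<rbrakk> \<Longrightarrow>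
       \<bar>expectation (\<lambda>\<omega>. (centred i t \<omega> - centred i s \<omega>) * (centred j t \<omega> - centred j s \<omega>))\<bar>
         \<le> C * (\<bar>H t - H s\<bar> + within_weight m dep i)"
proof -
  obtain C where C: "C \<ge> 1" and df: "\<And>i t. i \<in> incr_tuples m {1..} \<Longrightarrow>
       \<bar>prob {\<omega>\<in>space M. kernel_at i \<omega> \<le> t} - H t\<bar> \<le> C * within_weight m dep i"
    and cov: "\<And>i j s t. \<lbrakk>i \<in> incr_tuples m {1..}; j \<in> incr_tuples m {1..}\<rbrakk> \<Longrightarrow>
       \<bar>expectation (\<lambda>\<omega>. centred i s \<omega> * centred j t \<omega>)\<bar> \<le> C * weight m dep i j"
    using covariance_bounds by blast
  have int: "integrable M (\<lambda>\<omega>. centred i s \<omega> * centred j t \<omega>)"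
    if "i \<in> incr_tuples m {1..}" "j \<in> incr_tuples m {1..}" for i j s t
  proof (rule integrable_const_bound[where B = 1])
    show "AE \<omega> in M. norm (centred i s \<omega> * centred j t \<omega>) \<le> 1"
      by (auto simp: abs_mult intro!: AE_I2 mult_le_one centred_bound)
    show "(\<lambda>\<omega>. centred i s \<omega> * centred j t \<omega>) \<in> borel_measurable M"
      by (intro borel_measurable_times centred_measurable incr_tuples_image that)
  qed
  have small: "\<bar>expectation (\<lambda>\<omega>. (centred i t \<omega> - centred i s \<omega>) * (centred j t \<omega> - centred j s \<omega>))\<bar>
         \<le> 2 * (\<bar>H t - H s\<bar> + C * within_weight m dep i)"
    if i: "i \<in> incr_tuples m {1..}" and j: "j \<in> incr_tuples m {1..}" and st: "s \<le> t" for i j s t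
  proof -
    note mi = kernel_at_measurable[OF incr_tuples_image[OF i]]
    have int1: "integrable M (\<lambda>\<omega>. of_bool (kernel_at i \<omega> \<le> r) :: real)" for r
      using mi by (auto intro!: integrable_const_bound[where B = 1])
    have "H s \<le> H t" unfolding H_eq
    proof -
      interpret P: prob_space "PiM {1..m} (\<lambda>_. \<mu>)" by (intro prob_space_PiM mu.prob_space_axioms)
      have "h \<in> borel_measurable (PiM {1..m} (\<lambda>_. \<mu>))"
        using h_meas by (simp cong: measurable_cong_sets sets_PiM_cong)
      then have "{x\<in>space (PiM {1..m} (\<lambda>_. \<mu>)). h x \<le> t} \<in> P.events" by measurable
      then show "P.prob {x\<in>{1..m} \<rightarrow>\<^sub>E UNIV. h x \<le> s} \<le> P.prob {x\<in>{1..m} \<rightarrow>\<^sub>E UNIV. h x \<le> t}"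
        using st by (intro P.finite_measure_mono) (auto simp: space_PiM)
    qed
    then have Hst: "\<bar>H t - H s\<bar> = H t - H s" by simp
    have "\<bar>expectation (\<lambda>\<omega>. (centred i t \<omega> - centred i s \<omega>) * (centred j t \<omega> - centred j s \<omega>))\<bar>
        \<le> expectation (\<lambda>\<omega>. (of_bool (kernel_at i \<omega> \<le> t) - of_bool (kernel_at i \<omega> \<le> s)) + (H t - H s))"
    proof (rule order_trans[OF integral_abs_bound], rule integral_mono')
      fix \<omega>
      have "\<bar>centred j t \<omega> - centred j s \<omega>\<bar> \<le> 1"
        using st \<open>H s \<le> H t\<close> H_bounds[of s] H_bounds[of t] by (auto simp: centred_def)
      then have "\<bar>(centred i t \<omega> - centred i s \<omega>) * (centred j t \<omega> - centred j s \<omega>)\<bar> \<le> \<bar>centred i t \<omega> - centred i s \<omega>\<bar> * 1"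
        unfolding abs_mult by (intro mult_left_mono) auto
      also have "\<dots> \<le> (of_bool (kernel_at i \<omega> \<le> t) - of_bool (kernel_at i \<omega> \<le> s)) + (H t - H s)"
        using st \<open>H s \<le> H t\<close> by (auto simp: centred_def)
      finally show "\<bar>(centred i t \<omega> - centred i s \<omega>) * (centred j t \<omega> - centred j s \<omega>)\<bar>
          \<le> (of_bool (kernel_at i \<omega> \<le> t) - of_bool (kernel_at i \<omega> \<le> s)) + (H t - H s)" .
      then show "0 \<le> (of_bool (kernel_at i \<omega> \<le> t) - of_bool (kernel_at i \<omega> \<le> s)) + (H t - H s)"
        by (rule order_trans[OF abs_ge_zero])
    qed (use int1 in auto)
    also have "\<dots> = (prob {\<omega>\<in>space M. kernel_at i \<omega> \<le> t} - prob {\<omega>\<in>space M. kernel_at i \<omega> \<le> s}) + (H t - H s)"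
      using int1 mi by (simp add: expectation_of_bool prob_space)
    also have "\<dots> \<le> 2 * (\<bar>H t - H s\<bar> + C * within_weight m dep i)"
      using df[OF i, of s] df[OF i, of t] unfolding Hst by (simp add: abs_le_iff)
    finally show ?thesis .
  qed
  show thesis
  proof (rule that[of "4 * C"])
    fix i j s t assume i: "i \<in> incr_tuples m {1..}" and j: "j \<in> incr_tuples m {1..}"
    let ?E = "expectation (\<lambda>\<omega>. (centred i t \<omega> - centred i s \<omega>) * (centred j t \<omega> - centred j s \<omega>))"
    let ?c = "\<lambda>s t. expectation (\<lambda>\<omega>. centred i s \<omega> * centred j t \<omega>)"
    have "?E = ?c t t - ?c t s - ?c s t + ?c s s"
      using int[OF i j] by (simp add: algebra_simps)
    then show "\<bar>?E\<bar> \<le> 4 * C * weight m dep i j"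
      using cov[OF i j, of t t] cov[OF i j, of t s] cov[OF i j, of s t] cov[OF i j, of s s] by linarith
    have "\<bar>?E\<bar> \<le> 2 * (\<bar>H t - H s\<bar> + C * within_weight m dep i)"
    proof (cases "s \<le> t")
      case False
      have "?E = expectation (\<lambda>\<omega>. (centred i s \<omega> - centred i t \<omega>) * (centred j s \<omega> - centred j t \<omega>))"
        by (intro Bochner_Integration.integral_cong refl) (simp add: algebra_simps)
      with small[OF i j, of t s] False show ?thesis by (simp add: abs_minus_commute)
    qed (rule small[OF i j])
    also have "\<dots> \<le> 4 * C * (\<bar>H t - H s\<bar> + within_weight m dep i)"
    proof -
      have "0 \<le> C * within_weight m dep i" "0 \<le> C * \<bar>H t - H s\<bar>"
        using C by (auto intro!: mult_nonneg_nonneg within_weight_nonneg)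
      with mult_right_mono[OF C, of "\<bar>H t - H s\<bar>"] show ?thesis by (simp add: distrib_left)
    qed
    finally show "\<bar>?E\<bar> \<le> 4 * C * (\<bar>H t - H s\<bar> + within_weight m dep i)" .
  qed (use C in simp)
qed

text \<open>
The two bounds of \<open>tuple_increment_bounds\<close> are combined.  Call a tuple tight if two of its indices
are at distance at most \<open>D n\<close>, where \<open>D n\<close> is about \<open>n\<^sup>1\<^sup>/\<^sup>4\<close>.  If \<open>i\<close> or \<open>j\<close> is not tight, the covariance is
at most both the weight and \<open>\<kappa> n\<close>, which tends to 0; capping the summable errors at \<open>\<kappa> n\<close> makes the
sum over such pairs \<open>o(n\<^sup>2\<^sup>m\<^sup>-\<^sup>1)\<close>.  A share \<open>O(D n / n)\<close> of all tuples is tight, so pairs of tight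
tuples contribute \<open>O(n\<^sup>2\<^sup>m * (D n / n)\<^sup>2)\<close>, which is \<open>o(n\<^sup>2\<^sup>m\<^sup>-\<^sup>1)\<close> because \<open>(D n)\<^sup>2 = o(n)\<close>.
\<close>

lemma empirical_df_increment:
  assumes x: "(\<lambda>n. H (x n)) \<longlonglongrightarrow> H \<xi>"
  shows "(\<lambda>n. real n * expectation (\<lambda>\<omega>. ((empirical_df m h X n \<omega> (x n) - H (x n))
     - (empirical_df m h X n \<omega> \<xi> - H \<xi>))\<^sup>2)) \<longlonglongrightarrow> 0"
proof -
  obtain C where C: "C \<ge> 1"
    and b1: "\<And>i j s t. \<lbrakk>i \<in> incr_tuples m {1..}; j \<in> incr_tuples m {1..}\<rbrakk> \<Longrightarrow>
       \<bar>expectation (\<lambda>\<omega>. (centred i t \<omega> - centred i s \<omega>) * (centred j t \<omega> - centred j s \<omega>))\<bar>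
         \<le> C * weight m dep i j"
    and b2: "\<And>i j s t. \<lbrakk>i \<in> incr_tuples m {1..}; j \<in> incr_tuples m {1..}\<rbrakk> \<Longrightarrow>
       \<bar>expectation (\<lambda>\<omega>. (centred i t \<omega> - centred i s \<omega>) * (centred j t \<omega> - centred j s \<omega>))\<bar>
         \<le> C * (\<bar>H t - H s\<bar> + within_weight m dep i)"
    using tuple_increment_bounds by blast
  define D where "D n = nat \<lfloor>real n powr (1 / 4)\<rfloor>" for n
  define \<kappa> where "\<kappa> n = C * (\<bar>H (x n) - H \<xi>\<bar> + real m ^ 2 * dep (D n))" for n
  define near where "near n d = (of_bool (d \<le> D n) :: real)" for n d
  define \<Psi> where "\<Psi> n = (\<Sum>d. min (C * dep d) (\<kappa> n))" for n
  define E where "E n = expectation (\<lambda>\<omega>. ((empirical_df m h X n \<omega> (x n) - H (x n))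
     - (empirical_df m h X n \<omega> \<xi> - H \<xi>))\<^sup>2)" for n
  have k0: "\<kappa> n \<ge> 0" for n using C by (simp add: \<kappa>_def)
  have "filterlim D at_top at_top" unfolding D_def by real_asymp
  then have "(\<lambda>n. dep (D n)) \<longlonglongrightarrow> 0"
    by (rule filterlim_compose[OF summable_LIMSEQ_zero[OF summable_dep]])
  moreover have "(\<lambda>n. \<bar>H (x n) - H \<xi>\<bar>) \<longlonglongrightarrow> 0"
    using tendsto_rabs[OF tendsto_diff[OF x tendsto_const[of "H \<xi>"]]] by simp
  ultimately have "\<kappa> \<longlonglongrightarrow> C * (0 + real m ^ 2 * 0)"
    unfolding \<kappa>_def by (intro tendsto_intros)
  then have kappa: "\<kappa> \<longlonglongrightarrow> 0" by simp
  have Psi: "\<Psi> \<longlonglongrightarrow> 0"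
    unfolding \<Psi>_def using C by (intro suminf_min_tendsto_0 k0 kappa summable_mult summable_dep) auto
  have near_sum: "summable (near n)" "suminf (near n) = real (D n) + 1" for n
  proof -
    have "near n sums (\<Sum>d\<in>{..D n}. near n d)"
      by (rule sums_finite) (auto simp: near_def)
    then show "summable (near n)" "suminf (near n) = real (D n) + 1"
      by (auto simp: sums_iff near_def)
  qed
  have pair_bound: "\<bar>expectation (\<lambda>\<omega>. (centred i (x n) \<omega> - centred i \<xi> \<omega>) * (centred j (x n) \<omega> - centred j \<xi> \<omega>))\<bar>
      \<le> weight m (\<lambda>d. min (C * dep d) (\<kappa> n)) i j + 4 * (within_weight m (near n) i * within_weight m (near n) j)"
    if i: "i \<in> incr_tuples m {1..}" and j: "j \<in> incr_tuples m {1..}" for i j n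
  proof -
    let ?E = "expectation (\<lambda>\<omega>. (centred i (x n) \<omega> - centred i \<xi> \<omega>) * (centred j (x n) \<omega> - centred j \<xi> \<omega>))"
    have Ccomm: "?E = expectation (\<lambda>\<omega>. (centred j (x n) \<omega> - centred j \<xi> \<omega>) * (centred i (x n) \<omega> - centred i \<xi> \<omega>))"
      by (simp add: mult.commute)
    have nn: "0 \<le> near n d" for d by (simp add: near_def)
    have wn: "0 \<le> within_weight m (near n) i'" for i' by (intro within_weight_nonneg nn)
    \<comment> \<open>A tuple is tight exactly when its weight with respect to \<open>near n\<close> is at least 1.\<close>
    have far: "\<bar>?E\<bar> \<le> \<kappa> n" if i': "i' = i \<or> i' = j" and w: "within_weight m (near n) i' < 1" for i'
    proof -
      have "within_weight m dep i' \<le> (\<Sum>u\<in>{1..m}. \<Sum>v\<in>{1..m} - {u}. dep (D n))"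
        unfolding within_weight_def
      proof (intro sum_mono)
        fix u v assume u: "u \<in> {1..m}" and v: "v \<in> {1..m} - {u}"
        have "near n (gap (i' u) (i' v)) \<le> (\<Sum>v\<in>{1..m} - {u}. near n (gap (i' u) (i' v)))"
          using v nn by (intro member_le_sum) auto
        also have "\<dots> \<le> within_weight m (near n) i'"
          unfolding within_weight_def using u nn
          by (intro member_le_sum[where f = "\<lambda>u. \<Sum>v\<in>{1..m} - {u}. near n (gap (i' u) (i' v))"]) (auto intro: sum_nonneg)
        finally have "near n (gap (i' u) (i' v)) < 1" using w by simp
        then have "D n \<le> gap (i' u) (i' v)" by (auto simp: near_def split: if_splits)
        then show "dep (gap (i' u) (i' v)) \<le> dep (D n)" by (rule dep_antimono)
      qed
      also have "\<dots> \<le> (\<Sum>u\<in>{1..m}. \<Sum>v\<in>{1..m}. dep (D n))"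
        by (intro sum_mono sum_mono2) auto
      also have "\<dots> = real m ^ 2 * dep (D n)" by (simp add: power2_eq_square)
      finally have "C * (\<bar>H (x n) - H \<xi>\<bar> + within_weight m dep i') \<le> \<kappa> n"
        unfolding \<kappa>_def using C by (intro mult_left_mono add_left_mono) auto
      then show ?thesis
        using i' b2[OF i j, of "x n" \<xi>] b2[OF j i, of "x n" \<xi>] Ccomm by auto
    qed
    show ?thesis
    proof (cases "within_weight m (near n) i < 1 \<or> within_weight m (near n) j < 1")
      case True
      then have "\<bar>?E\<bar> \<le> \<kappa> n" using far by auto
      moreover have "C * weight m dep i j = weight m (\<lambda>d. C * dep d) i j"
        by (simp add: weight_def within_weight_def cross_weight_def sum_distrib_left distrib_left)
      ultimately have "\<bar>?E\<bar> \<le> min (weight m (\<lambda>d. C * dep d) i j) (\<kappa> n)"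
        using b1[OF i j, of "x n" \<xi>] by simp
      also have "\<dots> \<le> weight m (\<lambda>d. min (C * dep d) (\<kappa> n)) i j"
        using C by (intro min_weight_le k0) simp
      finally show ?thesis using mult_nonneg_nonneg[OF wn wn, of i j] by linarith
    next
      case False
      have "\<bar>?E\<bar> \<le> expectation (\<lambda>\<omega>. 4)"
      proof (rule order_trans[OF integral_abs_bound], rule integral_mono')
        fix \<omega>
        have "\<bar>centred i' (x n) \<omega> - centred i' \<xi> \<omega>\<bar> \<le> 2" for i'
          using centred_bound[of i' "x n" \<omega>] centred_bound[of i' \<xi> \<omega>] by linarith
        from mult_mono[OF this[of i] this[of j]]
        show "\<bar>(centred i (x n) \<omega> - centred i \<xi> \<omega>) * (centred j (x n) \<omega> - centred j \<xi> \<omega>)\<bar> \<le> 4"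
          by (simp add: abs_mult)
      qed auto
      then have "\<bar>?E\<bar> \<le> 4" by (simp add: prob_space)
      also have "4 \<le> 4 * (within_weight m (near n) i * within_weight m (near n) j)"
        using False mult_mono[of 1 "within_weight m (near n) i" 1 "within_weight m (near n) j"] by simp
      finally show ?thesis using weight_nonneg[of "\<lambda>d. min (C * dep d) (\<kappa> n)" m i j] k0 C by simp
    qed
  qed
  define R where "R n = real m ^ (2 * m) * (6 * real m ^ 2 * \<Psi> n + 16 * real m ^ 4 * ((real (D n) + 1)\<^sup>2 / real n))" for n
  have le: "real n * E n \<le> R n" if n: "n \<ge> m" for n
  proof -
    have pos: "real n > 0" using n m2 by simp
    let ?V = "\<Sum>i\<in>tuples n. within_weight m (near n) i"
    let ?S = "6 * real m ^ 2 * real n ^ (2 * m - 1) * \<Psi> n + 4 * (2 * real m ^ 2 * real n ^ (m - 1) * (real (D n) + 1))\<^sup>2"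
    have V: "0 \<le> ?V" "?V \<le> 2 * real m ^ 2 * real n ^ (m - 1) * (real (D n) + 1)"
      using sum_within_weight_le[of "near n" m n] near_sum[of n] m2
      by (auto simp: near_def intro!: sum_nonneg within_weight_nonneg)
    have "(\<Sum>i\<in>tuples n. \<Sum>j\<in>tuples n. weight m (\<lambda>d. min (C * dep d) (\<kappa> n)) i j + 4 * (within_weight m (near n) i * within_weight m (near n) j))
        = (\<Sum>i\<in>tuples n. \<Sum>j\<in>tuples n. weight m (\<lambda>d. min (C * dep d) (\<kappa> n)) i j) + 4 * ?V\<^sup>2"
      by (simp add: sum.distrib power2_eq_square sum_distrib_left[symmetric] sum_distrib_right[symmetric])
    also have "\<dots> \<le> ?S"
    proof (rule add_mono)
      have "summable (\<lambda>d. min (C * dep d) (\<kappa> n))"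
        by (rule summable_comparison_test'[OF summable_mult[OF summable_dep, of C], of 0]) (use C k0 in auto)
      then show "(\<Sum>i\<in>tuples n. \<Sum>j\<in>tuples n. weight m (\<lambda>d. min (C * dep d) (\<kappa> n)) i j) \<le> 6 * real m ^ 2 * real n ^ (2 * m - 1) * \<Psi> n"
        unfolding \<Psi>_def using C k0 m2 by (intro sum_weight_le) auto
      show "4 * ?V\<^sup>2 \<le> 4 * (2 * real m ^ 2 * real n ^ (m - 1) * (real (D n) + 1))\<^sup>2"
        using V by (intro mult_left_mono power_mono) auto
    qed
    finally have sum: "(\<Sum>i\<in>tuples n. \<Sum>j\<in>tuples n. weight m (\<lambda>d. min (C * dep d) (\<kappa> n)) i j + 4 * (within_weight m (near n) i * within_weight m (near n) j)) \<le> ?S" .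
    have diff: "(empirical_df m h X n \<omega> (x n) - H (x n)) - (empirical_df m h X n \<omega> \<xi> - H \<xi>)
       = (\<Sum>i\<in>tuples n. centred i (x n) \<omega> - centred i \<xi> \<omega>) / real (n choose m)" for \<omega>
      unfolding empirical_df_centred[OF n] by (simp add: sum_subtractf diff_divide_distrib)
    have "E n \<le> real m ^ (2 * m) * ?S / real n ^ (2 * m)"
      unfolding E_def diff
    proof (rule scaled_second_moment_le[OF n _ _ _ sum, where c = 2])
      fix i \<omega>
      show "\<bar>centred i (x n) \<omega> - centred i \<xi> \<omega>\<bar> \<le> 2"
        using centred_bound[of i "x n" \<omega>] centred_bound[of i \<xi> \<omega>] by linarith
    next
      fix i assume "i \<in> tuples n"
      then show "(\<lambda>\<omega>. centred i (x n) \<omega> - centred i \<xi> \<omega>) \<in> borel_measurable M"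
        using tuples_subset by (intro borel_measurable_diff centred_measurable incr_tuples_image) blast+
    next
      fix i j assume "i \<in> tuples n" "j \<in> tuples n"
      then show "\<bar>expectation (\<lambda>\<omega>. (centred i (x n) \<omega> - centred i \<xi> \<omega>) * (centred j (x n) \<omega> - centred j \<xi> \<omega>))\<bar>
        \<le> weight m (\<lambda>d. min (C * dep d) (\<kappa> n)) i j + 4 * (within_weight m (near n) i * within_weight m (near n) j)"
        using tuples_subset by (intro pair_bound) blast+
    qed
    then have "real n * E n \<le> real n * (real m ^ (2 * m) * ?S / real n ^ (2 * m))"
      using pos by (intro mult_left_mono) auto
    also have "\<dots> = R n"
    proof -
      define N where "N = real n ^ (m - 1)"
      have N: "N > 0" using pos by (simp add: N_def)
      have p1: "real n ^ (2 * m - 1) = N * N * real n"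
      proof -
        have "2 * m - 1 = Suc ((m - 1) + (m - 1))" using m2 by simp
        then show ?thesis unfolding N_def by (simp only: power_add power_Suc mult_ac)
      qed
      have p2: "real n ^ (2 * m) = N * N * real n * real n"
      proof -
        have "2 * m = Suc (2 * m - 1)" using m2 by simp
        then have "real n ^ (2 * m) = real n * real n ^ (2 * m - 1)" by (metis power_Suc)
        then show ?thesis using p1 by simp
      qed
      show ?thesis
        unfolding R_def p1 p2 N_def[symmetric] using N pos
        by (simp add: field_simps power2_eq_square power4_eq_xxxx)
    qed
    finally show ?thesis .
  qed
  have "(\<lambda>n. (real (D n) + 1)\<^sup>2 / real n) \<longlonglongrightarrow> 0" unfolding D_def by real_asymp
  with Psi have "R \<longlonglongrightarrow> real m ^ (2 * m) * (6 * real m ^ 2 * 0 + 16 * real m ^ 4 * 0)"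
    unfolding R_def by (intro tendsto_intros)
  then have R: "R \<longlonglongrightarrow> 0" by simp
  have "(\<lambda>n. real n * E n) \<longlonglongrightarrow> 0"
  proof (rule tendsto_sandwich[OF _ _ tendsto_const R])
    show "\<forall>\<^sub>F n in sequentially. 0 \<le> real n * E n"
      by (intro always_eventually allI mult_nonneg_nonneg) (auto simp: E_def intro!: Bochner_Integration.integral_nonneg)
    show "\<forall>\<^sub>F n in sequentially. real n * E n \<le> R n"
      using le by (auto simp: eventually_at_top_linorder)
  qed
  then show ?thesis by (simp add: E_def)
qed

end

section \<open>The Bahadur representation\<close>

text \<open>
The infimum defining the generalized inverse of a step function is attained at a jump, which makes
the equivalence exact.
\<close>

lemma gen_inverse_step_le_iff:
  fixes f :: "'b \<Rightarrow> real"
  assumes T: "finite T" "T \<noteq> {}" and p: "0 < p" "p \<le> 1"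
  defines "G \<equiv> \<lambda>x. 1 / real (card T) * (\<Sum>i\<in>T. of_bool (f i \<le> x))"
  shows "gen_inverse G p \<le> x \<longleftrightarrow> p \<le> G x"
proof -
  have c: "card T > 0" using T by (simp add: card_gt_0_iff)
  have mono: "G x \<le> G y" if "x \<le> y" for x y
    unfolding G_def using that by (intro mult_left_mono sum_mono) auto
  define V where "V = f ` T"
  have V: "finite V" "V \<noteq> {}" using T by (auto simp: V_def)
  have "G (Max V) = 1"
  proof -
    have "f i \<le> Max V" if "i \<in> T" for i using that T by (auto simp: V_def)
    then show ?thesis using c by (simp add: G_def)
  qed
  then have ne: "Max V \<in> {w\<in>V. p \<le> G w}" using Max_in[OF V] p by auto
  define v where "v = Min {w\<in>V. p \<le> G w}"
  have v: "v \<in> {w\<in>V. p \<le> G w}" unfolding v_def using V(1) ne by (intro Min_in) (simp, blast)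
  have "{x. p \<le> G x} = {v..}"
  proof safe
    fix x assume px: "p \<le> G x"
    have "{w\<in>V. w \<le> x} \<noteq> {}"
    proof
      assume "{w\<in>V. w \<le> x} = {}"
      then have "\<not> f i \<le> x" if "i \<in> T" for i using that by (auto simp: V_def)
      then have "G x = 0" by (simp add: G_def)
      then show False using px p by simp
    qed
    then have w: "Max {w\<in>V. w \<le> x} \<in> {w\<in>V. w \<le> x}" using V by (intro Max_in) auto
    have "f i \<le> x \<longleftrightarrow> f i \<le> Max {w\<in>V. w \<le> x}" if "i \<in> T" for i
    proof
      assume "f i \<le> x" then show "f i \<le> Max {w\<in>V. w \<le> x}" using that V by (intro Max_ge) (auto simp: V_def)
    qed (use w in auto)
    then have "G x = G (Max {w\<in>V. w \<le> x})" by (simp add: G_def)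
    then have "v \<le> Max {w\<in>V. w \<le> x}" unfolding v_def using V px w by (intro Min_le) auto
    then show "v \<le> x" using w by auto
  next
    fix x assume "v \<le> x"
    then show "p \<le> G x" using v mono[of v x] by auto
  qed
  then show ?thesis by (auto simp: gen_inverse_def)
qed

text \<open>
If \<open>v\<close> and \<open>w\<close> are more than three meshes apart, some grid point separates them and keeps at least one
mesh away from \<open>w\<close>.  The grid only has to cover the range of \<open>w\<close>, enlarged by two meshes.
\<close>

lemma ex_grid_point_between:
  fixes w v :: real
  assumes \<delta>: "\<delta> > 0" and w: "\<bar>w\<bar> < \<Lambda>" and K: "\<Lambda> / \<delta> + 2 \<le> real K" and far: "\<bar>v - w\<bar> > 3 * \<delta>"
  shows "\<exists>k\<in>{- int K..int K}. (w + \<delta> \<le> real_of_int k * \<delta> \<and> real_of_int k * \<delta> < v)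
           \<or> (v < real_of_int k * \<delta> \<and> real_of_int k * \<delta> \<le> w - \<delta>)"
proof -
  have wd: "\<bar>w / \<delta>\<bar> < \<Lambda> / \<delta>" using w \<delta> by (simp add: divide_strict_right_mono)
  show ?thesis
  proof (cases "v > w")
    case True
    define k where "k = \<lceil>w / \<delta>\<rceil> + 1"
    have k: "w / \<delta> + 1 \<le> real_of_int k" "real_of_int k < w / \<delta> + 2" unfolding k_def by linarith+
    then have "(w / \<delta> + 1) * \<delta> \<le> real_of_int k * \<delta>" "real_of_int k * \<delta> < (w / \<delta> + 2) * \<delta>"
      using \<delta> by (auto intro: mult_right_mono)
    then have "w + \<delta> \<le> real_of_int k * \<delta>" "real_of_int k * \<delta> < w + 2 * \<delta>"
      using \<delta> by (auto simp: distrib_right)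
    moreover have "k \<in> {- int K..int K}"
    proof -
      have "real_of_int k \<le> real K" "- real K \<le> real_of_int k" using k wd K by linarith+
      then show ?thesis by (simp; linarith)
    qed
    ultimately show ?thesis using far True \<delta> by (intro bexI[of _ k]) auto
  next
    case False
    define k where "k = \<lfloor>w / \<delta>\<rfloor> - 1"
    have k: "real_of_int k \<le> w / \<delta> - 1" "w / \<delta> - 2 < real_of_int k" unfolding k_def by linarith+
    then have "real_of_int k * \<delta> \<le> (w / \<delta> - 1) * \<delta>" "(w / \<delta> - 2) * \<delta> < real_of_int k * \<delta>"
      using \<delta> by (auto intro: mult_right_mono)
    then have "real_of_int k * \<delta> \<le> w - \<delta>" "w - 2 * \<delta> < real_of_int k * \<delta>"
      using \<delta> by (auto simp: left_diff_distrib)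
    moreover have "k \<in> {- int K..int K}"
    proof -
      have "real_of_int k \<le> real K" "- real K \<le> real_of_int k" using k wd K by linarith+
      then show ?thesis by (simp; linarith)
    qed
    ultimately show ?thesis using far False \<delta> by (intro bexI[of _ k]) auto
  qed
qed

lemma (in prob_space) prob_abs_ge_le_second_moment:
  fixes Z :: "'a \<Rightarrow> real"
  assumes Z: "Z \<in> borel_measurable M" "\<And>\<omega>. \<bar>Z \<omega>\<bar> \<le> c" and a: "a > 0"
  shows "prob {\<omega>\<in>space M. \<bar>Z \<omega>\<bar> \<ge> a} \<le> expectation (\<lambda>\<omega>. (Z \<omega>)\<^sup>2) / a\<^sup>2"
proof -
  have "{\<omega>\<in>space M. \<bar>Z \<omega>\<bar> \<ge> a} = {\<omega>\<in>space M. (Z \<omega>)\<^sup>2 \<ge> a\<^sup>2}"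
    using a by (auto simp: abs_le_square_iff[symmetric])
  moreover have "integrable M (\<lambda>\<omega>. (Z \<omega>)\<^sup>2)"
  proof (rule integrable_const_bound[where B = "c\<^sup>2"])
    have "(Z \<omega>)\<^sup>2 \<le> c\<^sup>2" for \<omega> using Z(2)[of \<omega>] by (intro power2_le_iff_abs_le[THEN iffD2]) auto
    then show "AE \<omega> in M. norm ((Z \<omega>)\<^sup>2) \<le> c\<^sup>2" by simp
  qed (use Z in auto)
  ultimately show ?thesis
    using integral_Markov_inequality_measure[of M "\<lambda>\<omega>. (Z \<omega>)\<^sup>2" "{}" "a\<^sup>2"] a by simp
qed

context kernel_process
begin

abbreviation "H_emp n \<omega> \<equiv> empirical_df m h X n \<omega>"

lemma H_emp_eq: "H_emp n \<omega> = (\<lambda>x. 1 / real (card (tuples n)) * (\<Sum>i\<in>tuples n. of_bool (kernel_at i \<omega> \<le> x)))"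
  by (simp add: empirical_df_def kernel_at_def at_tuple_def card_incr_tuples[simplified] fun_eq_iff)

lemma H_emp_measurable: "(\<lambda>\<omega>. H_emp n \<omega> x) \<in> borel_measurable M"
proof -
  have "(\<lambda>\<omega>. of_bool (kernel_at i \<omega> \<le> x) :: real) \<in> borel_measurable M" if "i \<in> tuples n" for i
  proof -
    have "kernel_at i \<in> borel_measurable M"
      using that tuples_subset by (intro kernel_at_measurable incr_tuples_image) blast
    then show ?thesis by measurable
  qed
  then show ?thesis unfolding H_emp_eq by (intro borel_measurable_times borel_measurable_const borel_measurable_sum)
qed

lemma H_emp_bounds: "0 \<le> H_emp n \<omega> x" "H_emp n \<omega> x \<le> 1"
proof -
  have "(\<Sum>i\<in>tuples n. of_bool (kernel_at i \<omega> \<le> x)) \<le> (\<Sum>i\<in>tuples n. 1 :: real)"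
    by (intro sum_mono) auto
  then have "(\<Sum>i\<in>tuples n. of_bool (kernel_at i \<omega> \<le> x)) / real (card (tuples n)) \<le> 1"
    unfolding divide_le_eq_1 by auto
  then show "H_emp n \<omega> x \<le> 1"
    unfolding H_emp_eq by (simp only: times_divide_eq_left mult_1)
  show "0 \<le> H_emp n \<omega> x" unfolding H_emp_eq by (simp add: sum_nonneg)
qed

lemma quantile_le_iff:
  assumes "n \<ge> m" "0 < p" "p \<le> 1"
  shows "gen_inverse (H_emp n \<omega>) p \<le> x \<longleftrightarrow> p \<le> H_emp n \<omega> x"
  unfolding H_emp_eq
proof (rule gen_inverse_step_le_iff)
  have "card (tuples n) > 0" using assms(1) card_incr_tuples[of m n] by simp
  then show "tuples n \<noteq> {}" by auto
qed (use assms in auto)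

text \<open>
For \<open>n < m\<close> there are no tuples, the empirical distribution function is 0, and the generalized inverse is the constant \<open>Inf {}\<close>.
\<close>

lemma quantile_measurable:
  assumes "0 < p" "p \<le> 1"
  shows "(\<lambda>\<omega>. gen_inverse (H_emp n \<omega>) p) \<in> borel_measurable M"
proof (cases "n \<ge> m")
  case True
  show ?thesis
    unfolding borel_measurable_iff_le quantile_le_iff[OF True assms]
    using H_emp_measurable by (auto intro!: borel_measurable_le)
next
  case False
  then have "H_emp n \<omega> = (\<lambda>_. 0)" for \<omega> by (simp add: empirical_df_def fun_eq_iff)
  then show ?thesis by simp
qed

text \<open>
In the proof, \<open>V\<close> and \<open>W\<close> are the rescaled quantile error and its linear approximation, \<open>\<tau> t\<close> is the
difference quotient of \<open>H\<close> rescaled so that it tends to \<open>t\<close>, and \<open>\<Delta> t\<close> is the rescaled increment of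
\<open>H\<^sub>n - H\<close> between \<open>\<xi>\<close> and \<open>\<xi> + t / \<surd>n\<close>.
\<close>

theorem bahadur_representation:
  assumes p: "0 < p" "p \<le> 1" and \<xi>: "H \<xi> = p"
    and deriv: "(H has_real_derivative b) (at \<xi>)" and b: "b > 0"
  shows "small_o_prob M
    (\<lambda>n \<omega>. gen_inverse (H_emp n \<omega>) p - (\<xi> + (H \<xi> - H_emp n \<omega> \<xi>) / b)) (\<lambda>n. 1 / sqrt (real n))"
  unfolding small_o_prob_def
proof (intro conjI allI impI)
  show "(\<lambda>\<omega>. gen_inverse (H_emp n \<omega>) p - (\<xi> + (H \<xi> - H_emp n \<omega> \<xi>) / b)) \<in> borel_measurable M" for n
    using quantile_measurable[OF p] H_emp_measurable by measurable
  fix \<epsilon> :: real assume eps: "\<epsilon> > 0"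
  define R where "R n \<omega> = gen_inverse (H_emp n \<omega>) p - (\<xi> + (H \<xi> - H_emp n \<omega> \<xi>) / b)" for n \<omega>
  define W where "W n \<omega> = sqrt (real n) * ((H \<xi> - H_emp n \<omega> \<xi>) / b)" for n \<omega>
  define V where "V n \<omega> = sqrt (real n) * (gen_inverse (H_emp n \<omega>) p - \<xi>)" for n \<omega>
  define x where "x t n = \<xi> + t / sqrt (real n)" for t and n :: nat
  define \<tau> where "\<tau> t n = sqrt (real n) * ((H (x t n) - H \<xi>) / b)" for t and n :: nat
  define \<Delta> where "\<Delta> t n \<omega> = sqrt (real n) / b * ((H_emp n \<omega> (x t n) - H (x t n)) - (H_emp n \<omega> \<xi> - H \<xi>))" for t n \<omega>
  have x_lim: "(\<lambda>n. H (x t n)) \<longlonglongrightarrow> H \<xi>" for t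
  proof -
    have "(\<lambda>n. \<xi> + t / sqrt (real n)) \<longlonglongrightarrow> \<xi>" by real_asymp
    then show ?thesis
      unfolding x_def using DERIV_isCont[OF deriv] by (rule isCont_tendsto_compose[rotated])
  qed
  have tau_lim: "\<tau> t \<longlonglongrightarrow> t" for t
  proof (cases "t = 0")
    case False
    have "(\<lambda>n. t / sqrt (real n)) \<longlonglongrightarrow> 0" by real_asymp
    moreover have "eventually (\<lambda>n. t / sqrt (real n) \<noteq> 0) sequentially"
      using eventually_gt_at_top[of "0::nat"] by eventually_elim (use False in auto)
    ultimately have "filterlim (\<lambda>n. t / sqrt (real n)) (at 0) sequentially"
      by (auto simp: filterlim_at)
    from filterlim_compose[OF deriv[unfolded DERIV_def] this]
    have "(\<lambda>n. (H (\<xi> + t / sqrt (real n)) - H \<xi>) / (t / sqrt (real n))) \<longlonglongrightarrow> b" by simp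
    then have "(\<lambda>n. t / b * ((H (\<xi> + t / sqrt (real n)) - H \<xi>) / (t / sqrt (real n)))) \<longlonglongrightarrow> t / b * b"
      by (intro tendsto_intros)
    moreover have "\<tau> t = (\<lambda>n. t / b * ((H (\<xi> + t / sqrt (real n)) - H \<xi>) / (t / sqrt (real n))))"
      using False by (simp add: \<tau>_def x_def fun_eq_iff)
    moreover have "t / b * b = t" using b by simp
    ultimately show ?thesis by (simp only:)
  next
    case True
    then have "\<tau> t = (\<lambda>_. 0)" by (simp add: \<tau>_def x_def fun_eq_iff)
    with True show ?thesis by simp
  qed
  obtain C where C: "C \<ge> 0" and C2: "\<And>n t. n \<ge> m \<Longrightarrow> expectation (\<lambda>\<omega>. (H_emp n \<omega> t - H t)\<^sup>2) \<le> C / real n"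
    using empirical_df_second_moment by blast
  have W_meas: "W n \<in> borel_measurable M" and D_meas: "\<Delta> t n \<in> borel_measurable M" for n t
    unfolding W_def \<Delta>_def using H_emp_measurable by measurable
  have diff_bound: "\<bar>H_emp n \<omega> y - H y\<bar> \<le> 1" for n \<omega> y
    using H_emp_bounds[of n \<omega> y] H_bounds[of y] by (simp add: abs_le_iff)
  have W_tail: "prob {\<omega>\<in>space M. \<bar>W n \<omega>\<bar> \<ge> \<Lambda>} \<le> C / b\<^sup>2 / \<Lambda>\<^sup>2" if "n \<ge> m" "\<Lambda> > 0" for n \<Lambda>
  proof -
    have n: "real n > 0" using that m2 by simp
    have "\<bar>W n \<omega>\<bar> \<le> sqrt (real n) * (1 / b)" for \<omega>
      unfolding W_def abs_mult using diff_bound[of n \<omega> \<xi>] b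
      by (intro mult_mono) (auto simp: abs_minus_commute divide_right_mono)
    then have "prob {\<omega>\<in>space M. \<bar>W n \<omega>\<bar> \<ge> \<Lambda>} \<le> expectation (\<lambda>\<omega>. (W n \<omega>)\<^sup>2) / \<Lambda>\<^sup>2"
      by (intro prob_abs_ge_le_second_moment W_meas that)
    also have "expectation (\<lambda>\<omega>. (W n \<omega>)\<^sup>2) = real n / b\<^sup>2 * expectation (\<lambda>\<omega>. (H_emp n \<omega> \<xi> - H \<xi>)\<^sup>2)"
      by (subst Bochner_Integration.integral_mult_right_zero[symmetric], intro Bochner_Integration.integral_cong)
         (simp_all add: W_def power_mult_distrib power_divide power2_commute)
    also have "\<dots> \<le> real n / b\<^sup>2 * (C / real n)" by (intro mult_left_mono C2 that) auto
    also have "\<dots> = C / b\<^sup>2" using n by simp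
    finally show ?thesis by (simp add: divide_right_mono)
  qed
  have D_tail: "(\<lambda>n. prob {\<omega>\<in>space M. \<bar>\<Delta> t n \<omega>\<bar> \<ge> a}) \<longlonglongrightarrow> 0" if "a > 0" for a t
  proof -
    define E where "E n = real n * expectation (\<lambda>\<omega>. ((H_emp n \<omega> (x t n) - H (x t n)) - (H_emp n \<omega> \<xi> - H \<xi>))\<^sup>2)" for n
    have E: "E \<longlonglongrightarrow> 0" unfolding E_def by (rule empirical_df_increment[OF x_lim])
    have le: "prob {\<omega>\<in>space M. \<bar>\<Delta> t n \<omega>\<bar> \<ge> a} \<le> 1 / b\<^sup>2 / a\<^sup>2 * E n" for n
    proof -
      have "\<bar>\<Delta> t n \<omega>\<bar> \<le> sqrt (real n) / b * 2" for \<omega>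
        unfolding \<Delta>_def abs_mult using diff_bound[of n \<omega> \<xi>] diff_bound[of n \<omega> "x t n"] b
        by (intro mult_mono) auto
      then have "prob {\<omega>\<in>space M. \<bar>\<Delta> t n \<omega>\<bar> \<ge> a} \<le> expectation (\<lambda>\<omega>. (\<Delta> t n \<omega>)\<^sup>2) / a\<^sup>2"
        by (intro prob_abs_ge_le_second_moment D_meas that)
      also have "expectation (\<lambda>\<omega>. (\<Delta> t n \<omega>)\<^sup>2) = 1 / b\<^sup>2 * E n"
        by (simp add: \<Delta>_def E_def power_mult_distrib power_divide)
      finally show ?thesis by simp
    qed
    have "(\<lambda>n. 1 / b\<^sup>2 / a\<^sup>2 * E n) \<longlonglongrightarrow> 1 / b\<^sup>2 / a\<^sup>2 * 0" by (intro tendsto_intros E)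
    then have lim: "(\<lambda>n. 1 / b\<^sup>2 / a\<^sup>2 * E n) \<longlonglongrightarrow> 0" by simp
    show ?thesis
      by (rule tendsto_sandwich[OF always_eventually always_eventually tendsto_const lim])
         (simp, rule allI, rule le)
  qed
  have "(\<lambda>n. prob {\<omega>\<in>space M. \<bar>R n \<omega>\<bar> > \<epsilon> * (1 / sqrt (real n))}) \<longlonglongrightarrow> 0"
  proof (rule LIMSEQ_I)
    fix r :: real assume r: "r > 0"
    \<comment> \<open>Chebyshev makes \<open>\<bar>W\<bar> \<ge> \<Lambda>\<close> unlikely; \<open>C + 1\<close> keeps \<open>\<Lambda>\<close> positive.\<close>
    define \<Lambda> where "\<Lambda> = sqrt (2 * (C + 1) / (b\<^sup>2 * r))"
    have lam: "\<Lambda> > 0" using C b r by (simp add: \<Lambda>_def)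
    have lam2: "C / b\<^sup>2 / \<Lambda>\<^sup>2 < r / 2"
    proof -
      have "\<Lambda>\<^sup>2 = 2 * (C + 1) / (b\<^sup>2 * r)" using C r by (simp add: \<Lambda>_def)
      then have "C / b\<^sup>2 / \<Lambda>\<^sup>2 = C / b\<^sup>2 / (2 * (C + 1) / (b\<^sup>2 * r))" by simp
      also have "\<dots> = (r / 2) * (C / (C + 1))" using b r C by simp
      also have "\<dots> < (r / 2) * 1" using r C by (intro mult_strict_left_mono) auto
      finally show ?thesis by simp
    qed
    define d where "d = \<epsilon> / 3"
    have d: "d > 0" using eps by (simp add: d_def)
    obtain K :: nat where K: "\<Lambda> / d + 2 \<le> real K" using real_arch_simple by blast
    define ts where "ts = (\<lambda>k. real_of_int k * d) ` {- int K..int K}"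
    have ts: "finite ts" by (simp add: ts_def)
    have "(\<lambda>n. \<Sum>t\<in>ts. prob {\<omega>\<in>space M. \<bar>\<Delta> t n \<omega>\<bar> \<ge> d / 2}) \<longlonglongrightarrow> (\<Sum>t\<in>ts. 0)"
      using d by (intro tendsto_sum D_tail) simp
    then have ev1: "eventually (\<lambda>n. (\<Sum>t\<in>ts. prob {\<omega>\<in>space M. \<bar>\<Delta> t n \<omega>\<bar> \<ge> d / 2}) < r / 2) sequentially"
      using r by (intro order_tendstoD(2)[where y = 0]) auto
    have ev2: "eventually (\<lambda>n. \<forall>t\<in>ts. \<bar>\<tau> t n - t\<bar> < d / 2) sequentially"
    proof (intro eventually_ball_finite ts ballI)
      fix t assume "t \<in> ts"
      from tendstoD[OF tau_lim[of t], of "d / 2"] d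
      show "eventually (\<lambda>n. \<bar>\<tau> t n - t\<bar> < d / 2) sequentially" by (simp only: dist_real_def half_gt_zero)
    qed
    have "eventually (\<lambda>n. prob {\<omega>\<in>space M. \<bar>R n \<omega>\<bar> > \<epsilon> * (1 / sqrt (real n))} < r) sequentially"
      using ev1 ev2 eventually_ge_at_top[of m]
    proof eventually_elim
      case (elim n)
      have n: "real n > 0" "sqrt (real n) > 0" using elim(3) m2 by auto
      let ?bad = "\<Union>t\<in>ts. {\<omega>\<in>space M. \<bar>\<Delta> t n \<omega>\<bar> \<ge> d / 2}"
      have "{\<omega>\<in>space M. \<bar>R n \<omega>\<bar> > \<epsilon> * (1 / sqrt (real n))} \<subseteq> {\<omega>\<in>space M. \<bar>W n \<omega>\<bar> \<ge> \<Lambda>} \<union> ?bad"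
      proof (intro subsetI UnCI)
        fix \<omega> assume R: "\<omega> \<in> {\<omega>\<in>space M. \<bar>R n \<omega>\<bar> > \<epsilon> * (1 / sqrt (real n))}" and "\<omega> \<notin> ?bad"
        then have \<omega>: "\<omega> \<in> space M" and small: "\<And>t. t \<in> ts \<Longrightarrow> \<bar>\<Delta> t n \<omega>\<bar> < d / 2" by (auto simp: not_le)
        have VW: "V n \<omega> - W n \<omega> = sqrt (real n) * R n \<omega>"
          by (simp add: V_def W_def R_def algebra_simps)
        have "\<bar>V n \<omega> - W n \<omega>\<bar> > 3 * d"
          using R n unfolding VW abs_mult d_def by (simp add: field_simps)
        have "\<not> \<bar>W n \<omega>\<bar> < \<Lambda>"
        proof
          assume "\<bar>W n \<omega>\<bar> < \<Lambda>"
          from ex_grid_point_between[OF d this K \<open>\<bar>V n \<omega> - W n \<omega>\<bar> > 3 * d\<close>]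
          obtain t where t: "t \<in> ts" and side: "(W n \<omega> + d \<le> t \<and> t < V n \<omega>) \<or> (V n \<omega> < t \<and> t \<le> W n \<omega> - d)"
            by (auto simp: ts_def)
          \<comment> \<open>A grid point between \<open>V\<close> and \<open>W\<close> fixes the sign of the first term, and \<open>W\<close> differs from \<open>t\<close> by a full mesh but \<open>\<tau> t\<close> by less than half of one.\<close>
          have D_eq: "\<Delta> t n \<omega> = sqrt (real n) / b * (H_emp n \<omega> (x t n) - p) - \<tau> t n + W n \<omega>"
            unfolding \<Delta>_def \<tau>_def W_def \<xi> by (simp add: diff_divide_distrib algebra_simps)
          have tau: "\<bar>\<tau> t n - t\<bar> < d / 2" using elim(2) t by blast
          have V_iff: "V n \<omega> \<le> t \<longleftrightarrow> p \<le> H_emp n \<omega> (x t n)"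
          proof -
            have "V n \<omega> \<le> t \<longleftrightarrow> gen_inverse (H_emp n \<omega>) p \<le> x t n"
              using n by (simp add: V_def x_def field_simps)
            then show ?thesis using quantile_le_iff[OF elim(3) p] by simp
          qed
          from side show False
          proof
            assume s: "W n \<omega> + d \<le> t \<and> t < V n \<omega>"
            then have "H_emp n \<omega> (x t n) - p \<le> 0" using V_iff by auto
            then have "sqrt (real n) / b * (H_emp n \<omega> (x t n) - p) \<le> 0"
              using n b by (intro mult_nonneg_nonpos) auto
            then have "\<Delta> t n \<omega> < - (d / 2)" using D_eq s tau by linarith
            then show False using small[OF t] by linarith
          next
            assume s: "V n \<omega> < t \<and> t \<le> W n \<omega> - d"
            then have "0 \<le> H_emp n \<omega> (x t n) - p" using V_iff by auto
            then have "0 \<le> sqrt (real n) / b * (H_emp n \<omega> (x t n) - p)"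
              using n b by (intro mult_nonneg_nonneg) auto
            then have "\<Delta> t n \<omega> > d / 2" using D_eq s tau by linarith
            then show False using small[OF t] by linarith
          qed
        qed
        then show "\<omega> \<in> {\<omega>\<in>space M. \<bar>W n \<omega>\<bar> \<ge> \<Lambda>}" using \<omega> by simp
      qed
      then have "prob {\<omega>\<in>space M. \<bar>R n \<omega>\<bar> > \<epsilon> * (1 / sqrt (real n))} \<le> prob ({\<omega>\<in>space M. \<bar>W n \<omega>\<bar> \<ge> \<Lambda>} \<union> ?bad)"
        using W_meas D_meas ts by (intro finite_measure_mono) (auto intro!: sets.Un sets.finite_UN borel_measurable_le)
      also have "\<dots> \<le> prob {\<omega>\<in>space M. \<bar>W n \<omega>\<bar> \<ge> \<Lambda>} + prob ?bad"
        using W_meas D_meas ts by (intro measure_Un_le) (auto intro!: sets.finite_UN borel_measurable_le)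
      also have "prob ?bad \<le> (\<Sum>t\<in>ts. prob {\<omega>\<in>space M. \<bar>\<Delta> t n \<omega>\<bar> \<ge> d / 2})"
        using D_meas ts by (intro finite_measure_subadditive_finite) (auto intro!: borel_measurable_le)
      finally show ?case using W_tail[OF elim(3) lam] lam2 elim(1) by linarith
    qed
    then show "\<exists>no. \<forall>n\<ge>no. norm (prob {\<omega>\<in>space M. \<bar>R n \<omega>\<bar> > \<epsilon> * (1 / sqrt (real n))} - 0) < r"
      by (auto simp: eventually_at_top_linorder)
  qed
  then show "(\<lambda>n. prob {\<omega>\<in>space M. \<bar>gen_inverse (H_emp n \<omega>) p - (\<xi> + (H \<xi> - H_emp n \<omega> \<xi>) / b)\<bar> > \<epsilon> * (1 / sqrt (real n))}) \<longlonglongrightarrow> 0"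
    by (simp add: R_def)
qed

end

section \<open>Distribution functions and the main result\<close>

lemma cdf_eq_PiM_law:
  assumes "prob_space M" and ind: "prob_space.indep_vars M (\<lambda>_. borel) Y {1::nat..}"
    and law: "\<And>j. j \<ge> 1 \<Longrightarrow> distr M borel (Y j) = \<mu>" and m: "m \<ge> 1"
    and h: "h \<in> borel_measurable (PiM {1..m} (\<lambda>_. borel :: real measure))"
  shows "kernel_df M m h Y t = measure (PiM {1..m} (\<lambda>_. \<mu>)) {x\<in>{1..m} \<rightarrow>\<^sub>E UNIV. h x \<le> t}"
proof -
  interpret prob_space M by fact
  have Y: "Y j \<in> borel_measurable M" if "j \<ge> 1" for j
    using ind that by (auto simp: indep_vars_def)
  let ?Y = "\<lambda>\<omega>. \<lambda>j\<in>{1..m}. Y j \<omega>"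
  have "indep_vars (\<lambda>_. borel) Y {1..m}" using ind by (rule indep_vars_subset) auto
  then have "distr M (PiM {1..m} (\<lambda>_. borel)) ?Y = PiM {1..m} (\<lambda>j. distr M borel (Y j))"
    by (subst (asm) indep_vars_iff_distr_eq_PiM') (use m Y in auto)
  also have "\<dots> = PiM {1..m} (\<lambda>_. \<mu>)" by (intro PiM_cong refl law) auto
  finally have d: "distr M (PiM {1..m} (\<lambda>_. borel)) ?Y = PiM {1..m} (\<lambda>_. \<mu>)" .
  have Ym: "?Y \<in> measurable M (PiM {1..m} (\<lambda>_. borel))" using Y by (intro measurable_restrict) auto
  have hY: "indep_kernel m h Y \<in> borel_measurable M"
    unfolding indep_kernel_def by (rule measurable_compose[OF Ym h])
  have "kernel_df M m h Y t = prob {\<omega>\<in>space M. h (?Y \<omega>) \<le> t}"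
    using hY by (simp add: kernel_df_def cdf_def measure_distr vimage_def Int_def indep_kernel_def conj_commute)
  also have "\<dots> = prob (?Y -` {x\<in>space (PiM {1..m} (\<lambda>_. borel)). h x \<le> t} \<inter> space M)"
    by (intro arg_cong[where f = prob]) (auto simp: space_PiM)
  also have "\<dots> = measure (PiM {1..m} (\<lambda>_. \<mu>)) {x\<in>space (PiM {1..m} (\<lambda>_. borel)). h x \<le> t}"
    unfolding d[symmetric] using h by (subst measure_distr[OF Ym]) auto
  finally show ?thesis by (simp add: space_PiM)
qed

lemma cdf_lipschitz_of_bounded_density:
  assumes "prob_space M" and d: "distributed M lborel Z (\<lambda>x. ennreal (f x))" and f: "\<And>x. f x \<le> B" and B: "B \<ge> 0"
  shows "\<bar>cdf (distr M borel Z) s - cdf (distr M borel Z) t\<bar> \<le> B * \<bar>s - t\<bar>"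
proof -
  interpret prob_space M by fact
  have Z: "Z \<in> borel_measurable M" using distributed_measurable[OF d] by simp
  interpret D: real_distribution "distr M borel Z" using Z by simp
  have eq: "distr M borel Z = density lborel (\<lambda>x. ennreal (f x))"
    using distributed_distr_eq_density[OF d] by (simp cong: distr_cong)
  have step: "cdf (distr M borel Z) t - cdf (distr M borel Z) s \<le> B * (t - s)" if "s \<le> t" for s t
  proof (cases "s = t")
    case False
    then have st: "s < t" using that by simp
    have "cdf (distr M borel Z) t - cdf (distr M borel Z) s = D.prob {s<..t}"
      by (rule D.cdf_diff_eq[OF st])
    moreover have "emeasure (distr M borel Z) {s<..t} \<le> ennreal (B * (t - s))"
    proof -
      have "emeasure (distr M borel Z) {s<..t} = (\<integral>\<^sup>+x. ennreal (f x) * indicator {s<..t} x \<partial>lborel)"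
        unfolding eq using distributed_borel_measurable[OF d] by (intro emeasure_density) auto
      also have "\<dots> \<le> (\<integral>\<^sup>+x. ennreal B * indicator {s<..t} x \<partial>lborel)"
        using f by (intro nn_integral_mono mult_right_mono ennreal_leI) auto
      also have "\<dots> = ennreal (B * (t - s))"
        using st B by (simp add: nn_integral_cmult_indicator ennreal_mult)
      finally show ?thesis .
    qed
    ultimately show ?thesis
      using st B by (simp add: D.emeasure_eq_measure)
  qed simp
  show ?thesis
    using step[of s t] step[of t s] D.cdf_nondecreasing[of s t] D.cdf_nondecreasing[of t s]
    by (cases "s \<le> t") (auto simp: abs_if)
qed

text \<open>
The set in the definition of the generalized inverse is closed by continuity, so its infimum belongs to it; the intermediate value theorem excludes a value above \<open>p\<close>.
\<close>

lemma cdf_gen_inverse: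
  assumes "real_distribution D" and cont: "\<And>x. isCont (cdf D) x" and p: "0 < p" "p < 1"
  shows "cdf D (gen_inverse (cdf D) p) = p"
proof -
  interpret real_distribution D by fact
  let ?S = "{x. p \<le> cdf D x}"
  obtain x1 where x1: "p < cdf D x1"
    using order_tendstoD(1)[OF cdf_lim_at_top_prob p(2)] by (auto simp: eventually_at_top_linorder)
  obtain x0 where x0: "cdf D x0 < p"
    using order_tendstoD(2)[OF cdf_lim_at_bot p(1)] by (auto simp: eventually_at_bot_linorder)
  have bdd: "bdd_below ?S"
  proof (rule bdd_belowI[of _ x0])
    fix x assume "x \<in> ?S"
    then show "x0 \<le> x" using x0 cdf_nondecreasing[of x x0] by (cases "x0 \<le> x") auto
  qed
  have cont': "continuous_on UNIV (cdf D)" using cont by (simp add: continuous_on_eq_continuous_at)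
  have closed: "closed ?S" by (intro closed_Collect_le continuous_on_const cont')
  have "Inf ?S \<in> ?S" using bdd closed by (intro closed_contains_Inf) (auto intro: less_imp_le[OF x1])
  then have ge: "p \<le> cdf D (Inf ?S)" by simp
  have "x0 < Inf ?S" using ge x0 cdf_nondecreasing[of "Inf ?S" x0] by (cases "x0 < Inf ?S") auto
  then obtain x where x: "x0 \<le> x" "x \<le> Inf ?S" "cdf D x = p"
    using IVT'[of "cdf D" x0 p "Inf ?S"] x0 ge continuous_on_subset[OF cont'] by auto
  have "Inf ?S \<le> x" using x bdd by (intro cInf_lower) auto
  then show ?thesis using x by (simp add: gen_inverse_def)
qed

lemma lipschitz_kernel_l1:
  assumes "lipschitz_kernel m h"
  obtains L where "l1_lipschitz L {1..m} h"
proof -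
  obtain L where L: "\<And>x y. \<lbrakk>x \<in> {1..m} \<rightarrow>\<^sub>E UNIV; y \<in> {1..m} \<rightarrow>\<^sub>E UNIV\<rbrakk> \<Longrightarrow>
      \<bar>h x - h y\<bar> \<le> L * L2_set (\<lambda>j. x j - y j) {1..m}"
    using assms unfolding lipschitz_kernel_def by blast
  have "\<bar>h x - h y\<bar> \<le> \<bar>L\<bar> * (\<Sum>j\<in>{1..m}. \<bar>x j - y j\<bar>)"
    if "x \<in> {1..m} \<rightarrow>\<^sub>E UNIV" "y \<in> {1..m} \<rightarrow>\<^sub>E UNIV" for x y
  proof -
    have "\<bar>h x - h y\<bar> \<le> L * L2_set (\<lambda>j. x j - y j) {1..m}" by (rule L[OF that])
    also have "\<dots> \<le> \<bar>L\<bar> * (\<Sum>j\<in>{1..m}. \<bar>x j - y j\<bar>)"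
      by (intro mult_mono L2_set_le_sum_abs) auto
    finally show ?thesis .
  qed
  then have "l1_lipschitz \<bar>L\<bar> {1..m} h" unfolding l1_lipschitz_def by auto
  then show thesis by (rule that)
qed

theorem theorem2p1:
  fixes M :: "'a measure" and X Y :: "nat \<Rightarrow> 'a \<Rightarrow> real"
    and F :: "real \<Rightarrow> real" and \<rho> \<delta> :: real
    and m :: nat and h :: "(nat \<Rightarrow> real) \<Rightarrow> real"
    and H\<^sub>F h\<^sub>F :: "real \<Rightarrow> real" and p \<xi>\<^sub>p :: real
  assumes "prob_space M"
    and "\<And>n. n \<ge> 1 \<Longrightarrow> X n \<in> borel_measurable M"
    and "stationary M X"
    and "strongly_mixing M X"
    and "F = cdf (distr M borel (X 1))"
    and "\<rho> \<ge> 1"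
    and "integrable M (\<lambda>\<omega>. \<bar>X 1 \<omega>\<bar> powr \<rho>)"
    and "\<delta> > (2 * \<rho> + 1) / \<rho>"
    and "mixing_coeff M X \<in> O(\<lambda>l. real l powr (- \<delta>))"
    and "independent_copies M X Y"
    and "m \<ge> 2"
    and "is_kernel m h"
    and "lipschitz_kernel m h"
    and "H\<^sub>F = kernel_df M m h Y"
    and "distributed M lborel (indep_kernel m h Y) h\<^sub>F"
    and "\<And>x. h\<^sub>F x > 0"
    and "bounded (range h\<^sub>F)"
    and "\<And>k i. \<lbrakk>2 \<le> k; k \<le> m; i \<in> incr_tuples m {1..}\<rbrakk>
           \<Longrightarrow> has_bounded_density M (mixed_kernel m h X Y k i)"
    and "0 < p" and "p < 1"
    and "\<xi>\<^sub>p = gen_inverse H\<^sub>F p"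
    and "(H\<^sub>F has_real_derivative h\<^sub>F \<xi>\<^sub>p) (at \<xi>\<^sub>p)"
  shows "small_o_prob M
           (\<lambda>n \<omega>. gen_inverse (empirical_df m h X n \<omega>) p
                    - (\<xi>\<^sub>p + (H\<^sub>F \<xi>\<^sub>p - empirical_df m h X n \<omega> \<xi>\<^sub>p) / h\<^sub>F \<xi>\<^sub>p))
           (\<lambda>n. 1 / sqrt (real n))"
proof -
  interpret prob_space M by fact
  define \<mu> where "\<mu> = distr M borel (X 1)"
  have X1: "X 1 \<in> borel_measurable M" using assms(2) by simp
  obtain L where L: "l1_lipschitz L {1..m} h" using lipschitz_kernel_l1[OF assms(13)] by blast
  obtain B where B: "\<And>x. \<bar>h\<^sub>F x\<bar> \<le> B" using assms(17) by (auto simp: bounded_iff)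
  have B0: "B \<ge> 0" using B[of 0] by linarith
  have h: "h \<in> borel_measurable (PiM {1..m} (\<lambda>_. borel))" using assms(12) by (simp add: is_kernel_def)
  have df: "H\<^sub>F t = measure (PiM {1..m} (\<lambda>_. \<mu>)) {x\<in>{1..m} \<rightarrow>\<^sub>E UNIV. h x \<le> t}" for t
    unfolding assms(14)
    by (rule cdf_eq_PiM_law[OF assms(1) _ _ _ h])
       (use assms(10,11) in \<open>auto simp: independent_copies_def \<mu>_def\<close>)
  have cdf: "H\<^sub>F = cdf (distr M borel (indep_kernel m h Y))" by (simp add: assms(14) kernel_df_def)
  have lip: "\<bar>H\<^sub>F s - H\<^sub>F t\<bar> \<le> B * \<bar>s - t\<bar>" for s t
    unfolding cdf using B abs_le_D1 by (intro cdf_lipschitz_of_bounded_density[OF assms(1,15)] B0) blast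
  interpret kernel_process M X \<mu> \<rho> \<delta> m h L B H\<^sub>F
  proof
    show "distr M borel (X n) = \<mu>" if "n \<ge> 1" for n
      unfolding \<mu>_def by (rule stationary_distr[OF assms(3,2) that])
    show "integrable \<mu> (\<lambda>x. \<bar>x\<bar> powr \<rho>)"
      unfolding \<mu>_def using assms(7) X1 by (simp add: integrable_distr_eq)
  qed (fact assms h L df lip B0)+
  have "indep_kernel m h Y \<in> borel_measurable M"
    using distributed_measurable[OF assms(15)] by simp
  then have dist: "real_distribution (distr M borel (indep_kernel m h Y))" by simp
  have "isCont H\<^sub>F x" for x
  proof -
    have "(\<lambda>y. B * \<bar>y - x\<bar>) \<midarrow>x\<rightarrow> B * \<bar>x - x\<bar>" by (intro tendsto_intros)
    then have "(\<lambda>y. B * \<bar>y - x\<bar>) \<midarrow>x\<rightarrow> 0" by simp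
    then have "(\<lambda>y. H\<^sub>F y - H\<^sub>F x) \<midarrow>x\<rightarrow> 0"
      by (rule Lim_null_comparison[rotated]) (auto intro!: always_eventually lip)
    then show ?thesis unfolding isCont_def by (simp only: LIM_zero_iff)
  qed
  then have "H\<^sub>F \<xi>\<^sub>p = p"
    using cdf_gen_inverse[OF dist _ assms(19,20)] by (simp add: assms(21) cdf)
  then show ?thesis
    using bahadur_representation[OF assms(19) _ _ assms(22,16)] assms(20) by simp
qed

end
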